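(* Let $\mathcal{C}$ be the class of (connected) cacti graphs. Then the constant $y=C^\bullet(\rho)$ is the unique positive solution to $zB''(z)=1$, where $B'(z)=z+\frac{z^2}{2(1-z)}$. Moreover, $$\kappa=\frac{y^4-2y^3+2y-2}{(y^2-2y+2)(1+y)(y-1)}\approx1.20297$$ and $\sigma^2=1+B'''(y)y^2\approx2.29559$.
   Context: Graphs are finite, simple, undirected and vertex-labelled. A cactus graph is a (connected) graph in which each edge is contained in at most one cycle; equivalently every block is an edge or a cycle. $\mathcal{B}\subset\mathcal{C}$ is the subclass of graphs in $\mathcal{C}$ that are 2-connected (connected, at least three vertices, no cutvertex) or consist of a single edge with its two ends. $C(z)=\sum_n|\mathcal{C}_n|z^n/n!$ and $B(z)=\sum_n|\mathcal{B}_n|z^n/n!$ are the exponential generating functions (a subscript $n$ denotes the objects with vertex set $\{1,\dots,n\}$); $\rho$ is the radius of convergence of $C(z)$ and $C^\bullet(z)=zC'(z)$. A $\mathcal{B}'^\bullet$-object on a finite set $U$ is a graph in $\mathcal{B}$ with vertex set $U\cup\{*\}$, $*\notin U$, together with a distinguished root vertex in $U$; its size $|\cdot|$ is $|U|$; the exponential generating function is $B'^\bullet(z)=zB''(z)$. The scaling factor is $\kappa=\mathbb{E}[\mathsf{sp}(\mathsf{B})]$, where $\mathsf{sp}(\mathsf{B})$ is the graph distance in $\mathsf{B}$ from $*$ to the root and $\mathsf{B}\in\mathcal{B}'^\bullet$ follows the Boltzmann distribution with parameter $y$: each object on label set $\{1,\dots,m\}$ has probability $y^m/(m!\,B'^\bullet(y))$.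 Also $\sigma^2=\mathbb{E}[|\mathsf{B}|]$. The symbol $\approx$ indicates a numerical approximation. *)

theory Defs
  imports "HOL-Probability.Probability"
begin

text \<open>
  A graph is a pair of a vertex set and a set of two-element subsets of it; labelled
  graphs are compared by equality, not up to isomorphism.
\<close>

type_synonym 'a graph = "'a set \<times> 'a set set"

abbreviation verts :: "'a graph \<Rightarrow> 'a set" where "verts \<equiv> fst"
abbreviation edges :: "'a graph \<Rightarrow> 'a set set" where "edges \<equiv> snd"

definition simple_graph :: "'a graph \<Rightarrow> bool" where
  "simple_graph G \<longleftrightarrow> finite (verts G) \<and> edges G \<subseteq> {e. e \<subseteq> verts G \<and> card e = 2}"

definition adj :: "'a graph \<Rightarrow> ('a \<times> 'a) set" where
  "adj G = {(u, v). {u, v} \<in> edges G}"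

text \<open>The graph without vertices is not regarded as connected.\<close>

definition connected_graph :: "'a graph \<Rightarrow> bool" where
  "connected_graph G \<longleftrightarrow> verts G \<noteq> {} \<and> (\<forall>u\<in>verts G. \<forall>v\<in>verts G. (u, v) \<in> (adj G)\<^sup>*)"

text \<open>Only meaningful if \<^term>\<open>u\<close> and \<^term>\<open>v\<close> lie in the same component.\<close>

definition graph_dist :: "'a graph \<Rightarrow> 'a \<Rightarrow> 'a \<Rightarrow> nat" where
  "graph_dist G u v = (LEAST k. (u, v) \<in> adj G ^^ k)"

definition delete_vertex :: "'a graph \<Rightarrow> 'a \<Rightarrow> 'a graph" where
  "delete_vertex G v = (verts G - {v}, {e \<in> edges G. v \<notin> e})"

definition cutvertex :: "'a graph \<Rightarrow> 'a \<Rightarrow> bool" where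
  "cutvertex G v \<longleftrightarrow> v \<in> verts G \<and>
     (\<exists>u \<in> verts G - {v}. \<exists>w \<in> verts G - {v}.
        (u, w) \<in> (adj G)\<^sup>* \<and> (u, w) \<notin> (adj (delete_vertex G v))\<^sup>*)"

definition two_connected :: "'a graph \<Rightarrow> bool" where
  "two_connected G \<longleftrightarrow>
     connected_graph G \<and> card (verts G) \<ge> 3 \<and> (\<nexists>v. cutvertex G v)"

definition single_edge :: "'a graph \<Rightarrow> bool" where
  "single_edge G \<longleftrightarrow> (\<exists>u v. u \<noteq> v \<and> G = ({u, v}, {{u, v}}))"

text \<open>
  A cycle is a subgraph without isolated vertices, so it is represented by its edge set;
  the choice of a starting vertex and a direction is thereby forgotten.
\<close>

definition cycle_of :: "'a graph \<Rightarrow> 'a set set \<Rightarrow> bool" where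
  "cycle_of G F \<longleftrightarrow> F \<subseteq> edges G \<and>
     (\<exists>vs. distinct vs \<and> length vs \<ge> 3 \<and>
        F = {{vs ! i, vs ! ((i + 1) mod length vs)} | i. i < length vs})"

definition cacti :: "'a graph set" where
  "cacti = {G. simple_graph G \<and> connected_graph G \<and>
     (\<forall>e \<in> edges G. \<forall>F F'. cycle_of G F \<and> cycle_of G F' \<and> e \<in> F \<and> e \<in> F' \<longrightarrow> F = F')}"

definition blocks_in :: "'a graph set \<Rightarrow> 'a graph set" where
  "blocks_in \<C> = {G \<in> \<C>. two_connected G \<or> single_edge G}"

definition egf :: "nat graph set \<Rightarrow> real fps" where
  "egf K = Abs_fps (\<lambda>n. real (card {G \<in> K. verts G = {1..n}}) / fact n)"

definition C_egf :: "real fps" where "C_egf = egf cacti"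

definition B_egf :: "real fps" where "B_egf = egf (blocks_in cacti)"

text \<open>If the radius of convergence were infinite, \<open>rho\<close> would be \<open>0\<close>.\<close>

definition rho :: real where "rho = real_of_ereal (fps_conv_radius C_egf)"

definition C_pointed :: "real fps" where "C_pointed = fps_X * fps_deriv C_egf"

definition B_derived_pointed :: "real fps" where
  "B_derived_pointed = fps_X * fps_deriv (fps_deriv B_egf)"

text \<open>
  Derived and pointed objects on \<^term>\<open>U\<close>. The vertex \<open>*\<close> is the label \<^term>\<open>0::nat\<close>,
  which lies outside the label sets \<open>{1..m}\<close>.
\<close>

type_synonym pointed_graph = "nat graph \<times> nat"

definition derived_pointed :: "nat graph set \<Rightarrow> nat set \<Rightarrow> pointed_graph set" where
  "derived_pointed K U = {(G, r). G \<in> K \<and> verts G = insert 0 U \<and> r \<in> U}"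

definition obj_size :: "pointed_graph \<Rightarrow> nat" where
  "obj_size = (\<lambda>(G, r). card (verts G - {0}))"

definition sp :: "pointed_graph \<Rightarrow> nat" where
  "sp = (\<lambda>(G, r). graph_dist G 0 r)"

definition boltzmann :: "real \<Rightarrow> pointed_graph pmf" where
  "boltzmann y = embed_pmf (\<lambda>b.
     if b \<in> (\<Union>m. derived_pointed (blocks_in cacti) {1..m})
     then y ^ obj_size b / (fact (obj_size b) * eval_fps B_derived_pointed y) else 0)"

definition kappa :: "real \<Rightarrow> real" where
  "kappa y = measure_pmf.expectation (boltzmann y) (\<lambda>b. real (sp b))"

definition sigma_sq :: "real \<Rightarrow> real" where
  "sigma_sq y = measure_pmf.expectation (boltzmann y) (\<lambda>b. real (obj_size b))"

text \<open>The claimed closed form of \<open>B'\<close>; it has a pole at \<open>z = 1\<close>, where division by zero makes \<open>B1 1 = 1\<close>.\<close>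

definition B1 :: "real \<Rightarrow> real" where
  "B1 z = z + z\<^sup>2 / (2 * (1 - z))"

end

theory Submission
  imports Defs
begin

text \<open>
  Let \<open>T\<close> count rooted cacti, let \<open>E\<close> count cacti whose unlabelled root is not a cutvertex,
  and let \<open>P\<close> count cacti with an ordered pair of vertices joined by a path of bridges.
  Splitting off the part of a cactus behind its root that contains the least label gives
  \<open>C'' = E' C'\<close>. The root of an object counted by \<open>E\<close> is either a leaf or it closes a path of
  bridges to a cycle, so \<open>2 E = T + P\<close>, and removing the first bridge gives \<open>P = T + T P\<close>.
  Hence \<open>T = z exp (B'(T))\<close>, that is, \<open>T\<close> inverts \<open>psi t = t exp (- B'(t))\<close>.

  The function \<open>psi\<close> increases up to \<open>tau\<close>, the root of \<open>t B''(t) = 1\<close>, and decreases afterwards.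
  By induction the partial sums of \<open>T\<close> at \<open>psi t\<close> are at most \<open>t\<close>, so the radius of convergence is at
  least \<open>psi tau\<close>; it is not larger, since \<open>T\<close> would solve \<open>psi (T z) = z\<close> beyond the maximum of \<open>psi\<close>.
  Injectivity of \<open>psi\<close> below \<open>tau\<close> then yields \<open>T rho = tau\<close>.

  Two-connected cacti are cycles, each coming from exactly two orderings of the non-root vertices,
  which turns both expectations into explicit power series at \<open>tau\<close>.
\<close>

section \<open>Paths and cycles as edge sets\<close>

text \<open>The textbook route, a set of blocks at the root with rooted cacti substituted for their
  vertices, needs a theory of substitution and of block trees. Splitting into just two pieces, at a
  vertex or at a bridge, replaces it: each splitting is a bijection proved by recovering the pieces
  from their union, and a differential equation takes over the role of the exponential formula. The
  pair count \<open>P\<close> keeps blocks out of the recursion: a cycle through the root is visible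
  only as the path of bridges that remains when the root is removed. Evaluating
  \<open>T = z exp (B'(T))\<close> presupposes convergence, while the radius is to be derived from
  that very equation. Truncated series break the circle: they are polynomials and satisfy the
  identities as inequalities, because all coefficients are nonnegative. The counts of blocks and of
  cacti are never related directly. They meet in one cubic, which is \<open>t B''(t) = 1\<close>
  with the denominator \<open>2 (1 - t)^2\<close> cleared; it arises once from
  \<open>psi' = 0\<close> and once from the closed form of \<open>B''\<close>.\<close>

fun path_edges :: "'a list \<Rightarrow> 'a set set" where
  "path_edges (x # y # xs) = insert {x, y} (path_edges (y # xs))"
| "path_edges _ = {}"

lemma path_edges_Cons: "xs \<noteq> [] \<Longrightarrow> path_edges (x # xs) = insert {x, hd xs} (path_edges xs)"
  by (cases xs) auto

lemma path_edges_append: "path_edges (xs @ y # ys) = path_edges (xs @ [y]) \<union> path_edges (y # ys)"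
proof (induction xs)
  case (Cons x xs)
  then show ?case by (cases xs) auto
qed auto

lemma path_edges_snoc: "xs \<noteq> [] \<Longrightarrow> path_edges (xs @ [x]) = insert {last xs, x} (path_edges xs)"
  by (induction xs rule: path_edges.induct) auto

lemma path_edges_rev [simp]: "path_edges (rev xs) = path_edges xs"
proof (induction xs rule: path_edges.induct)
  case (1 x y xs)
  have "path_edges (rev (x # y # xs)) = path_edges (rev xs @ [y]) \<union> path_edges [y, x]"
    using path_edges_append[of "rev xs" y "[x]"] by simp
  with 1 show ?case by auto
qed auto

lemma path_edges_nth: "path_edges xs = {{xs ! i, xs ! Suc i} | i. Suc i < length xs}"
proof (induction xs rule: path_edges.induct)
  case (1 x y xs)
  have "{{(x # y # xs) ! i, (x # y # xs) ! Suc i} | i. Suc i < length (x # y # xs)} =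
     insert {x, y} {{(y # xs) ! i, (y # xs) ! Suc i} | i. Suc i < length (y # xs)}" (is "?L = insert _ ?R")
  proof (intro subset_antisym subsetI)
    fix e assume "e \<in> ?L"
    then obtain i where i: "Suc i < length (x # y # xs)" "e = {(x # y # xs) ! i, (x # y # xs) ! Suc i}"
      by blast
    then show "e \<in> insert {x, y} ?R" by (cases i) auto
  next
    fix e assume "e \<in> insert {x, y} ?R"
    then consider "e = {x, y}" | i where "Suc i < length (y # xs)" "e = {(y # xs) ! i, (y # xs) ! Suc i}"
      by blast
    then show "e \<in> ?L"
    proof cases
      case 1
      then show ?thesis by (intro CollectI exI[of _ 0]) auto
    next
      case 2
      then show ?thesis by (intro CollectI exI[of _ "Suc i"]) auto
    qed
  qed
  with 1 show ?case by simp
qed auto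

lemma path_edges_subset_set: "e \<in> path_edges xs \<Longrightarrow> e \<subseteq> set xs"
  by (induction xs rule: path_edges.induct) auto

lemma Union_path_edges: "2 \<le> length xs \<Longrightarrow> \<Union>(path_edges xs) = set xs"
proof (induction xs rule: path_edges.induct)
  case (1 x y xs)
  then show ?case by (cases xs) auto
qed auto

lemma card_path_edge: "distinct xs \<Longrightarrow> e \<in> path_edges xs \<Longrightarrow> card e = 2"
  by (induction xs rule: path_edges.induct) auto

lemma finite_path_edges [simp]: "finite (path_edges xs)"
  by (induction xs rule: path_edges.induct) auto

section \<open>Reachability through an edge set\<close>

definition linked :: "'a set set \<Rightarrow> ('a \<times> 'a) set" where
  "linked E = {(u, v). {u, v} \<in> E}\<^sup>*"

lemma rtrancl_adj: "(adj G)\<^sup>* = linked (edges G)"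
  by (simp add: linked_def adj_def)

lemma linked_refl [simp]: "(u, u) \<in> linked E"
  by (simp add: linked_def)

lemma linked_edge: "{u, v} \<in> E \<Longrightarrow> (u, v) \<in> linked E"
  by (auto simp: linked_def)

lemma linked_trans: "(u, v) \<in> linked E \<Longrightarrow> (v, w) \<in> linked E \<Longrightarrow> (u, w) \<in> linked E"
  by (auto simp: linked_def)

lemma linked_step: "{u, v} \<in> E \<Longrightarrow> (v, w) \<in> linked E \<Longrightarrow> (u, w) \<in> linked E"
  using linked_edge linked_trans by metis

lemma linked_sym: "(u, v) \<in> linked E \<Longrightarrow> (v, u) \<in> linked E"
proof -
  have "sym {(u, v). {u, v} \<in> E}" by (auto simp: sym_def insert_commute)
  then show "(u, v) \<in> linked E \<Longrightarrow> (v, u) \<in> linked E"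
    unfolding linked_def using sym_rtrancl by (metis symD)
qed

lemma linked_mono: "E \<subseteq> E' \<Longrightarrow> (u, v) \<in> linked E \<Longrightarrow> (u, v) \<in> linked E'"
  unfolding linked_def by (rule rtrancl_mono[THEN subsetD]) auto

lemma linked_induct [consumes 1, case_names base step]:
  assumes "(u, v) \<in> linked E" "P v"
    "\<And>x y. {x, y} \<in> E \<Longrightarrow> (y, v) \<in> linked E \<Longrightarrow> P y \<Longrightarrow> P x"
  shows "P u"
  using assms(1) unfolding linked_def
proof (induction rule: converse_rtrancl_induct)
  case base
  show ?case by fact
next
  case (step x y)
  then show ?case using assms(3)[of x y] by (simp add: linked_def)
qed

lemma linked_closed:
  assumes "(u, v) \<in> linked E" "u \<in> S" "\<And>x y. {x, y} \<in> E \<Longrightarrow> x \<in> S \<Longrightarrow> y \<in> S"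
  shows "v \<in> S"
proof -
  have "u \<in> S \<longrightarrow> v \<in> S"
    using assms(1) by (induction rule: linked_induct) (use assms(3) in blast)+
  with assms(2) show ?thesis by simp
qed

lemma linked_path:
  assumes "xs \<noteq> []" "path_edges xs \<subseteq> E"
  shows "(hd xs, last xs) \<in> linked E"
  using assms
proof (induction xs rule: path_edges.induct)
  case (1 x y xs)
  then show ?case using linked_step[of x y] by auto
qed auto

lemma linked_path_mem:
  assumes "x \<in> set xs" "path_edges xs \<subseteq> E"
  shows "(hd xs, x) \<in> linked E" "(x, last xs) \<in> linked E"
proof -
  obtain as bs where xs: "xs = as @ x # bs" using assms(1) by (meson split_list)
  have "path_edges (as @ [x]) \<subseteq> E" "path_edges (x # bs) \<subseteq> E"
    using assms(2) xs path_edges_append[of as x bs] by auto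
  then show "(hd xs, x) \<in> linked E" "(x, last xs) \<in> linked E"
    using linked_path[of "as @ [x]" E] linked_path[of "x # bs" E]
    by (auto simp: xs hd_append split: if_splits)
qed

lemma linked_obtain_path:
  assumes "(u, v) \<in> linked E"
  obtains xs where "distinct xs" "xs \<noteq> []" "hd xs = u" "last xs = v" "path_edges xs \<subseteq> E"
proof -
  have "\<exists>xs. distinct xs \<and> xs \<noteq> [] \<and> hd xs = u \<and> last xs = v \<and> path_edges xs \<subseteq> E"
    using assms
  proof (induction rule: linked_induct)
    case base
    then show ?case by (intro exI[of _ "[v]"]) auto
  next
    case (step x y)
    then obtain xs where xs: "distinct xs" "xs \<noteq> []" "hd xs = y" "last xs = v" "path_edges xs \<subseteq> E"
      by auto
    show ?case
    proof (cases "x \<in> set xs")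
      case True
      \<comment> \<open>Shortcut: the path restarts at its earlier visit of \<open>x\<close>, which
        keeps it simple.\<close>
      then obtain as bs where "xs = as @ x # bs" by (meson split_list)
      with xs show ?thesis
        using path_edges_append[of as x bs] by (intro exI[of _ "x # bs"]) auto
    next
      case False
      with xs step(1) show ?thesis by (intro exI[of _ "x # xs"]) (auto simp: path_edges_Cons)
    qed
  qed
  with that show ?thesis by blast
qed

text \<open>The closed list repeats its start \<open>v\<close>; at least two further vertices rule
  out an edge traversed back and forth.\<close>

definition is_cycle :: "'a set set \<Rightarrow> bool" where
  "is_cycle F \<longleftrightarrow> (\<exists>v xs. distinct (v # xs) \<and> 2 \<le> length xs \<and> F = path_edges (v # xs @ [v]))"

lemma cyclic_edges_eq_path_edges:
  assumes "vs \<noteq> []"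
  shows "{{vs ! i, vs ! ((i + 1) mod length vs)} | i. i < length vs} = path_edges (vs @ [hd vs])"
proof -
  have "{vs ! i, vs ! ((i + 1) mod length vs)} = {(vs @ [hd vs]) ! i, (vs @ [hd vs]) ! Suc i}"
    if "i < length vs" for i
    using that assms by (cases "Suc i = length vs") (auto simp: nth_append hd_conv_nth)
  then show ?thesis unfolding path_edges_nth by auto
qed

lemma cycle_of_iff: "cycle_of G F \<longleftrightarrow> F \<subseteq> edges G \<and> is_cycle F"
proof -
  have "(\<exists>vs. distinct vs \<and> length vs \<ge> 3 \<and>
        F = {{vs ! i, vs ! ((i + 1) mod length vs)} | i. i < length vs}) \<longleftrightarrow> is_cycle F" (is "?L \<longleftrightarrow> _")
  proof
    assume ?L
    then obtain vs where vs: "distinct vs" "length vs \<ge> 3"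
        "F = {{vs ! i, vs ! ((i + 1) mod length vs)} | i. i < length vs}" by blast
    then obtain v xs where [simp]: "vs = v # xs" by (cases vs) auto
    show "is_cycle F" unfolding is_cycle_def
      using vs cyclic_edges_eq_path_edges[of vs] by (intro exI[of _ v] exI[of _ xs]) auto
  next
    assume "is_cycle F"
    then obtain v xs where "distinct (v # xs)" "2 \<le> length xs" "F = path_edges (v # xs @ [v])"
      unfolding is_cycle_def by blast
    then show ?L using cyclic_edges_eq_path_edges[of "v # xs"] by (intro exI[of _ "v # xs"]) auto
  qed
  then show ?thesis unfolding cycle_of_def by blast
qed

text \<open>The list is cut at \<open>u\<close> and its two pieces are swapped, so any vertex of the
  cycle can serve as the start.\<close>

lemma is_cycle_rotate:
  assumes "is_cycle F" "u \<in> \<Union>F"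
  obtains xs where "distinct (u # xs)" "2 \<le> length xs" "F = path_edges (u # xs @ [u])"
proof -
  obtain v xs where v: "distinct (v # xs)" "2 \<le> length xs" "F = path_edges (v # xs @ [v])"
    using assms(1) unfolding is_cycle_def by blast
  show ?thesis
  proof (cases "u = v")
    case True
    with v that show ?thesis by blast
  next
    case False
    have "u \<in> set (v # xs @ [v])" using assms(2) v(3) path_edges_subset_set by fast
    with False obtain as bs where xs: "xs = as @ u # bs" using split_list[of u xs]
      by (metis Un_iff append_Cons append_Nil empty_iff list.set(1) set_ConsD set_append)
    have "F = path_edges (v # as @ [u]) \<union> path_edges (u # bs @ [v])"
      using path_edges_append[of "v # as" u "bs @ [v]"] v(3) xs by simp
    moreover have "path_edges (u # bs @ v # as @ [u]) = path_edges (u # bs @ [v]) \<union> path_edges (v # as @ [u])"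
      using path_edges_append[of "u # bs" v "as @ [u]"] by simp
    ultimately have "F = path_edges (u # (bs @ v # as) @ [u])" by auto
    then show ?thesis using that[of "bs @ v # as"] v xs by auto
  qed
qed

lemma closed_path_edges:
  assumes "xs \<noteq> []"
  shows "path_edges (v # xs @ [v]) = insert {v, hd xs} (insert {v, last xs} (path_edges xs))"
  using assms path_edges_snoc[of xs v] by (auto simp: path_edges_Cons insert_commute)

lemma is_cycle_edges_at:
  assumes "distinct (v # xs)" "2 \<le> length xs" "F = path_edges (v # xs @ [v])"
  shows "{e \<in> F. v \<in> e} = {{v, hd xs}, {v, last xs}}" "hd xs \<noteq> last xs"
    "hd xs \<noteq> v" "last xs \<noteq> v"
proof -
  have ne: "xs \<noteq> []" using assms by auto
  have "v \<notin> e" if "e \<in> path_edges xs" for e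
    using that assms(1) path_edges_subset_set by fastforce
  then show "{e \<in> F. v \<in> e} = {{v, hd xs}, {v, last xs}}"
    unfolding assms(3) closed_path_edges[OF ne] by auto
  show "hd xs \<noteq> v" "last xs \<noteq> v" using assms(1) ne hd_in_set last_in_set by fastforce+
  show "hd xs \<noteq> last xs" using assms(1,2) by (cases xs) (auto split: if_splits)
qed

lemma is_cycle_degree:
  assumes "is_cycle F" "v \<in> \<Union>F"
  shows "card {e \<in> F. v \<in> e} = 2"
proof -
  obtain xs where xs: "distinct (v # xs)" "2 \<le> length xs" "F = path_edges (v # xs @ [v])"
    using is_cycle_rotate[OF assms] .
  then show ?thesis using is_cycle_edges_at[OF xs] by (auto simp: doubleton_eq_iff)
qed

lemma is_cycle_card: "is_cycle F \<Longrightarrow> e \<in> F \<Longrightarrow> card e = 2"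
proof -
  assume "is_cycle F" "e \<in> F"
  then obtain v xs where v: "distinct (v # xs)" "2 \<le> length xs" "F = path_edges (v # xs @ [v])"
    unfolding is_cycle_def by blast
  then have ne: "xs \<noteq> []" by auto
  have "e = {v, hd xs} \<or> e = {v, last xs} \<or> e \<in> path_edges xs"
    using v(3) \<open>e \<in> F\<close> closed_path_edges[OF ne] by auto
  moreover have "distinct xs" using v by simp
  ultimately show "card e = 2" using is_cycle_edges_at(3,4)[OF v] card_path_edge[of xs e]
    by (metis card_2_iff)
qed

text \<open>Every vertex of a cycle has degree two, so a cycle inside another one cannot be left.\<close>

lemma is_cycle_subset_eq:
  assumes "is_cycle F0" "is_cycle F" "F0 \<subseteq> F"
  shows "F0 = F"
proof -
  have fin: "finite F" using assms(2) by (auto simp: is_cycle_def)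
  have all: "e \<in> F0" if "u \<in> \<Union>F0" "e \<in> F" "u \<in> e" for u e
  proof -
    have "u \<in> \<Union>F" using that assms(3) by blast
    then have "card {e \<in> F0. u \<in> e} = card {e \<in> F. u \<in> e}"
      using is_cycle_degree assms that by metis
    moreover have "{e \<in> F0. u \<in> e} \<subseteq> {e \<in> F. u \<in> e}" using assms(3) by auto
    ultimately have "{e \<in> F0. u \<in> e} = {e \<in> F. u \<in> e}" using fin by (intro card_subset_eq) auto
    with that show ?thesis by auto
  qed
  have walk: "path_edges zs \<subseteq> F0" if "path_edges zs \<subseteq> F" "hd zs \<in> \<Union>F0" for zs
    using that
  proof (induction zs rule: path_edges.induct)
    case (1 x y zs)
    have "{x, y} \<in> F0" using all[of x "{x, y}"] 1 by auto
    with 1 show ?case by auto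
  qed auto
  obtain v xs where v: "distinct (v # xs)" "2 \<le> length xs" "F0 = path_edges (v # xs @ [v])"
    using assms(1) unfolding is_cycle_def by blast
  have vF0: "v \<in> \<Union>F0" using v(3) Union_path_edges[of "v # xs @ [v]"] by auto
  then have "v \<in> \<Union>F" using assms(3) by blast
  then obtain ys where ys: "distinct (v # ys)" "2 \<le> length ys" "F = path_edges (v # ys @ [v])"
    using is_cycle_rotate[OF assms(2)] by blast
  have "F \<subseteq> F0" using walk[of "v # ys @ [v]"] ys vF0 by auto
  with assms(3) show ?thesis by auto
qed

text \<open>The remainder of the cycle is a detour around the edge. This is why no edge of a cycle
  is a bridge.\<close>

lemma is_cycle_linked_minus_edge:
  assumes "is_cycle F" "{u, v} \<in> F"
  shows "(u, v) \<in> linked (F - {{u, v}})"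
proof -
  obtain xs where xs: "distinct (u # xs)" "2 \<le> length xs" "F = path_edges (u # xs @ [u])"
    using is_cycle_rotate[OF assms(1), of u] assms(2) by blast
  have ne: "xs \<noteq> []" using xs by auto
  note at = is_cycle_edges_at[OF xs]
  have *: "path_edges xs \<subseteq> F - {{u, v}}"
    using xs path_edges_subset_set[of "{u, v}" xs] unfolding xs(3) closed_path_edges[OF ne] by auto
  have "{u, v} \<in> {e \<in> F. u \<in> e}" using assms by auto
  then consider "v = hd xs" | "v = last xs" unfolding at by (auto simp: doubleton_eq_iff)
  then show ?thesis
  proof cases
    case 1
    have "{u, last xs} \<in> F - {{u, v}}" using 1 at xs(3) closed_path_edges[OF ne, of u]
      by (auto simp: doubleton_eq_iff)
    moreover have "(last xs, v) \<in> linked (F - {{u, v}})"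
      using linked_path[OF ne *] 1 linked_sym by metis
    ultimately show ?thesis by (rule linked_step)
  next
    case 2
    have "{u, hd xs} \<in> F - {{u, v}}" using 2 at xs(3) closed_path_edges[OF ne, of u]
      by (auto simp: doubleton_eq_iff)
    moreover have "(hd xs, v) \<in> linked (F - {{u, v}})"
      using linked_path[OF ne *] 2 by metis
    ultimately show ?thesis by (rule linked_step)
  qed
qed

text \<open>A path can change sides only at a vertex met by both edge sets, that is, at
  \<open>x\<close>. The list \<open>butlast (tl zs)\<close> consists of the inner entries, so
  \<open>x\<close> may still occur at the two ends.\<close>

lemma path_edges_one_side:
  assumes "path_edges zs \<subseteq> E1 \<union> E2" "\<Union>E1 \<inter> \<Union>E2 \<subseteq> {x}" "x \<notin> set (butlast (tl zs))"
  shows "path_edges zs \<subseteq> E1 \<or> path_edges zs \<subseteq> E2"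
  using assms(1,3)
proof (induction zs rule: path_edges.induct)
  case (1 a b zs)
  show ?case
  proof (cases zs)
    case Nil
    with 1 show ?thesis by auto
  next
    case (Cons c cs)
    have "x \<notin> set (butlast (tl (b # zs)))" using 1(3) Cons by (auto split: if_splits)
    with 1 have IH: "path_edges (b # zs) \<subseteq> E1 \<or> path_edges (b # zs) \<subseteq> E2" by auto
    have "b \<noteq> x" using 1(3) Cons by auto
    moreover have "{b, c} \<in> path_edges (b # zs)" using Cons by auto
    ultimately have "{a, b} \<in> E1 \<longleftrightarrow> {b, c} \<in> E1" "{a, b} \<in> E2 \<longleftrightarrow> {b, c} \<in> E2"
      using assms(2) 1(2) Cons by auto
    with IH \<open>{b, c} \<in> path_edges (b # zs)\<close> 1(2) \<open>b \<noteq> x\<close> assms(2) show ?thesis by auto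
  qed
qed auto

text \<open>If the cycle contains \<open>x\<close>, it is rotated to start there; then
  \<open>x\<close> is not an inner entry of the closed list.\<close>

lemma is_cycle_one_side:
  assumes "is_cycle F" "F \<subseteq> E1 \<union> E2" "\<Union>E1 \<inter> \<Union>E2 \<subseteq> {x}"
  shows "F \<subseteq> E1 \<or> F \<subseteq> E2"
proof -
  obtain v xs where v: "distinct (v # xs)" "2 \<le> length xs" "F = path_edges (v # xs @ [v])"
    "x \<notin> set xs"
  proof (cases "x \<in> \<Union>F")
    case True
    then show ?thesis using is_cycle_rotate[OF assms(1) True] that by auto
  next
    case False
    obtain v xs where v: "distinct (v # xs)" "2 \<le> length xs" "F = path_edges (v # xs @ [v])"
      using assms(1) unfolding is_cycle_def by blast
    then have "x \<notin> set xs" using False Union_path_edges[of "v # xs @ [v]"] by auto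
    with v that show ?thesis by blast
  qed
  then show ?thesis using path_edges_one_side[of "v # xs @ [v]" E1 E2 x] assms by auto
qed

section \<open>Edge sets whose distinct cycles share no edge\<close>

definition edge_disjoint_cycles :: "'a set set \<Rightarrow> bool" where
  "edge_disjoint_cycles E \<longleftrightarrow> (\<forall>F F'. is_cycle F \<and> is_cycle F' \<and> F \<subseteq> E \<and> F' \<subseteq> E \<and> F \<inter> F' \<noteq> {} \<longrightarrow> F = F')"

lemma edge_disjoint_cyclesD:
  "\<lbrakk>edge_disjoint_cycles E; is_cycle F; is_cycle F'; F \<subseteq> E; F' \<subseteq> E; e \<in> F; e \<in> F'\<rbrakk> \<Longrightarrow> F = F'"
  unfolding edge_disjoint_cycles_def by blast

lemma edge_disjoint_cycles_mono: "edge_disjoint_cycles E \<Longrightarrow> E' \<subseteq> E \<Longrightarrow> edge_disjoint_cycles E'"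
  unfolding edge_disjoint_cycles_def by (meson subset_trans)

lemma is_cycle_nonempty: "is_cycle F \<Longrightarrow> F \<noteq> {}"
  by (auto simp: is_cycle_def path_edges_Cons)

text \<open>Each cycle stays on one side, and a common edge forces the same side for both: an edge
  in \<open>E1\<close> and in \<open>E2\<close> would have its two ends in
  \<open>{x}\<close>.\<close>

lemma edge_disjoint_cycles_Un:
  assumes "edge_disjoint_cycles E1" "edge_disjoint_cycles E2" "\<Union>E1 \<inter> \<Union>E2 \<subseteq> {x}"
  shows "edge_disjoint_cycles (E1 \<union> E2)"
  unfolding edge_disjoint_cycles_def
proof (intro allI impI, elim conjE)
  fix F F' assume F: "is_cycle F" "is_cycle F'" "F \<subseteq> E1 \<union> E2" "F' \<subseteq> E1 \<union> E2" "F \<inter> F' \<noteq> {}"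
  then obtain e where e: "e \<in> F" "e \<in> F'" by blast
  have no: "\<not> (e \<in> E1 \<and> e \<in> E2)"
  proof
    assume "e \<in> E1 \<and> e \<in> E2"
    then have "e \<subseteq> {x}" using assms(3) by blast
    then have "card e \<le> 1" using card_mono[of "{x}" e] by auto
    with is_cycle_card[OF F(1) e(1)] show False by auto
  qed
  have "F \<subseteq> E1 \<or> F \<subseteq> E2" "F' \<subseteq> E1 \<or> F' \<subseteq> E2"
    using is_cycle_one_side F assms(3) by metis+
  with e no consider "F \<subseteq> E1" "F' \<subseteq> E1" | "F \<subseteq> E2" "F' \<subseteq> E2" by blast
  then show "F = F'"
    using edge_disjoint_cyclesD[OF assms(1) F(1,2)] edge_disjoint_cyclesD[OF assms(2) F(1,2)] e
    by cases blast+
qed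

text \<open>A vertex of a cycle has degree two, which a single edge cannot provide.\<close>

lemma edge_disjoint_cycles_singleton: "edge_disjoint_cycles {e}"
proof -
  have "\<not> is_cycle F" if "F \<subseteq> {e}" for F
  proof
    assume F: "is_cycle F"
    then have "e \<in> F" "F = {e}" using that is_cycle_nonempty by blast+
    then obtain v where "v \<in> e" using is_cycle_card[OF F] by fastforce
    then have "card {e' \<in> F. v \<in> e'} = 1" using \<open>F = {e}\<close>
      by (simp add: Collect_conv_if)
    with is_cycle_degree[OF F, of v] \<open>e \<in> F\<close> \<open>v \<in> e\<close> show False by auto
  qed
  then show ?thesis by (auto simp: edge_disjoint_cycles_def)
qed

lemma edge_disjoint_cycles_empty: "edge_disjoint_cycles {}"
  using edge_disjoint_cycles_mono[OF edge_disjoint_cycles_singleton] by blast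

lemma cacti_iff:
  "G \<in> cacti \<longleftrightarrow> simple_graph G \<and> connected_graph G \<and> edge_disjoint_cycles (edges G)"
  unfolding cacti_def cycle_of_iff edge_disjoint_cycles_def by blast

section \<open>Decomposing cacti at a vertex and at a bridge\<close>

text \<open>An edge may be mapped to a longer walk or to a single point. The typical
  \<open>f\<close> below contracts a vertex set to one vertex.\<close>

lemma linked_map:
  assumes "(u, v) \<in> linked E" "\<And>x y. {x, y} \<in> E \<Longrightarrow> (f x, f y) \<in> linked E'"
  shows "(f u, f v) \<in> linked E'"
  using assms(1)
proof (induction rule: linked_induct)
  case (step x y)
  then show ?case using assms(2)[of x y] linked_trans by metis
qed simp

lemma linked_restrict:
  assumes "(u, v) \<in> linked E" "v \<in> S" "\<And>x y. {x, y} \<in> E \<Longrightarrow> y \<in> S \<Longrightarrow> x \<in> S"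
  shows "(u, v) \<in> linked {e \<in> E. e \<subseteq> S}"
proof -
  have "u \<in> S \<and> (u, v) \<in> linked {e \<in> E. e \<subseteq> S}" using assms(1)
  proof (induction rule: linked_induct)
    case (step x y)
    with assms(3) have "x \<in> S" by blast
    moreover from this step have "{x, y} \<in> {e \<in> E. e \<subseteq> S}" by blast
    ultimately show ?case using linked_step[of x y "{e \<in> E. e \<subseteq> S}" v] step(3) by simp
  qed (use assms(2) in simp)
  then show ?thesis ..
qed

definition cactus :: "'a set \<Rightarrow> 'a set set \<Rightarrow> bool" where
  "cactus V E \<longleftrightarrow> finite V \<and> V \<noteq> {} \<and> (\<forall>e\<in>E. e \<subseteq> V \<and> card e = 2) \<and>
     (\<forall>u\<in>V. \<forall>v\<in>V. (u, v) \<in> linked E) \<and> edge_disjoint_cycles E"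

lemma cactus_iff: "(V, E) \<in> cacti \<longleftrightarrow> cactus V E"
  by (auto simp: cacti_iff simple_graph_def connected_graph_def cactus_def rtrancl_adj)

lemma cactusD:
  assumes "cactus V E"
  shows "finite V" "V \<noteq> {}" "e \<in> E \<Longrightarrow> e \<subseteq> V" "e \<in> E \<Longrightarrow> card e = 2"
    "u \<in> V \<Longrightarrow> v \<in> V \<Longrightarrow> (u, v) \<in> linked E" "edge_disjoint_cycles E"
  using assms by (auto simp: cactus_def)

lemma cactusI:
  assumes "finite V" "r \<in> V" "\<And>e. e \<in> E \<Longrightarrow> e \<subseteq> V \<and> card e = 2"
    "\<And>u. u \<in> V \<Longrightarrow> (u, r) \<in> linked E" "edge_disjoint_cycles E"
  shows "cactus V E"
proof -
  have "(u, v) \<in> linked E" if "u \<in> V" "v \<in> V" for u v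
    using assms(4)[OF that(1)] linked_sym[OF assms(4)[OF that(2)]] linked_trans by metis
  with assms show ?thesis by (auto simp: cactus_def)
qed

lemma cactus_edge_ends:
  assumes "cactus V E" "{u, v} \<in> E"
  shows "u \<in> V" "v \<in> V" "u \<noteq> v"
  using cactusD(3,4)[OF assms(1) assms(2)] by auto

lemma cactus_obtain_ends:
  assumes "cactus V E" "e \<in> E"
  obtains u v where "e = {u, v}" "u \<in> V" "v \<in> V" "u \<noteq> v"
proof -
  obtain u v where "e = {u, v}" using cactusD(4)[OF assms] by (auto simp: card_2_iff)
  with cactus_edge_ends[OF assms(1)] assms(2) that show ?thesis by metis
qed

lemma cactus_singleton: "cactus {a} {}"
  by (auto simp: cactus_def edge_disjoint_cycles_empty)

lemma cactus_edge: "a \<noteq> b \<Longrightarrow> cactus {a, b} {{a, b}}"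
  by (rule cactusI[of _ b]) (auto simp: edge_disjoint_cycles_singleton intro: linked_edge)

lemma cactus_Un:
  assumes "cactus V1 E1" "cactus V2 E2" "V1 \<inter> V2 = {x}"
  shows "cactus (V1 \<union> V2) (E1 \<union> E2)"
proof (rule cactusI[of _ x])
  show "(u, x) \<in> linked (E1 \<union> E2)" if "u \<in> V1 \<union> V2" for u
  proof -
    have "x \<in> V1" "x \<in> V2" using assms(3) by auto
    then show ?thesis using that cactusD(5)[OF assms(1), of u x] cactusD(5)[OF assms(2), of u x]
      linked_mono[of E1 "E1 \<union> E2" u x] linked_mono[of E2 "E1 \<union> E2" u x] by auto
  qed
  show "edge_disjoint_cycles (E1 \<union> E2)"
    using cactusD(3)[OF assms(1)] cactusD(3)[OF assms(2)] assms(3)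
    by (intro edge_disjoint_cycles_Un[where x = x] cactusD(6)[OF assms(1)] cactusD(6)[OF assms(2)]) blast
  show "e \<subseteq> V1 \<union> V2 \<and> card e = 2" if "e \<in> E1 \<union> E2" for e
    using that cactusD(3,4)[OF assms(1)] cactusD(3,4)[OF assms(2)] by auto
qed (use assms cactusD(1) in auto)

lemma cactus_leaf:
  assumes "cactus V E" "a \<in> V" "x \<notin> V"
  shows "cactus (insert x V) (insert {x, a} E)"
proof -
  have "V \<inter> {x, a} = {a}" "x \<noteq> a" using assms by auto
  from cactus_Un[OF assms(1) cactus_edge[OF this(2)] this(1)] show ?thesis
    using assms(2) by (simp add: insert_absorb Un_commute)
qed

text \<open>The new edge is first attached to \<open>V1\<close> with \<open>b\<close> as a leaf;
  what remains is gluing at the single common vertex \<open>b\<close>.\<close>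

lemma cactus_join:
  assumes "cactus V1 E1" "cactus V2 E2" "V1 \<inter> V2 = {}" "a \<in> V1" "b \<in> V2"
  shows "cactus (V1 \<union> V2) (insert {a, b} (E1 \<union> E2))"
proof -
  have "cactus (insert b V1) (insert {b, a} E1)"
    using cactus_leaf[OF assms(1,4), of b] assms by auto
  moreover have "insert b V1 \<inter> V2 = {b}" using assms by auto
  ultimately have "cactus (insert b V1 \<union> V2) (insert {b, a} E1 \<union> E2)"
    using cactus_Un assms(2) by metis
  moreover have "insert b V1 \<union> V2 = V1 \<union> V2" using assms(5) by auto
  ultimately show ?thesis by (simp add: insert_commute)
qed

lemma Un_edges_restrict:
  assumes "cactus V1 E1" "cactus V2 E2" "V1 \<inter> V2 \<subseteq> {x}"
  shows "{e \<in> E1 \<union> E2. e \<subseteq> V1} = E1" "{e \<in> E1 \<union> E2. e \<subseteq> V2} = E2"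
proof -
  have no: False if "e \<in> E1 \<or> e \<in> E2" "e \<subseteq> V1" "e \<subseteq> V2" for e
  proof -
    have "card e = 2" using that cactusD(4)[OF assms(1)] cactusD(4)[OF assms(2)] by auto
    moreover have "e \<subseteq> {x}" using that assms(3) by auto
    ultimately show False using card_mono[of "{x}" e] by auto
  qed
  then show "{e \<in> E1 \<union> E2. e \<subseteq> V1} = E1" "{e \<in> E1 \<union> E2. e \<subseteq> V2} = E2"
    using cactusD(3)[OF assms(1)] cactusD(3)[OF assms(2)] by blast+
qed

text \<open>The objects behind \<open>E\<close>: what is left after removing the root
  \<open>x\<close> is still connected. In all uses \<open>x\<close> lies outside
  \<open>S\<close>.\<close>

definition planted :: "'a \<Rightarrow> 'a set \<Rightarrow> 'a set set \<Rightarrow> bool" where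
  "planted x S E \<longleftrightarrow> cactus (insert x S) E \<and>
     (\<forall>u\<in>S. \<forall>v\<in>S. (u, v) \<in> linked {e \<in> E. x \<notin> e})"

text \<open>The last three conclusions recover \<open>S\<close>, \<open>E1\<close> and
  \<open>E2\<close> from the union; they give injectivity of the gluing map.\<close>

lemma glue_at_root_component:
  assumes "x \<notin> U" "S \<subseteq> U" "u \<in> S" "planted x S E1" "cactus (insert x (U - S)) E2"
  shows "cactus (insert x U) (E1 \<union> E2)"
    "S = {v. (u, v) \<in> linked {e \<in> E1 \<union> E2. x \<notin> e}}"
    "E1 = {e \<in> E1 \<union> E2. e \<subseteq> insert x S}" "E2 = {e \<in> E1 \<union> E2. e \<subseteq> insert x (U - S)}"
proof -
  have c1: "cactus (insert x S) E1" using assms by (simp add: planted_def)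
  have I: "insert x S \<inter> insert x (U - S) = {x}" using assms by auto
  show "E1 = {e \<in> E1 \<union> E2. e \<subseteq> insert x S}" "E2 = {e \<in> E1 \<union> E2. e \<subseteq> insert x (U - S)}"
    using Un_edges_restrict[OF c1 assms(5)] I by auto
  have "insert x S \<union> insert x (U - S) = insert x U" using assms by auto
  with cactus_Un[OF c1 assms(5) I] show "cactus (insert x U) (E1 \<union> E2)" by simp
  have "(u, v) \<in> linked {e \<in> E1 \<union> E2. x \<notin> e}" if "v \<in> S" for v
    using linked_mono[of "{e \<in> E1. x \<notin> e}" "{e \<in> E1 \<union> E2. x \<notin> e}"] that assms(3,4)
    by (auto simp: planted_def)
  moreover have "v \<in> S" if "(u, v) \<in> linked {e \<in> E1 \<union> E2. x \<notin> e}" for v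
    using that assms(3)
  proof (rule linked_closed)
    fix y z assume "{y, z} \<in> {e \<in> E1 \<union> E2. x \<notin> e}" "y \<in> S"
    then show "z \<in> S"
      using cactusD(3)[OF c1, of "{y, z}"] cactusD(3)[OF assms(5), of "{y, z}"] by auto
  qed
  ultimately show "S = {v. (u, v) \<in> linked {e \<in> E1 \<union> E2. x \<notin> e}}" by blast
qed

text \<open>Edges leave \<open>S\<close> only towards \<open>x\<close>, so contracting
  \<open>S\<close> to \<open>x\<close> turns a walk between vertices outside \<open>S\<close> into
  one that avoids \<open>S\<close>.\<close>

lemma cactus_contract_side:
  assumes "cactus (insert x U) E" "x \<notin> U" "S \<subseteq> U"
    "\<And>y z. {y, z} \<in> E \<Longrightarrow> y \<in> S \<Longrightarrow> z \<in> insert x S"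
  shows "cactus (insert x (U - S)) {e \<in> E. e \<subseteq> insert x (U - S)}"
proof (rule cactusI[of _ x])
  let ?E2 = "{e \<in> E. e \<subseteq> insert x (U - S)}"
  let ?f = "\<lambda>w. if w \<in> S then x else w"
  show "finite (insert x (U - S))" using cactusD(1)[OF assms(1)] by simp
  show "(w, x) \<in> linked ?E2" if "w \<in> insert x (U - S)" for w
  proof -
    have "(w, x) \<in> linked E" using cactusD(5)[OF assms(1)] that by auto
    then have L: "(?f w, ?f x) \<in> linked ?E2"
    proof (rule linked_map)
      fix y z assume yz: "{y, z} \<in> E"
      then have zy: "{z, y} \<in> E" by (simp add: insert_commute)
      have "y \<in> insert x U" "z \<in> insert x U" using cactus_edge_ends[OF assms(1) yz] by auto
      then consider "y \<in> S" "z \<in> insert x S" | "z \<in> S" "y \<in> insert x S"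
        | "y \<in> insert x (U - S)" "z \<in> insert x (U - S)"
        using assms(4)[OF yz] assms(4)[OF zy] by blast
      then show "(?f y, ?f z) \<in> linked ?E2"
      proof cases
        case 3
        then have f: "?f y = y" "?f z = z" using assms by auto
        have "{y, z} \<in> ?E2" using 3 yz by auto
        then have "(y, z) \<in> linked ?E2" by (rule linked_edge)
        then show ?thesis unfolding f .
      qed (use assms(2,3) in auto)
    qed
    have f: "?f w = w" "?f x = x" using that assms(2,3) by auto
    show ?thesis using L unfolding f .
  qed
  show "edge_disjoint_cycles ?E2" by (rule edge_disjoint_cycles_mono[OF cactusD(6)[OF assms(1)]]) auto
qed (use cactusD(4)[OF assms(1)] in auto)

text \<open>The inverse of gluing. Edges avoiding \<open>x\<close> lead neither out of the component
  \<open>S\<close> nor out of its complement in \<open>U\<close>, so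
  \<open>cactus_contract_side\<close> applies to both sides.\<close>

lemma split_at_root_component:
  assumes "cactus (insert x U) E" "x \<notin> U" "u \<in> U"
  defines "S \<equiv> {v. (u, v) \<in> linked {e \<in> E. x \<notin> e}}"
  shows "S \<subseteq> U" "u \<in> S" "planted x S {e \<in> E. e \<subseteq> insert x S}"
    "cactus (insert x (U - S)) {e \<in> E. e \<subseteq> insert x (U - S)}"
    "E = {e \<in> E. e \<subseteq> insert x S} \<union> {e \<in> E. e \<subseteq> insert x (U - S)}"
proof -
  show u: "u \<in> S" by (simp add: S_def)
  show SU: "S \<subseteq> U"
  proof
    fix v assume "v \<in> S"
    then have "(u, v) \<in> linked {e \<in> E. x \<notin> e}" by (simp add: S_def)
    then show "v \<in> U" using assms(3)
      by (rule linked_closed) (use cactus_edge_ends[OF assms(1)] in blast)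
  qed
  have closed: "z \<in> insert x S" if "{y, z} \<in> E" "y \<in> S" for y z
  proof (cases "z = x")
    case False
    then have "{y, z} \<in> {e \<in> E. x \<notin> e}" using that SU assms(2) by auto
    from linked_edge[OF this] have "(u, z) \<in> linked {e \<in> E. x \<notin> e}"
      using that(2) linked_trans[of u y _ z] by (simp add: S_def)
    then show ?thesis by (simp add: S_def)
  qed simp
  show "cactus (insert x (U - S)) {e \<in> E. e \<subseteq> insert x (U - S)}"
    by (rule cactus_contract_side[OF assms(1,2) SU]) (use closed in blast)
  have closed': "z \<in> insert x (U - S)" if "{y, z} \<in> E" "y \<in> U - S" for y z
    using closed[of z y] that cactus_edge_ends[OF assms(1) that(1)] assms(2) by (auto simp: insert_commute)
  have "U - (U - S) = S" using SU by auto
  then have c: "cactus (insert x S) {e \<in> E. e \<subseteq> insert x S}"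
    using cactus_contract_side[OF assms(1,2), of "U - S"] closed' by auto
  have lk: "(u, v) \<in> linked {e \<in> {e \<in> E. e \<subseteq> insert x S}. x \<notin> e}" if "v \<in> S" for v
  proof -
    have "(v, u) \<in> linked {e \<in> E. x \<notin> e}" using that by (auto simp: S_def intro: linked_sym)
    then have "(v, u) \<in> linked {e \<in> {e \<in> E. x \<notin> e}. e \<subseteq> S}"
    proof (rule linked_restrict)
      fix y z assume "{y, z} \<in> {e \<in> E. x \<notin> e}" "z \<in> S"
      then show "y \<in> S" using closed[of z y] by (auto simp: insert_commute)
    qed (rule u)
    then have "(v, u) \<in> linked {e \<in> {e \<in> E. e \<subseteq> insert x S}. x \<notin> e}"
      by (rule linked_mono[rotated]) auto
    then show ?thesis by (rule linked_sym)
  qed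
  show "planted x S {e \<in> E. e \<subseteq> insert x S}"
    unfolding planted_def using c linked_trans[OF linked_sym[OF lk] lk] by blast
  have "e \<subseteq> insert x S \<or> e \<subseteq> insert x (U - S)" if e: "e \<in> E" for e
  proof -
    obtain y z where yz: "e = {y, z}" using cactusD(4)[OF assms(1) e] by (auto simp: card_2_iff)
    then have "y \<in> insert x U" "z \<in> insert x U" using cactusD(3)[OF assms(1) e] by auto
    then show ?thesis using closed[of y z] closed[of z y] e yz by (auto simp: insert_commute)
  qed
  then show "E = {e \<in> E. e \<subseteq> insert x S} \<union> {e \<in> E. e \<subseteq> insert x (U - S)}" by blast
qed

section \<open>Bridges and paths of bridges\<close>

definition bridge_edges :: "'a set set \<Rightarrow> 'a set set" where
  "bridge_edges E = {e \<in> E. \<forall>u v. e = {u, v} \<longrightarrow> (u, v) \<notin> linked (E - {e})}"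

lemma bridge_edges_subset: "bridge_edges E \<subseteq> E"
  by (auto simp: bridge_edges_def)

lemma bridge_not_in_cycle:
  assumes "e \<in> bridge_edges E" "is_cycle F" "F \<subseteq> E"
  shows "e \<notin> F"
proof
  assume e: "e \<in> F"
  then obtain u v where uv: "e = {u, v}" using is_cycle_card[OF assms(2) e] by (auto simp: card_2_iff)
  have "(u, v) \<in> linked (F - {e})" using is_cycle_linked_minus_edge assms(2) e uv by metis
  then have "(u, v) \<in> linked (E - {e})" by (rule linked_mono[rotated]) (use assms in auto)
  with assms(1) uv show False by (auto simp: bridge_edges_def)
qed

lemma linked_imp_cycle:
  assumes "(u, v) \<in> linked (E - {{u, v}})" "u \<noteq> v"
  obtains F where "is_cycle F" "{u, v} \<in> F" "F \<subseteq> insert {u, v} E"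
proof -
  obtain xs where xs: "distinct xs" "xs \<noteq> []" "hd xs = u" "last xs = v" "path_edges xs \<subseteq> E - {{u, v}}"
    using linked_obtain_path[OF assms(1)] .
  then obtain ys where ys: "xs = u # ys" by (cases xs) auto
  with xs assms(2) have ne: "ys \<noteq> []" by auto
  \<comment> \<open>A path with a single edge would be the deleted edge itself.\<close>
  have "2 \<le> length ys"
  proof (rule ccontr)
    assume "\<not> 2 \<le> length ys"
    with ne obtain z where "ys = [z]" by (cases ys) (auto simp: not_le)
    with xs ys show False by auto
  qed
  moreover have F: "path_edges (u # ys @ [u]) = insert {u, v} (path_edges xs)"
    using path_edges_snoc[of xs u] xs ys by (auto simp: insert_commute)
  ultimately have "is_cycle (path_edges (u # ys @ [u]))"
    using xs ys is_cycle_def[of "path_edges (u # ys @ [u])"] by auto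
  with that F xs(5) show ?thesis by blast
qed

lemma closing_path_is_cycle:
  assumes "distinct xs" "xs \<noteq> []" "hd xs = a" "last xs = b" "a \<noteq> b" "x \<notin> set xs"
  shows "is_cycle (path_edges (x # xs @ [x]))"
    "path_edges (x # xs @ [x]) = insert {x, a} (insert {x, b} (path_edges xs))"
proof -
  have "2 \<le> length xs" using assms(2-5) by (cases xs; cases "tl xs") (auto split: if_splits)
  then show "is_cycle (path_edges (x # xs @ [x]))" using assms unfolding is_cycle_def by auto
  show "path_edges (x # xs @ [x]) = insert {x, a} (insert {x, b} (path_edges xs))"
    using closed_path_edges assms by metis
qed

text \<open>If \<open>E'\<close> missed a bridge of the path, the link between the ends inside
  \<open>E'\<close> together with the two remaining pieces of the path would connect the ends of
  that bridge without it.\<close>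

lemma separating_bridges_in_path:
  assumes "distinct xs" "xs \<noteq> []" "path_edges xs \<subseteq> bridge_edges E"
    "(hd xs, last xs) \<in> linked E'" "E' \<subseteq> E"
  shows "path_edges xs \<subseteq> E'"
proof
  fix e assume e: "e \<in> path_edges xs"
  then obtain i where i: "Suc i < length xs" "e = {xs ! i, xs ! Suc i}"
    by (auto simp: path_edges_nth)
  define u v where "u = xs ! i" and "v = xs ! Suc i"
  define as bs where "as = take i xs" and "bs = drop (Suc (Suc i)) xs"
  have xs: "xs = as @ u # v # bs" unfolding as_def bs_def u_def v_def using i
    by (metis Cons_nth_drop_Suc Suc_lessD append_take_drop_id)
  have uv: "e = {u, v}" using i by (simp add: u_def v_def)
  show "e \<in> E'"
  proof (rule ccontr)
    assume "e \<notin> E'"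
    then have 1: "(hd xs, last xs) \<in> linked (E - {e})"
      using assms(4,5) by (auto intro: linked_mono[rotated])
    have "e \<notin> path_edges (as @ [u])" "e \<notin> path_edges (v # bs)"
      using assms(1) xs path_edges_subset_set uv by fastforce+
    moreover have "path_edges xs = path_edges (as @ [u]) \<union> path_edges (u # v # bs)"
      using path_edges_append[of as u "v # bs"] xs by simp
    ultimately have "path_edges (as @ [u]) \<subseteq> E - {e}" "path_edges (v # bs) \<subseteq> E - {e}"
      using assms(3) bridge_edges_subset[of E] by auto
    then have "(hd (as @ [u]), last (as @ [u])) \<in> linked (E - {e})" "(hd (v # bs), last (v # bs)) \<in> linked (E - {e})"
      by (intro linked_path; simp)+
    moreover have "hd (as @ [u]) = hd xs" "last (v # bs) = last xs" using xs by (auto simp: hd_append)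
    ultimately have "(hd xs, u) \<in> linked (E - {e})" "(v, last xs) \<in> linked (E - {e})" by auto
    with 1 have "(u, v) \<in> linked (E - {e})" using linked_sym linked_trans by metis
    moreover have "e \<in> bridge_edges E" using e assms(3) by blast
    ultimately show False using uv by (auto simp: bridge_edges_def)
  qed
qed

text \<open>
  Every cycle through the new vertex contains all bridges separating its two neighbours, hence
  contains the cycle closed by the path of bridges and equals it.
\<close>

lemma cactus_close_bridged:
  assumes "cactus S E" "x \<notin> S" "a \<in> S" "b \<in> S" "a \<noteq> b" "(a, b) \<in> linked (bridge_edges E)"
  shows "cactus (insert x S) (insert {x, a} (insert {x, b} E))"
proof (rule cactusI[of _ a])
  let ?E = "insert {x, a} (insert {x, b} E)"
  obtain xs where xs: "distinct xs" "xs \<noteq> []" "hd xs = a" "last xs = b" "path_edges xs \<subseteq> bridge_edges E"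
    using linked_obtain_path[OF assms(6)] .
  have xE: "x \<notin> e" if "e \<in> E" for e using that cactusD(3)[OF assms(1)] assms(2) by auto
  have "2 \<le> length xs" using xs assms(5) by (cases xs; cases "tl xs") (auto split: if_splits)
  then have xxs: "x \<notin> set xs" using Union_path_edges xE xs(5) bridge_edges_subset by fastforce
  let ?F0 = "path_edges (x # xs @ [x])"
  note F0 = closing_path_is_cycle[OF xs(1-4) assms(5) xxs]
  have through: "F = ?F0" if F: "is_cycle F" "F \<subseteq> ?E" "\<not> F \<subseteq> E" for F
  proof -
    have "x \<in> \<Union>F" using F by auto
    then obtain ys where ys: "distinct (x # ys)" "2 \<le> length ys" "F = path_edges (x # ys @ [x])"
      using is_cycle_rotate[OF F(1)] by blast
    note at = is_cycle_edges_at[OF ys]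
    have ne: "ys \<noteq> []" using ys by auto
    have "{e \<in> F. x \<in> e} \<subseteq> {{x, a}, {x, b}}" using F(2) xE by auto
    then have *: "hd ys = a \<and> last ys = b \<or> hd ys = b \<and> last ys = a"
      unfolding at(1) using at(2-4) by (auto simp: doubleton_eq_iff)
    have sub: "path_edges ys \<subseteq> E"
      using F(2) path_edges_subset_set[of _ ys] ys(1) unfolding ys(3) closed_path_edges[OF ne] by auto
    have "(hd xs, last xs) \<in> linked (path_edges ys)"
      using linked_path[OF ne order_refl] * linked_sym xs by metis
    then have "path_edges xs \<subseteq> path_edges ys"
      using separating_bridges_in_path[OF xs(1,2,5)] sub by blast
    then have "?F0 \<subseteq> F"
      unfolding F0(2) ys(3) closed_path_edges[OF ne] using * by auto
    then show ?thesis using is_cycle_subset_eq[OF F0(1) F(1)] by simp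
  qed
  show "edge_disjoint_cycles ?E"
    unfolding edge_disjoint_cycles_def
  proof (intro allI impI, elim conjE)
    fix F F' assume F: "is_cycle F" "is_cycle F'" "F \<subseteq> ?E" "F' \<subseteq> ?E" "F \<inter> F' \<noteq> {}"
    \<comment> \<open>A cycle inside \<open>E\<close> avoids \<open>x\<close> and contains no
      bridge, whereas every edge of \<open>?F0\<close> is incident to \<open>x\<close> or is a
      bridge.\<close>
    have no: False if G: "is_cycle G" "G \<subseteq> E" "?F0 \<inter> G \<noteq> {}" for G
    proof -
      from G(3) obtain e where "e \<in> ?F0" "e \<in> G" by blast
      then have "e \<in> path_edges xs" using G(2) xE unfolding F0(2) by auto
      then show False using bridge_not_in_cycle[of e E G] xs(5) G \<open>e \<in> G\<close> by auto
    qed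
    consider "F \<subseteq> E" "F' \<subseteq> E" | "F = ?F0" "F' \<subseteq> E" | "F' = ?F0" "F \<subseteq> E" | "F = ?F0" "F' = ?F0"
      using through F by metis
    then show "F = F'"
    proof cases
      case 1
      then show ?thesis using cactusD(6)[OF assms(1)] F unfolding edge_disjoint_cycles_def by blast
    next
      case 2
      then show ?thesis using no[of F'] F by auto
    next
      case 3
      then show ?thesis using no[of F] F by auto
    qed simp
  qed
  show "(u, a) \<in> linked ?E" if "u \<in> insert x S" for u
    using that linked_edge[of x a ?E] cactusD(5)[OF assms(1) _ assms(3), of u]
      linked_mono[of E ?E u a] by auto
  show "e \<subseteq> insert x S \<and> card e = 2" if "e \<in> ?E" for e
    using that cactusD(3,4)[OF assms(1), of e] assms(2-4) by (auto simp: card_insert_if)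
qed (use assms cactusD(1) in auto)

lemma planted_path_cycle:
  assumes "planted x S E" "x \<notin> S" "{x, a} \<in> E" "{x, b} \<in> E" "a \<noteq> b"
  obtains xs where "distinct xs" "xs \<noteq> []" "hd xs = a" "last xs = b" "x \<notin> set xs"
    "path_edges xs \<subseteq> {e \<in> E. x \<notin> e}"
    "is_cycle (path_edges (x # xs @ [x]))" "path_edges (x # xs @ [x]) \<subseteq> E"
    "path_edges (x # xs @ [x]) = insert {x, a} (insert {x, b} (path_edges xs))"
proof -
  have c: "cactus (insert x S) E" using assms(1) by (simp add: planted_def)
  have "a \<in> S" "b \<in> S" using cactus_edge_ends[OF c assms(3)] cactus_edge_ends[OF c assms(4)] by auto
  then have "(a, b) \<in> linked {e \<in> E. x \<notin> e}" using assms(1) by (simp add: planted_def)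
  from linked_obtain_path[OF this] obtain xs where xs: "distinct xs" "xs \<noteq> []"
      "hd xs = a" "last xs = b" "path_edges xs \<subseteq> {e \<in> E. x \<notin> e}" .
  have "2 \<le> length xs" using xs assms(5) by (cases xs; cases "tl xs") (auto split: if_splits)
  then have "x \<notin> set xs" using Union_path_edges xs(5) by fastforce
  note F = closing_path_is_cycle[OF xs(1-4) assms(5) this]
  have "path_edges (x # xs @ [x]) \<subseteq> E" using xs(5) assms(3,4) unfolding F(2) by auto
  then show ?thesis using that xs F \<open>x \<notin> set xs\<close> by blast
qed

text \<open>The edge \<open>{x, a}\<close> would lie on a cycle returning through \<open>b\<close>
  and on one returning through \<open>c\<close>. These coincide in a cactus, but a cycle has only
  two edges at \<open>x\<close>.\<close>

lemma planted_degree_two: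
  assumes "planted x S E" "x \<notin> S" "{x, a} \<in> E" "{x, b} \<in> E" "a \<noteq> b" "{x, c} \<in> E"
  shows "c = a \<or> c = b"
proof (rule ccontr)
  assume c: "\<not> (c = a \<or> c = b)"
  obtain F where F: "is_cycle F" "F \<subseteq> E" "{e \<in> F. x \<in> e} = {{x, a}, {x, b}}"
  proof (rule planted_path_cycle[OF assms(1-5)])
    fix xs assume *: "path_edges xs \<subseteq> {e \<in> E. x \<notin> e}"
      "is_cycle (path_edges (x # xs @ [x]))" "path_edges (x # xs @ [x]) \<subseteq> E"
      "path_edges (x # xs @ [x]) = insert {x, a} (insert {x, b} (path_edges xs))"
    have "{e \<in> path_edges (x # xs @ [x]). x \<in> e} = {{x, a}, {x, b}}"
      using *(1) unfolding *(4) by blast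
    with that *(2,3) show thesis by blast
  qed
  obtain F' where F': "is_cycle F'" "F' \<subseteq> E" "{x, a} \<in> F'" "{x, c} \<in> F'"
  proof (rule planted_path_cycle[OF assms(1-3,6)])
    fix xs assume "is_cycle (path_edges (x # xs @ [x]))" "path_edges (x # xs @ [x]) \<subseteq> E"
      "path_edges (x # xs @ [x]) = insert {x, a} (insert {x, c} (path_edges xs))"
    with that show thesis by blast
  qed (use c in auto)
  have "cactus (insert x S) E" using assms(1) by (simp add: planted_def)
  then have "F = F'"
    using edge_disjoint_cyclesD[OF cactusD(6) F(1) F'(1) F(2) F'(2), of _ "{x, a}"] F(3) F'(3) by blast
  then have "{x, c} \<in> {e \<in> F. x \<in> e}" using F'(4) by simp
  then have "{x, c} \<in> {{x, a}, {x, b}}" unfolding F(3) .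
  with c show False by (auto simp: doubleton_eq_iff)
qed

text \<open>An edge of the path that is no bridge after removal of \<open>x\<close> would lie on a
  cycle avoiding \<open>x\<close>, a second cycle sharing this edge with the one closed through
  \<open>x\<close>.\<close>

lemma planted_bridged:
  assumes "planted x S E" "x \<notin> S" "{x, a} \<in> E" "{x, b} \<in> E" "a \<noteq> b"
  shows "(a, b) \<in> linked (bridge_edges {e \<in> E. x \<notin> e})"
proof -
  let ?E = "{e \<in> E. x \<notin> e}"
  have c: "cactus (insert x S) E" using assms(1) by (simp add: planted_def)
  obtain xs where xs: "distinct xs" "xs \<noteq> []" "hd xs = a" "last xs = b" "x \<notin> set xs"
    "path_edges xs \<subseteq> ?E"
    "is_cycle (path_edges (x # xs @ [x]))" "path_edges (x # xs @ [x]) \<subseteq> E"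
    "path_edges (x # xs @ [x]) = insert {x, a} (insert {x, b} (path_edges xs))"
    using planted_path_cycle[OF assms] .
  have "e \<in> bridge_edges ?E" if e: "e \<in> path_edges xs" for e
  proof (rule ccontr)
    assume "e \<notin> bridge_edges ?E"
    with e xs(6) obtain u v where uv: "e = {u, v}" "(u, v) \<in> linked (?E - {{u, v}})"
      by (auto simp: bridge_edges_def)
    have "e \<in> E" using e xs(6) by blast
    then have "u \<noteq> v" using cactus_edge_ends(3)[OF c] uv by metis
    then obtain F where F: "is_cycle F" "{u, v} \<in> F" "F \<subseteq> insert {u, v} ?E"
      using linked_imp_cycle[OF uv(2)] by blast
    have FE: "F \<subseteq> ?E" using F(3) e xs(6) uv(1) by blast
    have "F = path_edges (x # xs @ [x])"
      using edge_disjoint_cyclesD[OF cactusD(6)[OF c] F(1) xs(7) _ xs(8) F(2)] FE e uv(1) xs(9) by auto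
    then show False using FE xs(9) by auto
  qed
  then have "path_edges xs \<subseteq> bridge_edges ?E" by blast
  then show ?thesis using linked_path[OF xs(2)] xs(3,4) by metis
qed

lemma planted_remove_root:
  assumes "planted x S E" "x \<notin> S" "S \<noteq> {}"
  shows "cactus S {e \<in> E. x \<notin> e}" "\<exists>a\<in>S. {x, a} \<in> E"
    "e \<in> E \<Longrightarrow> x \<in> e \<Longrightarrow> \<exists>a\<in>S. e = {x, a}"
proof -
  have c: "cactus (insert x S) E" using assms(1) by (simp add: planted_def)
  have "edge_disjoint_cycles {e \<in> E. x \<notin> e}"
    by (rule edge_disjoint_cycles_mono[OF cactusD(6)[OF c]]) auto
  then show "cactus S {e \<in> E. x \<notin> e}"
    using c assms by (auto simp: cactus_def planted_def)
  obtain s where s: "s \<in> S" using assms by blast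
  have "(x, s) \<in> linked E" using cactusD(5)[OF c] s by auto
  then have "\<exists>a. {x, a} \<in> E" using s assms(2) unfolding linked_def
    by (auto elim: converse_rtranclE)
  then show "\<exists>a\<in>S. {x, a} \<in> E" using cactus_edge_ends[OF c] by blast
  show "\<exists>a\<in>S. e = {x, a}" if "e \<in> E" "x \<in> e"
  proof -
    obtain u v where uv: "e = {u, v}" "u \<in> insert x S" "v \<in> insert x S" "u \<noteq> v"
      using cactus_obtain_ends[OF c \<open>e \<in> E\<close>] .
    with that(2) show ?thesis by (auto simp: insert_commute)
  qed
qed

lemma planted_leaf:
  assumes "cactus S E" "x \<notin> S" "a \<in> S"
  shows "planted x S (insert {x, a} E)" "{e \<in> insert {x, a} E. x \<notin> e} = E"
proof -
  show *: "{e \<in> insert {x, a} E. x \<notin> e} = E" using cactusD(3)[OF assms(1)] assms(2) by auto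
  show "planted x S (insert {x, a} E)"
    using cactus_leaf[OF assms(1,3,2)] cactusD(5)[OF assms(1)] unfolding planted_def * by blast
qed

lemma planted_close_bridged:
  assumes "cactus S E" "x \<notin> S" "a \<in> S" "b \<in> S" "a \<noteq> b" "(a, b) \<in> linked (bridge_edges E)"
  shows "planted x S (insert {x, a} (insert {x, b} E))"
    "{e \<in> insert {x, a} (insert {x, b} E). x \<notin> e} = E"
proof -
  show *: "{e \<in> insert {x, a} (insert {x, b} E). x \<notin> e} = E" using cactusD(3)[OF assms(1)] assms(2) by auto
  show "planted x S (insert {x, a} (insert {x, b} E))"
    using cactus_close_bridged[OF assms] cactusD(5)[OF assms(1)] unfolding planted_def * by blast
qed

text \<open>Prepends one bridge to a path of bridges. The conclusions about \<open>A\<close>,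
  \<open>E1\<close> and \<open>E2\<close> recover the pieces once \<open>a'\<close> is known; the
  last one serves to identify \<open>a'\<close>.\<close>

lemma join_bridged:
  assumes "cactus A E1" "cactus B E2" "A \<inter> B = {}" "a \<in> A" "a' \<in> B" "b \<in> B"
    "(a', b) \<in> linked (bridge_edges E2)"
  defines "E \<equiv> insert {a, a'} (E1 \<union> E2)"
  shows "cactus (A \<union> B) E" "(a, b) \<in> linked (bridge_edges E)"
    "E - {{a, a'}} = E1 \<union> E2" "A = {w. (a, w) \<in> linked (E - {{a, a'}})}"
    "E1 = {e \<in> E. e \<subseteq> A}" "E2 = {e \<in> E. e \<subseteq> B}"
    "(a', b) \<in> linked {e \<in> E. a \<notin> e}"
proof -
  show c: "cactus (A \<union> B) E" unfolding E_def by (rule cactus_join[OF assms(1-5)])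
  have E1: "e \<subseteq> A" if "e \<in> E1" for e using that cactusD(3)[OF assms(1)] by blast
  have E2: "e \<subseteq> B" if "e \<in> E2" for e using that cactusD(3)[OF assms(2)] by blast
  have "{a, a'} \<notin> E1 \<union> E2" using E1 E2 assms by blast
  then show minus: "E - {{a, a'}} = E1 \<union> E2" unfolding E_def by auto
  have closed: "w' \<in> A" if "{w, w'} \<in> E1 \<union> E2" "w \<in> A" for w w'
    using that E1 E2 assms(3) by blast
  then have "w \<in> A" if "(a, w) \<in> linked (E1 \<union> E2)" for w
    using linked_closed[OF that assms(4)] by blast
  moreover have "(a, w) \<in> linked (E1 \<union> E2)" if "w \<in> A" for w
    using cactusD(5)[OF assms(1,4) that] linked_mono[of E1 "E1 \<union> E2"] by auto
  ultimately show A: "A = {w. (a, w) \<in> linked (E - {{a, a'}})}" unfolding minus by blast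
  have ne: "e \<noteq> {}" if "e \<in> E1 \<union> E2" for e
    using that cactusD(4)[OF assms(1), of e] cactusD(4)[OF assms(2), of e] by auto
  show "E1 = {e \<in> E. e \<subseteq> A}" "E2 = {e \<in> E. e \<subseteq> B}"
    unfolding E_def using E1 E2 ne assms(3,4,5) by blast+
  have "(a', b) \<in> linked E2" using cactusD(5)[OF assms(2,5,6)] .
  then show "(a', b) \<in> linked {e \<in> E. a \<notin> e}"
    by (rule linked_mono[rotated]) (use E2 assms(3,4) E_def in auto)
  have "{a, a'} \<in> bridge_edges E"
  proof -
    have "a' \<notin> A" using assms by auto
    then have "(a, a') \<notin> linked (E - {{a, a'}})" using A by auto
    moreover from this have "(a', a) \<notin> linked (E - {{a, a'}})" using linked_sym by metis
    moreover have "{a, a'} \<in> E" by (simp add: E_def)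
    ultimately show ?thesis by (auto simp: bridge_edges_def doubleton_eq_iff insert_commute)
  qed
  moreover have "bridge_edges E2 \<subseteq> bridge_edges E"
  proof
    fix e assume e: "e \<in> bridge_edges E2"
    then have eE2: "e \<in> E2" by (simp add: bridge_edges_def)
    have "(u, v) \<notin> linked (E - {e})" if uv: "e = {u, v}" for u v
    proof
      assume "(u, v) \<in> linked (E - {e})"
      \<comment> \<open>Contracting \<open>A\<close> to \<open>a'\<close> turns a detour around
        \<open>e\<close> in the joined cactus into a detour inside \<open>E2\<close>.\<close>
      let ?f = "\<lambda>w. if w \<in> A then a' else w"
      from \<open>(u, v) \<in> linked (E - {e})\<close> have "(?f u, ?f v) \<in> linked (E2 - {e})"
      proof (rule linked_map)
        fix y z assume yz: "{y, z} \<in> E - {e}"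
        then consider "{y, z} = {a, a'}" | "{y, z} \<in> E1" | "{y, z} \<in> E2 - {e}"
          unfolding E_def by blast
        then show "(?f y, ?f z) \<in> linked (E2 - {e})"
        proof cases
          case 1
          then have f: "?f y = a'" "?f z = a'" using assms(4) by (auto simp: doubleton_eq_iff)
          show ?thesis unfolding f by (rule linked_refl)
        next
          case 2
          then show ?thesis using E1[OF 2] by auto
        next
          case 3
          then have f: "?f y = y" "?f z = z" using E2[of "{y, z}"] assms(3) by auto
          from 3 have "(y, z) \<in> linked (E2 - {e})" by (rule linked_edge)
          then show ?thesis unfolding f .
        qed
      qed
      moreover have "?f u = u" "?f v = v" using E2[OF eE2] uv assms(3) by auto
      ultimately show False using e uv by (auto simp: bridge_edges_def)
    qed
    then show "e \<in> bridge_edges E" using eE2 by (auto simp: bridge_edges_def E_def)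
  qed
  ultimately show "(a, b) \<in> linked (bridge_edges E)"
    using assms(7) linked_step linked_mono by metis
qed

text \<open>The vertex \<open>a'\<close> is the only neighbour of \<open>a\<close> from which
  \<open>b\<close> is reached without \<open>a\<close>. A second one would be linked to
  \<open>a'\<close> without the joining edge, and its edge to \<open>a\<close> would then lead from
  \<open>B\<close> to \<open>a\<close>.\<close>

lemma join_bridged_unique_neighbour:
  assumes "cactus A E1" "cactus B E2" "A \<inter> B = {}" "a \<in> A" "a' \<in> B"
    "(a', b) \<in> linked {e \<in> E. a \<notin> e}" "(a'', b) \<in> linked {e \<in> E. a \<notin> e}" "{a, a''} \<in> E"
    "E = insert {a, a'} (E1 \<union> E2)"
  shows "a'' = a'"
proof (rule ccontr)
  assume ne: "a'' \<noteq> a'"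
  have E12: "e \<in> E1 \<union> E2" if "e \<in> E" "e \<noteq> {a, a'}" for e using that assms(9) by blast
  have "(a', a'') \<in> linked {e \<in> E. a \<notin> e}" using linked_trans[OF assms(6) linked_sym[OF assms(7)]] .
  then have "(a', a'') \<in> linked (E1 \<union> E2)"
    by (rule linked_mono[rotated]) (use E12 in auto)
  moreover have "{a'', a} \<in> E1 \<union> E2" using E12[OF assms(8)] ne by (auto simp: doubleton_eq_iff insert_commute)
  ultimately have "(a', a) \<in> linked (E1 \<union> E2)" using linked_edge linked_trans by metis
  then have "a \<in> B" using assms(5)
    by (rule linked_closed) (use cactusD(3)[OF assms(1)] cactusD(3)[OF assms(2)] assms(3) in blast)
  with assms show False by blast
qed

text \<open>The inverse of \<open>join_bridged\<close>. Once the first bridge is removed, the rest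
  of the path cannot return to the side of \<open>a\<close>, since it would link the ends of that
  bridge.\<close>

lemma bridged_split:
  assumes "cactus S E" "a \<in> S" "b \<in> S" "a \<noteq> b" "(a, b) \<in> linked (bridge_edges E)"
  obtains A E1 a' E2 where "A \<subseteq> S" "cactus A E1" "a \<in> A" "cactus (S - A) E2" "a' \<in> S - A" "b \<in> S - A"
    "(a', b) \<in> linked (bridge_edges E2)" "E = insert {a, a'} (E1 \<union> E2)"
proof -
  obtain xs where xs: "distinct xs" "xs \<noteq> []" "hd xs = a" "last xs = b" "path_edges xs \<subseteq> bridge_edges E"
    using linked_obtain_path[OF assms(5)] .
  then obtain a' ys where xs_eq: "xs = a # a' # ys"
    using assms(4) by (cases xs; cases "tl xs") auto
  define e where "e = {a, a'}"
  have eB: "e \<in> bridge_edges E" using xs xs_eq by (auto simp: e_def)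
  then have eE: "{a, a'} \<in> E" by (simp add: bridge_edges_def e_def)
  define A where "A = {w. (a, w) \<in> linked (E - {e})}"
  have aA: "a \<in> A" by (simp add: A_def)
  have a'A: "a' \<notin> A" using eB by (auto simp: A_def bridge_edges_def e_def)
  have closed: "w' \<in> A" if "{w, w'} \<in> E - {e}" "w \<in> A" for w w'
    using that linked_trans[OF _ linked_edge[OF that(1)]] by (simp add: A_def)
  have AS: "A \<subseteq> S"
  proof
    fix w assume "w \<in> A"
    then have "(a, w) \<in> linked (E - {e})" by (simp add: A_def)
    then show "w \<in> S" using assms(2)
      by (rule linked_closed) (use cactus_edge_ends[OF assms(1)] in blast)
  qed
  define E1 E2 where "E1 = {f \<in> E. f \<subseteq> A}" and "E2 = {f \<in> E. f \<subseteq> S - A}"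
  have a'S: "a' \<in> S" using cactus_edge_ends[OF assms(1) eE] by simp
  have split: "E = insert {a, a'} (E1 \<union> E2)"
  proof -
    have "f \<in> E1 \<union> E2" if f: "f \<in> E" "f \<noteq> e" for f
    proof -
      obtain y z where "f = {y, z}" "y \<in> S" "z \<in> S" using cactus_obtain_ends[OF assms(1) f(1)] by metis
      then show ?thesis using closed[of y z] closed[of z y] f unfolding E1_def E2_def
        by (auto simp: insert_commute)
    qed
    then show ?thesis using eE by (auto simp: E1_def E2_def e_def)
  qed
  have "cactus A E1"
  proof (rule cactusI[of _ a])
    show "finite A" using AS cactusD(1)[OF assms(1)] finite_subset by blast
    show "(w, a) \<in> linked E1" if "w \<in> A" for w
    proof -
      have "(w, a) \<in> linked (E - {e})" using that by (auto simp: A_def intro: linked_sym)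
      then have "(w, a) \<in> linked {f \<in> E - {e}. f \<subseteq> A}"
        by (rule linked_restrict) (use closed aA in \<open>auto simp: insert_commute\<close>)
      then show ?thesis by (rule linked_mono[rotated]) (auto simp: E1_def)
    qed
    show "edge_disjoint_cycles E1"
      by (rule edge_disjoint_cycles_mono[OF cactusD(6)[OF assms(1)]]) (auto simp: E1_def)
  qed (use aA cactusD(4)[OF assms(1)] in \<open>auto simp: E1_def\<close>)
  moreover have c2: "cactus (S - A) E2"
  proof (rule cactusI[of _ a'])
    show "(w, a') \<in> linked E2" if "w \<in> S - A" for w
    proof -
      let ?f = "\<lambda>w. if w \<in> A then a' else w"
      have "(w, a') \<in> linked E" using cactusD(5)[OF assms(1)] that a'S by blast
      then have "(?f w, ?f a') \<in> linked E2"
      proof (rule linked_map)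
        fix y z assume "{y, z} \<in> E"
        then consider "{y, z} = {a, a'}" | "{y, z} \<in> E1" | "{y, z} \<in> E2" using split by blast
        then show "(?f y, ?f z) \<in> linked E2"
        proof cases
          case 1
          then have f: "?f y = a'" "?f z = a'" using aA by (auto simp: doubleton_eq_iff)
          show ?thesis unfolding f by (rule linked_refl)
        next
          case 2
          then show ?thesis by (auto simp: E1_def)
        next
          case 3
          then have f: "?f y = y" "?f z = z" by (auto simp: E2_def)
          from 3 have "(y, z) \<in> linked E2" by (rule linked_edge)
          then show ?thesis unfolding f .
        qed
      qed
      then show ?thesis using that by auto
    qed
    show "edge_disjoint_cycles E2"
      by (rule edge_disjoint_cycles_mono[OF cactusD(6)[OF assms(1)]]) (auto simp: E2_def)
  qed (use a'A a'S cactusD(1,4)[OF assms(1)] in \<open>auto simp: E2_def\<close>)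
  moreover have ys_sub: "path_edges (a' # ys) \<subseteq> E - {e}"
    using xs xs_eq path_edges_subset_set[of e "a' # ys"] bridge_edges_subset[of E] by (auto simp: e_def)
  have ys_SA: "w \<notin> A" if "w \<in> set (a' # ys)" for w
  proof
    assume "w \<in> A"
    moreover have "(a', w) \<in> linked (E - {e})" using linked_path_mem(1)[OF that ys_sub] by simp
    ultimately have "(a, a') \<in> linked (E - {e})"
      using linked_sym[of a' w] linked_trans[of a w] by (simp add: A_def)
    with a'A show False by (simp add: A_def)
  qed
  have "path_edges (a' # ys) \<subseteq> bridge_edges E2"
  proof
    fix f assume f: "f \<in> path_edges (a' # ys)"
    then have fE: "f \<in> E" using ys_sub by blast
    have "f \<subseteq> S - A" using path_edges_subset_set[OF f] ys_SA cactusD(3)[OF assms(1) fE] by blast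
    then have "f \<in> E2" using fE by (simp add: E2_def)
    moreover have "(u, v) \<notin> linked (E2 - {f})" if "f = {u, v}" for u v
    proof
      assume "(u, v) \<in> linked (E2 - {f})"
      then have "(u, v) \<in> linked (E - {f})" by (rule linked_mono[rotated]) (auto simp: E2_def)
      moreover have "f \<in> bridge_edges E" using f xs(5) xs_eq by auto
      ultimately show False using that by (auto simp: bridge_edges_def)
    qed
    ultimately show "f \<in> bridge_edges E2" by (simp add: bridge_edges_def)
  qed
  then have "(a', b) \<in> linked (bridge_edges E2)"
    using linked_path[of "a' # ys"] xs xs_eq by auto
  moreover have "b \<notin> A" using ys_SA[of b] xs(4) xs_eq last_in_set[of "a' # ys"] by auto
  ultimately show ?thesis using that[OF AS _ aA c2 _ _ _ split] a'A a'S assms(3) by blast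
qed

section \<open>Counting labelled cacti\<close>

lemma path_edges_map: "path_edges (map f xs) = (`) f ` path_edges xs"
  by (induction xs rule: path_edges.induct) auto

lemma is_cycle_image:
  assumes "is_cycle F" "inj_on f (\<Union>F)"
  shows "is_cycle ((`) f ` F)"
proof -
  obtain v xs where v: "distinct (v # xs)" "2 \<le> length xs" "F = path_edges (v # xs @ [v])"
    using assms(1) unfolding is_cycle_def by blast
  have "\<Union>F = set (v # xs)" using v(3) Union_path_edges[of "v # xs @ [v]"] by auto
  then have "distinct (map f (v # xs))" using v(1) assms(2) by (metis distinct_map)
  moreover have "(`) f ` F = path_edges (f v # map f xs @ [f v])"
    using v(3) path_edges_map[of f "v # xs @ [v]"] by simp
  ultimately show ?thesis
    unfolding is_cycle_def using v(2) by (intro exI[of _ "f v"] exI[of _ "map f xs"]) auto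
qed

lemma cactus_image:
  assumes "inj_on f V" "cactus V E"
  shows "cactus (f ` V) ((`) f ` E)"
proof -
  obtain r where r: "r \<in> V" using cactusD(2)[OF assms(2)] by blast
  show ?thesis
  proof (rule cactusI[of _ "f r"])
    show "e \<subseteq> f ` V \<and> card e = 2" if e: "e \<in> (`) f ` E" for e
    proof -
      obtain d where d: "d \<in> E" "e = f ` d" using e by blast
      then have "inj_on f d" using cactusD(3)[OF assms(2)] assms(1) inj_on_subset by blast
      then show ?thesis using d cactusD(3,4)[OF assms(2) d(1)] by (auto simp: card_image)
    qed
    show "(u, f r) \<in> linked ((`) f ` E)" if u: "u \<in> f ` V" for u
    proof -
      obtain w where w: "w \<in> V" "u = f w" using u by blast
      have "(f w, f r) \<in> linked ((`) f ` E)" using cactusD(5)[OF assms(2) w(1) r]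
      proof (rule linked_map)
        fix x y assume "{x, y} \<in> E"
        then have "f ` {x, y} \<in> (`) f ` E" by (rule imageI)
        then have "{f x, f y} \<in> (`) f ` E" by simp
        then show "(f x, f y) \<in> linked ((`) f ` E)" by (rule linked_edge)
      qed
      with w show ?thesis by simp
    qed
    show "edge_disjoint_cycles ((`) f ` E)"
      unfolding edge_disjoint_cycles_def
    proof (intro allI impI, elim conjE)
      fix F F' assume F: "is_cycle F" "is_cycle F'" "F \<subseteq> (`) f ` E" "F' \<subseteq> (`) f ` E" "F \<inter> F' \<noteq> {}"
      \<comment> \<open>Cycles of the image are pulled back along the inverse on \<open>V\<close>,
        compared there, and pushed forward again.\<close>
      let ?g = "inv_into V f"
      have gf: "?g ` f ` d = d" if "d \<in> E" for d
        using cactusD(3)[OF assms(2) that] assms(1) by simp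
      have pull: "is_cycle ((`) ?g ` G)" "(`) ?g ` G \<subseteq> E" "(`) f ` (`) ?g ` G = G"
        if G: "is_cycle G" "G \<subseteq> (`) f ` E" for G
      proof -
        have "\<Union>G \<subseteq> f ` V" using G(2) cactusD(3)[OF assms(2)] by blast
        then show "is_cycle ((`) ?g ` G)"
          by (intro is_cycle_image[OF G(1)] inj_on_subset[OF inj_on_inv_into[OF order_refl]])
        show "(`) ?g ` G \<subseteq> E" using G(2) gf by auto
        have "f ` ?g ` e = e" if e: "e \<in> G" for e
        proof -
          obtain d where "d \<in> E" "e = f ` d" using e G(2) by blast
          with gf show ?thesis by metis
        qed
        then show "(`) f ` (`) ?g ` G = G" by (simp add: image_image)
      qed
      have "(`) ?g ` F \<inter> (`) ?g ` F' \<noteq> {}" using F(5) by blast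
      then have "(`) ?g ` F = (`) ?g ` F'"
        using cactusD(6)[OF assms(2)] pull(1,2) F(1-4) unfolding edge_disjoint_cycles_def by meson
      then show "F = F'" using pull(3) F(1-4) by metis
    qed
  qed (use r cactusD(1)[OF assms(2)] in auto)
qed

definition cactus_edges :: "'a set \<Rightarrow> 'a set set set" where
  "cactus_edges V = {E. cactus V E}"

lemma finite_cactus_edges [simp]: "finite V \<Longrightarrow> finite (cactus_edges V)"
  by (rule finite_subset[of _ "Pow (Pow V)"]) (auto simp: cactus_edges_def cactus_def)

text \<open>One inequality suffices, because the hypotheses are symmetric in \<open>V\<close> and
  \<open>W\<close>.\<close>

lemma card_cactus_edges_le:
  assumes "finite V" "finite W" "card V = card W"
  shows "card (cactus_edges V) \<le> card (cactus_edges W)"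
proof -
  obtain f where f: "bij_betw f V W" using finite_same_card_bij assms by blast
  then have inj: "inj_on f V" and W: "W = f ` V" by (auto simp: bij_betw_def)
  have "(`) ((`) f) ` cactus_edges V \<subseteq> cactus_edges W"
    using cactus_image[OF inj] W by (auto simp: cactus_edges_def)
  moreover have "inj_on ((`) ((`) f)) (cactus_edges V)"
  proof (rule inj_on_subset)
    show "inj_on ((`) ((`) f)) (Pow (Pow V))"
      using inj by (intro inj_on_image_Pow)
    show "cactus_edges V \<subseteq> Pow (Pow V)" by (auto simp: cactus_edges_def cactus_def)
  qed
  ultimately show ?thesis using card_inj_on_le finite_cactus_edges[OF assms(2)] by metis
qed

definition cactus_count :: "nat \<Rightarrow> nat" where
  "cactus_count n = card (cactus_edges {1..n})"

lemma card_cactus_edges: "finite V \<Longrightarrow> card (cactus_edges V) = cactus_count (card V)"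
  unfolding cactus_count_def by (intro antisym card_cactus_edges_le) auto

lemma cactus_count_0 [simp]: "cactus_count 0 = 0"
  by (simp add: cactus_count_def cactus_edges_def cactus_def)

lemma cactus_count_1 [simp]: "cactus_count (Suc 0) = 1"
proof -
  have "E = {}" if "cactus {Suc 0} E" for E
  proof -
    have "e \<notin> E" for e
    proof
      assume "e \<in> E"
      then have "e \<subseteq> {Suc 0}" "card e = 2" using cactusD(3,4)[OF that] by auto
      then show False using card_mono[of "{Suc 0}" e] by auto
    qed
    then show ?thesis by blast
  qed
  then have "cactus_edges {1..Suc 0} = {{}}"
    using cactus_singleton[of "Suc 0"] by (auto simp: cactus_edges_def)
  then show ?thesis by (simp add: cactus_count_def)
qed

section \<open>Bijections for planted cacti and pairs joined by bridges\<close>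

definition planted_edges :: "'a \<Rightarrow> 'a set \<Rightarrow> 'a set set set" where
  "planted_edges x S = {E. planted x S E}"

lemma finite_planted_edges [simp]: "finite S \<Longrightarrow> finite (planted_edges x S)"
proof (rule finite_subset)
  show "planted_edges x S \<subseteq> cactus_edges (insert x S)"
    by (auto simp: cactus_edges_def planted_edges_def planted_def)
qed simp

text \<open>Marking \<open>u\<close> selects one of the components behind the root, so every cactus
  is split in exactly one way.\<close>

lemma card_split_at_root_component:
  assumes "finite U" "x \<notin> U" "u \<in> U"
  shows "card (cactus_edges (insert x U)) =
    (\<Sum>S | S \<subseteq> U \<and> u \<in> S. card (planted_edges x S) * card (cactus_edges (insert x (U - S))))"
proof -
  let ?D = "SIGMA S:{S. S \<subseteq> U \<and> u \<in> S}. planted_edges x S \<times> cactus_edges (insert x (U - S))"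
  let ?f = "\<lambda>(S, E1, E2). E1 \<union> E2"
  have "bij_betw ?f ?D (cactus_edges (insert x U))"
  proof (rule bij_betw_imageI)
    show "inj_on ?f ?D"
    proof (rule inj_onI)
      fix p q assume p: "p \<in> ?D" and q: "q \<in> ?D" and eq: "?f p = ?f q"
      obtain S E1 E2 where p_eq: "p = (S, E1, E2)" by (cases p) auto
      obtain T F1 F2 where q_eq: "q = (T, F1, F2)" by (cases q) auto
      have P: "S \<subseteq> U" "u \<in> S" "planted x S E1" "cactus (insert x (U - S)) E2"
        using p by (auto simp: p_eq planted_edges_def cactus_edges_def)
      have Q: "T \<subseteq> U" "u \<in> T" "planted x T F1" "cactus (insert x (U - T)) F2"
        using q by (auto simp: q_eq planted_edges_def cactus_edges_def)
      have eq: "E1 \<union> E2 = F1 \<union> F2" using eq by (simp add: p_eq q_eq)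
      note P' = glue_at_root_component[OF assms(2) P]
      note Q' = glue_at_root_component[OF assms(2) Q]
      have "S = T" using P'(2) Q'(2) unfolding eq by (rule trans[OF _ sym])
      moreover have "E1 = F1" using P'(3) Q'(3) unfolding \<open>S = T\<close> eq by (rule trans[OF _ sym])
      moreover have "E2 = F2" using P'(4) Q'(4) unfolding \<open>S = T\<close> eq by (rule trans[OF _ sym])
      ultimately show "p = q" by (simp add: p_eq q_eq)
    qed
    show "?f ` ?D = cactus_edges (insert x U)"
    proof (intro subset_antisym subsetI)
      fix E assume "E \<in> ?f ` ?D"
      then show "E \<in> cactus_edges (insert x U)"
        using glue_at_root_component(1)[OF assms(2)] by (auto simp: planted_edges_def cactus_edges_def)
    next
      fix E assume "E \<in> cactus_edges (insert x U)"
      then have "cactus (insert x U) E" by (simp add: cactus_edges_def)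
      note * = split_at_root_component[OF this assms(2,3)]
      let ?S = "{v. (u, v) \<in> linked {e \<in> E. x \<notin> e}}"
      show "E \<in> ?f ` ?D"
      proof (rule image_eqI)
        show "E = ?f (?S, {e \<in> E. e \<subseteq> insert x ?S}, {e \<in> E. e \<subseteq> insert x (U - ?S)})"
          unfolding case_prod_conv by (rule *(5))
        show "(?S, {e \<in> E. e \<subseteq> insert x ?S}, {e \<in> E. e \<subseteq> insert x (U - ?S)}) \<in> ?D"
          using *(1-4) by (simp add: planted_edges_def cactus_edges_def)
      qed
    qed
  qed
  then have "card (cactus_edges (insert x U)) = card ?D" by (rule bij_betw_same_card[symmetric])
  also have "\<dots> = (\<Sum>S | S \<subseteq> U \<and> u \<in> S. card (planted_edges x S \<times> cactus_edges (insert x (U - S))))"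
  proof (rule card_SigmaI)
    have "finite S" if "S \<subseteq> U" for S using that assms(1) finite_subset by blast
    then show "\<forall>S\<in>{S. S \<subseteq> U \<and> u \<in> S}. finite (planted_edges x S \<times> cactus_edges (insert x (U - S)))"
      using assms(1) by auto
  qed (use assms(1) in auto)
  finally show ?thesis by (simp add: card_cartesian_product)
qed

text \<open>The objects behind \<open>P\<close>. The case \<open>a = b\<close>, with the trivial
  path, is included.\<close>

definition bridged_triples :: "'a set \<Rightarrow> ('a \<times> 'a \<times> 'a set set) set" where
  "bridged_triples S = {(a, b, E). a \<in> S \<and> b \<in> S \<and> cactus S E \<and> (a, b) \<in> linked (bridge_edges E)}"

lemma finite_bridged_triples [simp]: "finite S \<Longrightarrow> finite (bridged_triples S)"
proof (rule finite_subset)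
  show "bridged_triples S \<subseteq> S \<times> S \<times> cactus_edges S"
    by (auto simp: bridged_triples_def cactus_edges_def)
qed simp

definition neighbours :: "'a \<Rightarrow> 'a set set \<Rightarrow> 'a set" where
  "neighbours x E = {a. {x, a} \<in> E}"

lemma planted_eq_neighbours:
  assumes "planted x S E" "x \<notin> S" "S \<noteq> {}"
  shows "E = (\<lambda>c. {x, c}) ` neighbours x E \<union> {e \<in> E. x \<notin> e}"
proof (intro subset_antisym subsetI)
  fix e assume e: "e \<in> E"
  show "e \<in> (\<lambda>c. {x, c}) ` neighbours x E \<union> {e \<in> E. x \<notin> e}"
  proof (cases "x \<in> e")
    case True
    then show ?thesis using planted_remove_root(3)[OF assms e] e by (auto simp: neighbours_def)
  qed (use e in simp)
qed (auto simp: neighbours_def)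

lemma planted_neighbours:
  assumes "planted x S E" "x \<notin> S" "S \<noteq> {}"
  obtains a where "a \<in> S" "neighbours x E = {a}"
  | a b where "a \<in> S" "b \<in> S" "a \<noteq> b" "neighbours x E = {a, b}"
proof -
  have c: "cactus (insert x S) E" using assms(1) by (simp add: planted_def)
  obtain a where a: "a \<in> S" "{x, a} \<in> E" using planted_remove_root(2)[OF assms] by blast
  have NS: "b \<in> S" if "b \<in> neighbours x E" for b
    using cactus_edge_ends[OF c, of x b] that by (auto simp: neighbours_def)
  show ?thesis
  proof (cases "neighbours x E = {a}")
    case True
    then show ?thesis using that(1)[OF a(1) True] by simp
  next
    case False
    then obtain b where b: "{x, b} \<in> E" "b \<noteq> a" using a by (auto simp: neighbours_def)
    have "c = a \<or> c = b" if "{x, c} \<in> E" for c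
      using planted_degree_two[OF assms(1,2) a(2) b(1) _ that] b(2) by simp
    then have N: "neighbours x E = {a, b}" using a b by (auto simp: neighbours_def)
    then show ?thesis using that(2)[of a b] NS b(2) by auto
  qed
qed

text \<open>The inner cardinality is 1 if the root is a leaf and 0 otherwise. In this form the count
  can be added termwise to the one for bridged triples.\<close>

lemma card_rooted_cacti_planted:
  assumes "finite S" "x \<notin> S" "S \<noteq> {}"
  shows "card S * card (cactus_edges S) = (\<Sum>E\<in>planted_edges x S. card {a. neighbours x E = {a}})"
proof -
  let ?D = "SIGMA E:planted_edges x S. {a. neighbours x E = {a}}"
  have fin: "finite {a. M = {a}}" for M :: "'a set"
    by (rule finite_subset[of _ "if finite M then M else {}"]) auto
  have "bij_betw (\<lambda>(E, a). (a, {e \<in> E. x \<notin> e})) ?D (S \<times> cactus_edges S)"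
  proof (rule bij_betwI[where g = "\<lambda>(a, E). (insert {x, a} E, a)"])
    show "(\<lambda>(E, a). (a, {e \<in> E. x \<notin> e})) \<in> ?D \<rightarrow> S \<times> cactus_edges S"
    proof clarsimp
      fix E a assume "E \<in> planted_edges x S" and N: "neighbours x E = {a}"
      then have E: "planted x S E" by (simp add: planted_edges_def)
      have "neighbours x E \<subseteq> S" by (rule planted_neighbours[OF E assms(2,3)]) auto
      then show "a \<in> S \<and> {e \<in> E. x \<notin> e} \<in> cactus_edges S"
        using N planted_remove_root(1)[OF E assms(2,3)] by (simp add: cactus_edges_def)
    qed
    show "(\<lambda>(a, E). (insert {x, a} E, a)) \<in> S \<times> cactus_edges S \<rightarrow> ?D"
    proof clarsimp
      fix a E assume a: "a \<in> S" "E \<in> cactus_edges S"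
      then have c: "cactus S E" by (simp add: cactus_edges_def)
      have "{x, b} \<notin> E" for b using cactusD(3)[OF c, of "{x, b}"] assms(2) by auto
      then show "insert {x, a} E \<in> planted_edges x S \<and> neighbours x (insert {x, a} E) = {a}"
        using planted_leaf(1)[OF c assms(2) a(1)] by (auto simp: planted_edges_def neighbours_def doubleton_eq_iff)
    qed
    show "(case case p of (E, a) \<Rightarrow> (a, {e \<in> E. x \<notin> e}) of (a, E) \<Rightarrow> (insert {x, a} E, a)) = p" if "p \<in> ?D" for p
    proof -
      obtain E a where p: "p = (E, a)" by (cases p)
      with that have E: "planted x S E" "neighbours x E = {a}" by (auto simp: planted_edges_def)
      have "insert {x, a} {e \<in> E. x \<notin> e} = E"
        using planted_eq_neighbours[OF E(1) assms(2,3)] unfolding E(2) by auto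
      with p show ?thesis by simp
    qed
    show "(case case q of (a, E) \<Rightarrow> (insert {x, a} E, a) of (E, a) \<Rightarrow> (a, {e \<in> E. x \<notin> e})) = q"
      if "q \<in> S \<times> cactus_edges S" for q
      using that planted_leaf(2)[OF _ assms(2)] by (cases q) (simp add: cactus_edges_def)
  qed
  from bij_betw_same_card[OF this] have "card S * card (cactus_edges S) = card ?D"
    by (simp add: card_cartesian_product)
  also have "\<dots> = (\<Sum>E\<in>planted_edges x S. card {a. neighbours x E = {a}})"
    using assms(1) fin by (intro card_SigmaI) auto
  finally show ?thesis .
qed

lemma card_bridged_triples_planted:
  assumes "finite S" "x \<notin> S" "S \<noteq> {}"
  shows "card (bridged_triples S) = (\<Sum>E\<in>planted_edges x S. card {(a, b). neighbours x E = {a, b}})"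
proof -
  let ?D = "SIGMA E:planted_edges x S. {(a, b). neighbours x E = {a, b}}"
  have fin: "finite {(a, b). M = {a, b}}" for M :: "'a set"
    by (rule finite_subset[of _ "if finite M then M \<times> M else {}"]) auto
  let ?f = "\<lambda>(E, a, b). (a, b, {e \<in> E. x \<notin> e})"
  let ?g = "\<lambda>(a, b, E). (insert {x, a} (insert {x, b} E), a, b)"
  have "bij_betw ?f ?D (bridged_triples S)"
  proof (rule bij_betwI[where g = ?g])
    show "?f \<in> ?D \<rightarrow> bridged_triples S"
    proof clarsimp
      fix E a b assume "E \<in> planted_edges x S" and N: "neighbours x E = {a, b}"
      then have E: "planted x S E" by (simp add: planted_edges_def)
      have ab: "{x, a} \<in> E" "{x, b} \<in> E" using N by (auto simp: neighbours_def)
      have "neighbours x E \<subseteq> S" by (rule planted_neighbours[OF E assms(2,3)]) auto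
      then have S: "a \<in> S" "b \<in> S" using N by auto
      have "(a, b) \<in> linked (bridge_edges {e \<in> E. x \<notin> e})"
        using planted_bridged[OF E assms(2) ab] by (cases "a = b") auto
      then show "(a, b, {e \<in> E. x \<notin> e}) \<in> bridged_triples S"
        using S planted_remove_root(1)[OF E assms(2,3)] by (simp add: bridged_triples_def)
    qed
    show "?g \<in> bridged_triples S \<rightarrow> ?D"
    proof clarsimp
      fix a b E assume "(a, b, E) \<in> bridged_triples S"
      then have a: "a \<in> S" "b \<in> S" and c: "cactus S E" and l: "(a, b) \<in> linked (bridge_edges E)"
        by (auto simp: bridged_triples_def)
      have "{x, b} \<notin> E" for b using cactusD(3)[OF c, of "{x, b}"] assms(2) by auto
      then have "neighbours x (insert {x, a} (insert {x, b} E)) = {a, b}"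
        by (auto simp: neighbours_def doubleton_eq_iff)
      moreover have "planted x S (insert {x, a} (insert {x, b} E))"
        using planted_leaf(1)[OF c assms(2) a(1)] planted_close_bridged(1)[OF c assms(2) a _ l]
        by (cases "a = b") auto
      ultimately show "insert {x, a} (insert {x, b} E) \<in> planted_edges x S \<and>
          neighbours x (insert {x, a} (insert {x, b} E)) = {a, b}"
        by (simp add: planted_edges_def)
    qed
    show "?g (?f p) = p" if "p \<in> ?D" for p
    proof -
      obtain E a b where p: "p = (E, a, b)" by (cases p)
      with that have E: "planted x S E" "neighbours x E = {a, b}" by (auto simp: planted_edges_def)
      have "insert {x, a} (insert {x, b} {e \<in> E. x \<notin> e}) = E"
        using planted_eq_neighbours[OF E(1) assms(2,3)] unfolding E(2) by auto
      with p show ?thesis by simp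
    qed
    show "?f (?g q) = q" if "q \<in> bridged_triples S" for q
    proof -
      obtain a b E where q: "q = (a, b, E)" by (cases q)
      with that have c: "cactus S E" by (simp add: bridged_triples_def)
      then have "{e \<in> insert {x, a} (insert {x, b} E). x \<notin> e} = E"
        using cactusD(3)[OF c] assms(2) by auto
      with q show ?thesis by simp
    qed
  qed
  then have "card (bridged_triples S) = card ?D" by (rule bij_betw_same_card[symmetric])
  also have "\<dots> = (\<Sum>E\<in>planted_edges x S. card {(a, b). neighbours x E = {a, b}})"
    using assms(1) fin by (intro card_SigmaI) auto
  finally show ?thesis .
qed

text \<open>
  The root of a planted cactus has one neighbour (counted once as a rooted cactus and once as a pair
  \<open>a = b\<close>) or two (counted as two ordered pairs).
\<close>

lemma card_planted_edges:
  assumes "finite S" "x \<notin> S" "S \<noteq> {}"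
  shows "2 * card (planted_edges x S) = card S * card (cactus_edges S) + card (bridged_triples S)"
proof -
  have "card {a. neighbours x E = {a}} + card {(a, b). neighbours x E = {a, b}} = 2" if "E \<in> planted_edges x S" for E
  proof -
    have "planted x S E" using that by (simp add: planted_edges_def)
    then show ?thesis
    proof (rule planted_neighbours[OF _ assms(2,3)])
      fix a assume N: "neighbours x E = {a}"
      have "{a'. neighbours x E = {a'}} = {a}" "{(a', b'). neighbours x E = {a', b'}} = {(a, a)}"
        unfolding N by auto
      then show ?thesis by simp
    next
      fix a b assume N: "neighbours x E = {a, b}" "a \<noteq> b"
      then have "{a'. neighbours x E = {a'}} = {}" "{(a', b'). neighbours x E = {a', b'}} = {(a, b), (b, a)}"
        unfolding N by (auto simp: doubleton_eq_iff)
      then show ?thesis using N(2) by simp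
    qed
  qed
  then have "(\<Sum>E\<in>planted_edges x S. card {a. neighbours x E = {a}} + card {(a, b). neighbours x E = {a, b}}) =
      (\<Sum>E\<in>planted_edges x S. 2)"
    by (rule sum.cong[OF refl])
  then show ?thesis
    unfolding card_rooted_cacti_planted[OF assms] card_bridged_triples_planted[OF assms] sum.distrib[symmetric]
    by simp
qed

text \<open>The first summand is the diagonal \<open>a = b\<close>. In the sum, \<open>A\<close> is
  the side cut off by the first bridge, rooted at \<open>a\<close>, and the triple on
  \<open>S - A\<close> starts at the far end of that bridge.\<close>

lemma card_bridged_triples_rec:
  assumes "finite S"
  shows "card (bridged_triples S) = card S * card (cactus_edges S) +
    (\<Sum>A | A \<subseteq> S \<and> A \<noteq> {} \<and> A \<noteq> S. card A * card (cactus_edges A) * card (bridged_triples (S - A)))"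
proof -
  let ?I = "{A. A \<subseteq> S \<and> A \<noteq> {} \<and> A \<noteq> S}"
  let ?D = "SIGMA A:?I. (A \<times> cactus_edges A) \<times> bridged_triples (S - A)"
  let ?f = "\<lambda>(A, (a, E1), (a', b, E2)). (a, b, insert {a, a'} (E1 \<union> E2))"
  let ?eq = "{(a, b, E) \<in> bridged_triples S. a = b}"
  let ?ne = "{(a, b, E) \<in> bridged_triples S. a \<noteq> b}"
  have "bij_betw ?f ?D ?ne"
  proof (rule bij_betw_imageI)
    show "inj_on ?f ?D"
    proof (rule inj_onI)
      fix p q assume p: "p \<in> ?D" and q: "q \<in> ?D" and eq: "?f p = ?f q"
      obtain A a E1 a' b E2 where p_eq: "p = (A, (a, E1), (a', b, E2))" by (metis prod.exhaust)
      obtain B c F1 c' d F2 where q_eq: "q = (B, (c, F1), (c', d, F2))" by (metis prod.exhaust)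
      have cd: "c = a" "d = b" and E: "insert {a, a'} (E1 \<union> E2) = insert {a, c'} (F1 \<union> F2)"
        using eq by (auto simp: p_eq q_eq)
      have P: "A \<subseteq> S" "cactus A E1" "cactus (S - A) E2" "A \<inter> (S - A) = {}" "a \<in> A" "a' \<in> S - A" "b \<in> S - A"
          "(a', b) \<in> linked (bridge_edges E2)"
        using p unfolding p_eq by (auto simp: cactus_edges_def bridged_triples_def)
      have Q: "B \<subseteq> S" "cactus B F1" "cactus (S - B) F2" "B \<inter> (S - B) = {}" "a \<in> B" "c' \<in> S - B" "b \<in> S - B"
          "(c', b) \<in> linked (bridge_edges F2)"
        using q unfolding q_eq cd by (auto simp: cactus_edges_def bridged_triples_def)
      note P' = join_bridged[OF P(2-8)]
      note Q' = join_bridged[OF Q(2-8), folded E]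
      \<comment> \<open>The two decompositions might use different first bridges. Both far ends
        reach \<open>b\<close> without \<open>a\<close>, which makes them equal; only then can the
        pieces be compared.\<close>
      have "{a, c'} \<in> insert {a, a'} (E1 \<union> E2)" unfolding E by simp
      from join_bridged_unique_neighbour[OF P(2-6) P'(7) Q'(7) this refl] have c': "c' = a'" .
      have "A = B" using P'(4) Q'(4) unfolding c' by (rule trans[OF _ sym])
      moreover have "E1 = F1" using P'(5) Q'(5) unfolding \<open>A = B\<close> by (rule trans[OF _ sym])
      moreover have "E2 = F2" using P'(6) Q'(6) unfolding \<open>A = B\<close> by (rule trans[OF _ sym])
      ultimately show "p = q" by (simp add: p_eq q_eq cd c')
    qed
    show "?f ` ?D = ?ne"
    proof (intro subset_antisym subsetI)
      fix q assume "q \<in> ?f ` ?D"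
      then obtain p where p: "p \<in> ?D" "q = ?f p" by blast
      obtain A a E1 a' b E2 where p_eq: "p = (A, (a, E1), (a', b, E2))" by (metis prod.exhaust)
      have q: "q = (a, b, insert {a, a'} (E1 \<union> E2))" using p(2) by (simp add: p_eq)
      have P: "A \<subseteq> S" "cactus A E1" "cactus (S - A) E2" "A \<inter> (S - A) = {}" "a \<in> A" "a' \<in> S - A" "b \<in> S - A"
          "(a', b) \<in> linked (bridge_edges E2)"
        using p(1) unfolding p_eq by (auto simp: cactus_edges_def bridged_triples_def)
      have "A \<union> (S - A) = S" using P(1) by blast
      with join_bridged(1,2)[OF P(2-8)] P(1,5,7) show "q \<in> ?ne"
        unfolding q by (auto simp: bridged_triples_def)
    next
      fix q assume "q \<in> ?ne"
      then obtain a b E where q: "q = (a, b, E)" and *: "cactus S E" "a \<in> S" "b \<in> S" "a \<noteq> b"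
          "(a, b) \<in> linked (bridge_edges E)"
        by (auto simp: bridged_triples_def)
      from bridged_split[OF *] obtain A E1 a' E2 where A: "A \<subseteq> S" "cactus A E1" "a \<in> A"
        "cactus (S - A) E2" "a' \<in> S - A" "b \<in> S - A"
        "(a', b) \<in> linked (bridge_edges E2)" "E = insert {a, a'} (E1 \<union> E2)" .
      show "q \<in> ?f ` ?D"
      proof (rule image_eqI)
        show "q = ?f (A, (a, E1), (a', b, E2))" by (simp add: q A(8))
        show "(A, (a, E1), (a', b, E2)) \<in> ?D"
          using A by (auto simp: cactus_edges_def bridged_triples_def)
      qed
    qed
  qed
  then have "card ?ne = card ?D" by (rule bij_betw_same_card[symmetric])
  also have "\<dots> = (\<Sum>A\<in>?I. card ((A \<times> cactus_edges A) \<times> bridged_triples (S - A)))"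
  proof (rule card_SigmaI)
    have "finite A" if "A \<subseteq> S" for A using that assms finite_subset by blast
    then show "\<forall>A\<in>?I. finite ((A \<times> cactus_edges A) \<times> bridged_triples (S - A))" using assms by auto
  qed (use assms in auto)
  finally have ne: "card ?ne = (\<Sum>A\<in>?I. card A * card (cactus_edges A) * card (bridged_triples (S - A)))"
    by (simp add: card_cartesian_product)
  have "?eq = (\<lambda>(a, E). (a, a, E)) ` (S \<times> cactus_edges S)"
    by (auto simp: bridged_triples_def cactus_edges_def)
  moreover have "inj_on (\<lambda>(a, E). (a, a, E)) (S \<times> cactus_edges S)" by (auto simp: inj_on_def)
  ultimately have eq: "card ?eq = card S * card (cactus_edges S)"
    by (simp add: card_image card_cartesian_product)
  have fin: "finite ?eq" "finite ?ne"
    by (rule finite_subset[OF _ finite_bridged_triples[OF assms]]; blast)+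
  have "bridged_triples S = ?eq \<union> ?ne" by auto
  also have "card \<dots> = card ?eq + card ?ne" by (rule card_Un_disjoint[OF fin]) auto
  finally have "card (bridged_triples S) = card ?eq + card ?ne" .
  with eq ne show ?thesis by simp
qed

section \<open>Recurrences for the counting sequences\<close>

lemma sum_subsets_by_card:
  fixes g :: "nat \<Rightarrow> nat"
  assumes "finite S" "finite K"
  shows "(\<Sum>A | A \<subseteq> S \<and> card A \<in> K. g (card A)) = (\<Sum>k\<in>K. (card S choose k) * g k)"
proof -
  have "(\<Sum>A | A \<subseteq> S \<and> card A \<in> K. g (card A)) =
      (\<Sum>k\<in>K. \<Sum>A\<in>{A \<in> {A. A \<subseteq> S \<and> card A \<in> K}. card A = k}. g (card A))"
    by (rule sum.group[symmetric]) (use assms in auto)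
  also have "\<dots> = (\<Sum>k\<in>K. (card S choose k) * g k)"
  proof (rule sum.cong[OF refl])
    fix k assume "k \<in> K"
    then have "{A \<in> {A. A \<subseteq> S \<and> card A \<in> K}. card A = k} = {A. A \<subseteq> S \<and> card A = k}" by auto
    then show "(\<Sum>A\<in>{A \<in> {A. A \<subseteq> S \<and> card A \<in> K}. card A = k}. g (card A)) = (card S choose k) * g k"
      using n_subsets[OF assms(1), of k] by simp
  qed
  finally show ?thesis .
qed

text \<open>The range \<open>{1..<n}\<close> makes the recursion well-founded. The terms for
  \<open>k = 0\<close> and \<open>k = n\<close> vanish, so the full convolution is recovered in
  \<open>bridged_count_rec\<close>.\<close>

fun bridged_count :: "nat \<Rightarrow> nat" where
  "bridged_count n = n * cactus_count n +
     (\<Sum>k\<in>{1..<n}. (n choose k) * (k * cactus_count k * bridged_count (n - k)))"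

declare bridged_count.simps [simp del]

lemma card_bridged_triples: "finite S \<Longrightarrow> card (bridged_triples S) = bridged_count (card S)"
proof (induction S rule: finite_psubset_induct)
  case (psubset S)
  let ?I = "{A. A \<subseteq> S \<and> A \<noteq> {} \<and> A \<noteq> S}"
  have I: "?I = {A. A \<subseteq> S \<and> card A \<in> {1..<card S}}"
  proof (intro subset_antisym subsetI)
    fix A assume "A \<in> ?I"
    then show "A \<in> {A. A \<subseteq> S \<and> card A \<in> {1..<card S}}"
      using psubset(1) psubset_card_mono[of S A] finite_subset[of A S]
      by (auto simp: Suc_le_eq card_gt_0_iff)
  qed auto
  have "card (bridged_triples S) = card S * cactus_count (card S) +
    (\<Sum>A\<in>?I. card A * cactus_count (card A) * bridged_count (card S - card A))"
    unfolding card_bridged_triples_rec[OF psubset(1)] card_cactus_edges[OF psubset(1)]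
  proof (intro arg_cong2[of _ _ _ _ "(+)"] refl sum.cong)
    fix A assume A: "A \<in> ?I"
    then have "finite A" "S - A \<subset> S" using finite_subset psubset(1) by auto
    then show "card A * card (cactus_edges A) * card (bridged_triples (S - A)) =
        card A * cactus_count (card A) * bridged_count (card S - card A)"
      using A psubset(2)[of "S - A"] by (simp add: card_cactus_edges card_Diff_subset)
  qed
  also have "\<dots> = bridged_count (card S)"
    unfolding I sum_subsets_by_card[OF psubset(1) finite_atLeastLessThan,
        where g = "\<lambda>k. k * cactus_count k * bridged_count (card S - k)"]
    by (simp add: bridged_count.simps[of "card S"])
  finally show ?case .
qed

lemma bridged_count_0 [simp]: "bridged_count 0 = 0"
  by (subst bridged_count.simps) simp

lemma bridged_count_rec:
  "bridged_count n = n * cactus_count n +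
     (\<Sum>k\<le>n. (n choose k) * (k * cactus_count k * bridged_count (n - k)))"
proof -
  have "(\<Sum>k\<le>n. (n choose k) * (k * cactus_count k * bridged_count (n - k))) =
    (\<Sum>k\<in>{1..<n}. (n choose k) * (k * cactus_count k * bridged_count (n - k)))"
    by (rule sum.mono_neutral_right) (auto simp: not_less Suc_le_eq)
  then show ?thesis by (subst bridged_count.simps) simp
qed

text \<open>The root is 0 and the marked label is 1; its component takes \<open>j\<close> of the
  \<open>m\<close> other labels, hence the size \<open>Suc j\<close>. The factor 2 avoids halving
  the count of planted cacti.\<close>

lemma cactus_count_rec:
  "2 * cactus_count (Suc (Suc m)) =
     (\<Sum>j\<le>m. (m choose j) * ((Suc j * cactus_count (Suc j) + bridged_count (Suc j)) * cactus_count (Suc (m - j))))"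
proof -
  let ?U = "{1..Suc m}" and ?W = "{2..Suc m}"
  let ?g = "\<lambda>j. (Suc j * cactus_count (Suc j) + bridged_count (Suc j)) * cactus_count (Suc (m - j))"
  have U: "?U = insert 1 ?W" by auto
  have "2 * cactus_count (Suc (Suc m)) = 2 * card (cactus_edges (insert 0 ?U))"
    by (subst card_cactus_edges) auto
  also have "\<dots> = (\<Sum>S | S \<subseteq> ?U \<and> 1 \<in> S. 2 * card (planted_edges 0 S) * card (cactus_edges (insert 0 (?U - S))))"
    by (subst card_split_at_root_component[where u = 1]) (auto simp: sum_distrib_left mult.assoc)
  also have "\<dots> = (\<Sum>A\<in>Pow ?W. ?g (card A))"
  proof (rule sum.reindex_bij_witness[where i = "insert 1" and j = "\<lambda>S. S - {1}"])
    fix S :: "nat set" assume "S \<in> {S. S \<subseteq> ?U \<and> 1 \<in> S}"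
    then have S: "S \<subseteq> ?U" "1 \<in> S" by auto
    have fin: "finite S" using S finite_subset by blast
    have 0: "0 \<notin> S" using S by auto
    show "insert 1 (S - {1}) = S" using S by auto
    show "S - {1} \<in> Pow ?W" using S by auto
    have c: "card S = Suc (card (S - {1}))" using fin S(2) by (rule card.remove)
    have "card (?U - S) = Suc m - card S" using S(1) fin by (simp add: card_Diff_subset)
    then have "card (insert 0 (?U - S)) = Suc (m - card (S - {1}))" using c by simp
    then have "card (cactus_edges (insert 0 (?U - S))) = cactus_count (Suc (m - card (S - {1})))"
      by (subst card_cactus_edges) auto
    moreover have "2 * card (planted_edges 0 S) = card S * cactus_count (card S) + bridged_count (card S)"
      using card_planted_edges[OF fin 0] S(2) card_cactus_edges[OF fin] card_bridged_triples[OF fin] by auto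
    ultimately show "?g (card (S - {1})) = 2 * card (planted_edges 0 S) * card (cactus_edges (insert 0 (?U - S)))"
      by (simp only: c)
  qed auto
  also have "\<dots> = (\<Sum>A | A \<subseteq> ?W \<and> card A \<in> {..m}. ?g (card A))"
  proof (rule sum.cong[OF _ refl])
    have "card A \<le> m" if "A \<subseteq> ?W" for A using card_mono[OF _ that] by simp
    then show "Pow ?W = {A. A \<subseteq> ?W \<and> card A \<in> {..m}}" by auto
  qed
  also have "\<dots> = (\<Sum>j\<le>m. (card ?W choose j) * ?g j)"
    by (rule sum_subsets_by_card) auto
  finally show ?thesis by simp
qed

section \<open>The dominant singularity of rooted cacti\<close>

definition rooted_fps :: "real fps" where
  "rooted_fps = Abs_fps (\<lambda>n. real (n * cactus_count n) / fact n)"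

definition bridged_fps :: "real fps" where
  "bridged_fps = Abs_fps (\<lambda>n. real (bridged_count n) / fact n)"

text \<open>Half the sum \<open>T + P\<close> rather than an enumeration of planted cacti: this
  leaves out the degenerate one with \<open>S = {}\<close> and makes the constant term 0.\<close>

definition planted_fps :: "real fps" where
  "planted_fps = fps_const (1/2) * (rooted_fps + bridged_fps)"

lemma card_cacti_eq: "card {G \<in> cacti. verts G = V} = card (cactus_edges V)"
proof -
  have "{G \<in> cacti. verts G = V} = Pair V ` cactus_edges V"
    by (auto simp: cactus_iff cactus_edges_def)
  then show ?thesis by (simp add: card_image inj_on_def)
qed

lemma C_egf_nth: "fps_nth C_egf n = real (cactus_count n) / fact n"
  by (simp add: C_egf_def egf_def card_cacti_eq cactus_count_def)

lemma C_pointed_eq: "C_pointed = rooted_fps"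
proof (rule fps_ext)
  fix n show "fps_nth C_pointed n = fps_nth rooted_fps n"
    by (cases n) (simp_all add: C_pointed_def rooted_fps_def C_egf_nth)
qed

lemma rooted_fps_eq: "rooted_fps = fps_X * fps_deriv C_egf"
  using C_pointed_eq by (simp add: C_pointed_def)

lemma egf_coeff_nonneg:
  "0 \<le> fps_nth C_egf n" "0 \<le> fps_nth rooted_fps n" "0 \<le> fps_nth bridged_fps n" "0 \<le> fps_nth planted_fps n"
  "0 \<le> fps_nth (fps_deriv C_egf) n"
  by (simp_all add: C_egf_nth rooted_fps_def bridged_fps_def planted_fps_def)

lemma bridged_fps_eq: "bridged_fps = rooted_fps + rooted_fps * bridged_fps"
proof (rule fps_ext)
  fix n
  have "real (bridged_count n) = real n * cactus_count n +
      (\<Sum>k\<le>n. real (n choose k) * (real k * cactus_count k * bridged_count (n - k)))"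
    by (subst bridged_count_rec) (simp add: mult.assoc)
  also have "(\<Sum>k\<le>n. real (n choose k) * (real k * cactus_count k * bridged_count (n - k))) =
     fact n * (\<Sum>k\<le>n. (real k * cactus_count k / fact k) * (real (bridged_count (n - k)) / fact (n - k)))"
    unfolding sum_distrib_left
    by (intro sum.cong) (auto simp: binomial_fact field_simps)
  finally show "fps_nth bridged_fps n = fps_nth (rooted_fps + rooted_fps * bridged_fps) n"
    by (simp add: bridged_fps_def rooted_fps_def fps_mult_nth add_divide_distrib atLeast0AtMost)
qed

lemma planted_fps_nth: "fps_nth planted_fps n = (fps_nth rooted_fps n + fps_nth bridged_fps n) / 2"
  by (simp add: planted_fps_def)

lemma deriv_C_egf_nth: "fps_nth (fps_deriv C_egf) n = real (cactus_count (Suc n)) / fact n"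
  by (simp add: C_egf_nth)

lemma deriv_deriv_C_egf: "fps_deriv (fps_deriv C_egf) = fps_deriv planted_fps * fps_deriv C_egf"
proof (rule fps_ext)
  fix m
  have "2 * real (cactus_count (Suc (Suc m))) =
     (\<Sum>j\<le>m. real (m choose j) * ((real (Suc j) * cactus_count (Suc j) + bridged_count (Suc j)) * cactus_count (Suc (m - j))))"
    using cactus_count_rec[of m, THEN arg_cong[where f = real]]
    by (simp only: of_nat_mult of_nat_add of_nat_sum of_nat_numeral)
  also have "\<dots> = fact m * (\<Sum>j\<le>m. (2 * (real (Suc j) * fps_nth planted_fps (Suc j))) *
      fps_nth (fps_deriv C_egf) (m - j))"
    unfolding sum_distrib_left
  proof (intro sum.cong refl)
    fix j assume "j \<in> {..m}"
    then have c: "real (m choose j) = fact m / (fact j * fact (m - j))" by (simp add: binomial_fact)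
    have "2 * (real (Suc j) * fps_nth planted_fps (Suc j)) =
        (real (Suc j) * cactus_count (Suc j) + bridged_count (Suc j)) / fact j"
      by (simp add: planted_fps_nth rooted_fps_def bridged_fps_def field_simps del: of_nat_Suc)
    then show "real (m choose j) * ((real (Suc j) * cactus_count (Suc j) + bridged_count (Suc j)) * cactus_count (Suc (m - j))) =
       fact m * ((2 * (real (Suc j) * fps_nth planted_fps (Suc j))) * fps_nth (fps_deriv C_egf) (m - j))"
      unfolding c deriv_C_egf_nth by simp
  qed
  finally have "real (cactus_count (Suc (Suc m))) / fact m =
      (\<Sum>j\<le>m. (real (Suc j) * fps_nth planted_fps (Suc j)) * fps_nth (fps_deriv C_egf) (m - j))"
    by (simp add: sum_distrib_left[symmetric] mult.assoc del: of_nat_Suc)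
  moreover have "fps_nth (fps_deriv (fps_deriv C_egf)) m = real (cactus_count (Suc (Suc m))) / fact m"
    unfolding fps_deriv_nth[of "fps_deriv C_egf"] deriv_C_egf_nth by (simp del: of_nat_Suc)
  ultimately show "fps_nth (fps_deriv (fps_deriv C_egf)) m = fps_nth (fps_deriv planted_fps * fps_deriv C_egf) m"
    by (simp add: fps_mult_nth atLeast0AtMost)
qed

lemma egf_coeff_0: "fps_nth rooted_fps 0 = 0" "fps_nth planted_fps 0 = 0" "fps_nth (fps_deriv C_egf) 0 = 1"
  by (simp_all add: rooted_fps_def bridged_fps_def planted_fps_nth C_egf_nth)

text \<open>A polynomial in \<open>x\<close>, so it can be evaluated and differentiated everywhere
  before anything is known about convergence.\<close>

definition trunc_eval :: "real fps \<Rightarrow> nat \<Rightarrow> real \<Rightarrow> real" where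
  "trunc_eval F N x = (\<Sum>n\<le>N. fps_nth F n * x ^ n)"

lemma trunc_eval_nonneg: "(\<And>n. 0 \<le> fps_nth F n) \<Longrightarrow> 0 \<le> x \<Longrightarrow> 0 \<le> trunc_eval F N x"
  by (auto simp: trunc_eval_def intro!: sum_nonneg)

text \<open>The product of the truncations contains all terms of degree at most \<open>N\<close>
  and, besides them, only nonnegative ones: a triangle of index pairs inside a square.\<close>

lemma trunc_eval_mult_le:
  assumes "\<And>n. 0 \<le> fps_nth F n" "\<And>n. 0 \<le> fps_nth G n" "0 \<le> x"
  shows "trunc_eval (F * G) N x \<le> trunc_eval F N x * trunc_eval G N x"
proof -
  let ?g = "\<lambda>i j. (fps_nth F i * x ^ i) * (fps_nth G j * x ^ j)"
  have "trunc_eval (F * G) N x = (\<Sum>k\<le>N. \<Sum>i\<le>k. ?g i (k - i))"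
    unfolding trunc_eval_def fps_mult_nth atLeast0AtMost sum_distrib_right
  proof (intro sum.cong refl)
    fix k i :: nat assume "i \<in> {..k}"
    then have "x ^ k = x ^ i * x ^ (k - i)" by (simp add: power_add[symmetric])
    then show "fps_nth F i * fps_nth G (k - i) * x ^ k = ?g i (k - i)" by (simp add: mult_ac)
  qed
  also have "\<dots> = (\<Sum>(i, j)\<in>{(i, j). i + j \<le> N}. ?g i j)"
    by (rule sum.triangle_reindex_eq[symmetric])
  also have "\<dots> \<le> (\<Sum>(i, j)\<in>{..N} \<times> {..N}. ?g i j)"
    by (rule sum_mono2) (use assms in auto)
  also have "\<dots> = trunc_eval F N x * trunc_eval G N x"
    unfolding trunc_eval_def sum_product by (simp add: sum.cartesian_product)
  finally show ?thesis .
qed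

lemma trunc_eval_deriv:
  "(trunc_eval F (Suc N) has_field_derivative trunc_eval (fps_deriv F) N x) (at x)"
proof -
  have "((\<lambda>x. fps_nth F n * x ^ n) has_field_derivative fps_nth F n * (real n * x ^ (n - 1))) (at x)" for n
    by (auto intro!: derivative_eq_intros)
  then have "((\<lambda>x. \<Sum>n\<le>Suc N. fps_nth F n * x ^ n) has_field_derivative
      (\<Sum>n\<le>Suc N. fps_nth F n * (real n * x ^ (n - 1)))) (at x)"
    by (rule DERIV_sum)
  also have "(\<Sum>n\<le>Suc N. fps_nth F n * (real n * x ^ (n - 1))) = trunc_eval (fps_deriv F) N x"
    unfolding trunc_eval_def by (subst sum.atMost_Suc_shift) (auto intro!: sum.cong)
  finally show ?thesis unfolding trunc_eval_def .
qed

lemma trunc_eval_mono_N: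
  assumes "\<And>n. 0 \<le> fps_nth F n" "0 \<le> x"
  shows "trunc_eval F N x \<le> trunc_eval F (Suc N) x"
  using assms by (simp add: trunc_eval_def)

text \<open>Gronwall's argument, with the linear differential equation truncated to an inequality.\<close>

lemma trunc_eval_le_exp:
  assumes "fps_deriv G = fps_deriv F * G" "fps_nth G 0 = 1" "fps_nth F 0 = 0"
    "\<And>n. 0 \<le> fps_nth F n" "\<And>n. 0 \<le> fps_nth G n" "0 \<le> x"
  shows "trunc_eval G N x \<le> exp (trunc_eval F N x)"
proof (cases N)
  case 0
  then show ?thesis using assms(2,3) by (simp add: trunc_eval_def)
next
  case (Suc M)
  let ?h = "\<lambda>x. trunc_eval G N x * exp (- trunc_eval F N x)"
  have "?h x \<le> ?h 0"
  proof (rule DERIV_nonpos_imp_nonincreasing[OF assms(6)])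
    fix u :: real assume u: "0 \<le> u" "u \<le> x"
    have d: "(?h has_field_derivative (trunc_eval (fps_deriv G) M u - trunc_eval (fps_deriv F) M u * trunc_eval G N u) *
        exp (- trunc_eval F N u)) (at u)"
      unfolding Suc
      by (rule derivative_eq_intros trunc_eval_deriv refl)+ (simp add: algebra_simps)
    have "trunc_eval (fps_deriv G) M u \<le> trunc_eval (fps_deriv F) M u * trunc_eval G M u"
      unfolding assms(1) using assms(4,5) u by (intro trunc_eval_mult_le) auto
    \<comment> \<open>Differentiation lowers the truncation degree to \<open>M\<close>;
      nonnegativity allows raising it again for \<open>G\<close>.\<close>
    also have "\<dots> \<le> trunc_eval (fps_deriv F) M u * trunc_eval G N u"
      unfolding Suc using assms(4,5) u by (intro mult_left_mono trunc_eval_mono_N trunc_eval_nonneg) auto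
    finally have "(trunc_eval (fps_deriv G) M u - trunc_eval (fps_deriv F) M u * trunc_eval G N u) *
        exp (- trunc_eval F N u) \<le> 0" by (intro mult_nonpos_nonneg) auto
    with d show "\<exists>y. (?h has_field_derivative y) (at u) \<and> y \<le> 0" by blast
  qed
  also have "?h 0 = 1" using assms(2,3) by (simp add: trunc_eval_def sum.atMost_shift)
  finally show ?thesis by (simp add: exp_minus field_simps)
qed

text \<open>This is \<open>B'(t)\<close>, in the shape \<open>(T + P) / 2\<close> with
  \<open>T = t\<close> and \<open>P = t / (1 - t)\<close>.\<close>

definition block_exponent :: "real \<Rightarrow> real" where
  "block_exponent t = (t + t / (1 - t)) / 2"

definition psi :: "real \<Rightarrow> real" where
  "psi t = t * exp (- block_exponent t)"

text \<open>Truncating \<open>P = T + T P\<close> gives \<open>p \<le> t + t p\<close>, which can be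
  solved for \<open>p\<close> because \<open>t < 1\<close>.\<close>

lemma trunc_eval_P_le:
  assumes "0 \<le> x" "trunc_eval rooted_fps N x \<le> t" "t < 1"
  shows "trunc_eval bridged_fps N x \<le> t / (1 - t)"
proof -
  have "trunc_eval bridged_fps N x = trunc_eval rooted_fps N x + trunc_eval (rooted_fps * bridged_fps) N x"
    by (subst bridged_fps_eq) (simp add: trunc_eval_def sum.distrib algebra_simps)
  also have "\<dots> \<le> t + t * trunc_eval bridged_fps N x"
    using trunc_eval_mult_le[of rooted_fps bridged_fps x N] assms egf_coeff_nonneg
      mult_right_mono[OF assms(2) trunc_eval_nonneg[of bridged_fps x N]] by fastforce
  finally show ?thesis using assms(3) by (simp add: field_simps)
qed

text \<open>With \<open>x = psi t\<close>, the number \<open>t\<close> is a fixed point of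
  \<open>u \<mapsto> x exp (B'(u))\<close>, so the bound reproduces itself. Since
  \<open>T = z C'\<close>, degree \<open>Suc N\<close> of \<open>T\<close> needs only degree
  \<open>N\<close> of \<open>C'\<close>, and the induction closes.\<close>

lemma trunc_eval_T_le:
  assumes "0 \<le> t" "t < 1"
  shows "trunc_eval rooted_fps N (psi t) \<le> t"
proof (induction N)
  case 0
  then show ?case using assms by (simp add: trunc_eval_def egf_coeff_0)
next
  case (Suc N)
  have z: "0 \<le> psi t" using assms by (simp add: psi_def)
  have "trunc_eval rooted_fps (Suc N) (psi t) = psi t * trunc_eval (fps_deriv C_egf) N (psi t)"
    unfolding trunc_eval_def rooted_fps_eq sum_distrib_left
    by (subst sum.atMost_Suc_shift) (auto intro!: sum.cong simp: mult_ac)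
  also have "\<dots> \<le> psi t * exp (block_exponent t)"
  proof (rule mult_left_mono[OF _ z])
    have "trunc_eval (fps_deriv C_egf) N (psi t) \<le> exp (trunc_eval planted_fps N (psi t))"
      by (rule trunc_eval_le_exp[OF deriv_deriv_C_egf]) (simp_all add: egf_coeff_0 egf_coeff_nonneg z del: fps_deriv_nth)
    also have "trunc_eval planted_fps N (psi t) = (trunc_eval rooted_fps N (psi t) + trunc_eval bridged_fps N (psi t)) / 2"
      by (simp add: trunc_eval_def planted_fps_nth sum.distrib[symmetric] sum_divide_distrib algebra_simps add_divide_distrib)
    also have "exp \<dots> \<le> exp (block_exponent t)"
      unfolding block_exponent_def exp_le_cancel_iff
      by (intro divide_right_mono add_mono Suc trunc_eval_P_le[OF z Suc assms(2)]) simp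
    finally show "trunc_eval (fps_deriv C_egf) N (psi t) \<le> exp (block_exponent t)" by simp
  qed
  also have "\<dots> = t" by (simp add: psi_def exp_minus)
  finally show ?case .
qed

section \<open>From truncations to convergent series\<close>

lemma sums_of_partial_le:
  assumes "\<And>n. 0 \<le> fps_nth F n" "0 \<le> x" "\<And>N. trunc_eval F N x \<le> t"
  shows "summable (\<lambda>n. fps_nth F n * x ^ n)" "(\<Sum>n. fps_nth F n * x ^ n) \<le> t"
proof -
  show s: "summable (\<lambda>n. fps_nth F n * x ^ n)"
    using assms unfolding trunc_eval_def by (intro bounded_imp_summable[of _ t]) auto
  show "(\<Sum>n. fps_nth F n * x ^ n) \<le> t"
  proof (rule suminf_le_const[OF s])
    fix n show "(\<Sum>i<n. fps_nth F i * x ^ i) \<le> t"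
    proof (cases n)
      case 0
      have "0 \<le> t" using trunc_eval_nonneg[of F x 0, OF assms(1,2)] assms(3)[of 0] by (rule order_trans)
      with 0 show ?thesis by simp
    next
      case (Suc m)
      then show ?thesis using assms(3)[of m] by (simp add: trunc_eval_def lessThan_Suc_atMost)
    qed
  qed
qed

lemma trunc_eval_le_eval:
  assumes "\<And>n. 0 \<le> fps_nth F n" "0 \<le> x" "summable (\<lambda>n. fps_nth F n * x ^ n)"
  shows "trunc_eval F N x \<le> eval_fps F x"
  unfolding trunc_eval_def eval_fps_def using assms by (intro sum_le_suminf) auto

lemma conv_radius_geI_nonneg:
  assumes "\<And>n. 0 \<le> fps_nth F n" "0 \<le> x" "\<And>N. trunc_eval F N x \<le> t"
  shows "ereal x \<le> fps_conv_radius F"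
  unfolding fps_conv_radius_def
  using conv_radius_geI[OF sums_of_partial_le(1)[OF assms]] assms(2) by simp

text \<open>Only an upper bound on the value: \<open>psi\<close> rises up to \<open>tau\<close> and
  falls afterwards, so \<open>t\<close> need not be the value of \<open>T\<close> at
  \<open>psi t\<close>.\<close>

lemma T_at_psi:
  assumes "0 \<le> t" "t < 1"
  shows "summable (\<lambda>n. fps_nth rooted_fps n * psi t ^ n)" "eval_fps rooted_fps (psi t) \<le> t"
    "ereal (psi t) \<le> fps_conv_radius C_egf"
proof -
  have z: "0 \<le> psi t" using assms by (simp add: psi_def)
  show "summable (\<lambda>n. fps_nth rooted_fps n * psi t ^ n)" "eval_fps rooted_fps (psi t) \<le> t"
    unfolding eval_fps_def
    using sums_of_partial_le[OF egf_coeff_nonneg(2) z trunc_eval_T_le[OF assms]] by auto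
  show "ereal (psi t) \<le> fps_conv_radius C_egf"
  proof (rule conv_radius_geI_nonneg[OF egf_coeff_nonneg(1) z])
    fix N
    have "fps_nth C_egf n \<le> fps_nth rooted_fps n" for n
      unfolding C_egf_nth rooted_fps_def fps_nth_Abs_fps
    proof (intro divide_right_mono of_nat_mono)
      show "cactus_count n \<le> n * cactus_count n" by (cases n) auto
    qed simp
    then have "trunc_eval C_egf N (psi t) \<le> trunc_eval rooted_fps N (psi t)"
      unfolding trunc_eval_def using z by (intro sum_mono mult_right_mono) auto
    also have "\<dots> \<le> t" by (rule trunc_eval_T_le[OF assms])
    finally show "trunc_eval C_egf N (psi t) \<le> t" .
  qed
qed

lemma T_radius: "fps_conv_radius C_egf \<le> fps_conv_radius rooted_fps"
proof -
  have "fps_conv_radius (fps_deriv C_egf) \<le> fps_conv_radius (fps_X * fps_deriv C_egf)"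
    using fps_conv_radius_mult[of fps_X "fps_deriv C_egf"] by simp
  with fps_conv_radius_deriv[of C_egf] show ?thesis unfolding rooted_fps_eq by (rule order_trans)
qed

text \<open>Strictly inside the disc of convergence the differential equation
  \<open>C'' = E' C'\<close> can be integrated exactly, and \<open>P = T + T P\<close> can be solved
  as long as \<open>T < 1\<close>.\<close>

lemma psi_eval_T:
  assumes "0 < z" "ereal z < fps_conv_radius C_egf" "eval_fps rooted_fps z < 1"
  shows "0 \<le> eval_fps rooted_fps z" "psi (eval_fps rooted_fps z) = z"
proof -
  let ?w = "eval_fps rooted_fps"
  have zT: "ereal z < fps_conv_radius rooted_fps" using assms(2) T_radius by (rule less_le_trans)
  have sumT: "summable (\<lambda>n. fps_nth rooted_fps n * x ^ n)" if "0 \<le> x" "ereal x < fps_conv_radius rooted_fps" for x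
    by (rule summable_fps) (use that in simp)
  show w0: "0 \<le> ?w z"
    unfolding eval_fps_def using sumT[of z] zT assms(1) egf_coeff_nonneg by (intro suminf_nonneg) auto
  \<comment> \<open>A point slightly beyond \<open>z\<close> where \<open>T\<close> still converges
    and stays below 1. The estimate for \<open>P\<close> at \<open>r\<close> then yields a radius of
    at least \<open>r\<close>, hence strictly more than \<open>z\<close>.\<close>
  obtain r where r: "z < r" "ereal r < fps_conv_radius rooted_fps" "?w r < 1"
  proof -
    have "isCont ?w z" by (rule continuous_eval_fps) (use zT assms(1) in simp)
    then have "?w \<midarrow>z\<rightarrow> ?w z" by (simp add: isCont_def)
    then have "eventually (\<lambda>x. ?w x < 1) (at z)" by (rule order_tendstoD) (rule assms(3))
    then obtain d where d: "d > 0" "\<And>x. x \<noteq> z \<Longrightarrow> dist x z < d \<Longrightarrow> ?w x < 1"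
      by (auto simp: eventually_at)
    obtain s where s: "ereal z < ereal s" "ereal s < fps_conv_radius rooted_fps" using ereal_dense2[OF zT] by auto
    define x where "x = min s (z + d / 2)"
    have "z < x" "dist x z < d" "x \<le> s" using d(1) s(1) by (auto simp: x_def dist_real_def min_def)
    moreover from \<open>x \<le> s\<close> have "ereal x < fps_conv_radius rooted_fps"
      using s(2) by (metis ereal_less_eq(3) le_less_trans)
    ultimately show thesis using d(2)[of x] that[of x] by auto
  qed
  have r0: "0 \<le> r" using r assms(1) by simp
  have Pr: "ereal r \<le> fps_conv_radius bridged_fps"
    by (rule conv_radius_geI_nonneg[OF egf_coeff_nonneg(3) r0])
      (rule trunc_eval_P_le[OF r0 trunc_eval_le_eval[OF egf_coeff_nonneg(2) r0 sumT[OF r0 r(2)]] r(3)])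
  have rad: "ereal x < fps_conv_radius rooted_fps" "ereal x < fps_conv_radius bridged_fps"
      "ereal x < fps_conv_radius planted_fps" if "x < r" for x
  proof -
    have x: "ereal x < ereal r" using that by simp
    show "ereal x < fps_conv_radius rooted_fps" "ereal x < fps_conv_radius bridged_fps"
      using less_trans[OF x r(2)] less_le_trans[OF x Pr] by simp_all
    then have "ereal x < min (fps_conv_radius rooted_fps) (fps_conv_radius bridged_fps)" by simp
    then have "ereal x < fps_conv_radius (rooted_fps + bridged_fps)"
      using fps_conv_radius_add by (rule less_le_trans)
    then show "ereal x < fps_conv_radius planted_fps"
      unfolding planted_fps_def by (simp add: fps_conv_radius_cmult_left)
  qed
  have D_eq: "fps_deriv C_egf = fps_shift 1 rooted_fps"
    unfolding rooted_fps_eq by (rule fps_ext) simp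
  have radD: "ereal x < fps_conv_radius (fps_deriv C_egf)" if "x < r" for x
    unfolding D_eq using rad(1)[OF that] by simp
  \<comment> \<open>The quotient of \<open>C'\<close> by the expected solution \<open>exp E\<close>;
    its derivative vanishes by the differential equation.\<close>
  define h where "h x = eval_fps (fps_deriv C_egf) x * exp (- eval_fps planted_fps x)" for x
  have dh: "(h has_field_derivative 0) (at x)" if x: "0 \<le> x" "x < r" for x
  proof -
    have nx: "ereal (norm x) < fps_conv_radius planted_fps" "ereal (norm x) < fps_conv_radius (fps_deriv C_egf)"
      using rad(3)[OF x(2)] radD[OF x(2)] x(1) by auto
    have nE: "ereal (norm x) < fps_conv_radius (fps_deriv planted_fps)"
      using nx(1) fps_conv_radius_deriv by (rule less_le_trans)
    have "(h has_field_derivative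
        (eval_fps (fps_deriv (fps_deriv C_egf)) x - eval_fps (fps_deriv planted_fps) x * eval_fps (fps_deriv C_egf) x) *
        exp (- eval_fps planted_fps x)) (at x)"
      unfolding h_def
      by (rule derivative_eq_intros has_field_derivative_eval_fps nx refl)+ (simp add: algebra_simps)
    also have "eval_fps (fps_deriv (fps_deriv C_egf)) x = eval_fps (fps_deriv planted_fps) x * eval_fps (fps_deriv C_egf) x"
      unfolding deriv_deriv_C_egf by (rule eval_fps_mult[OF nE nx(2)])
    finally show ?thesis by simp
  qed
  have "h z = h 0"
  proof (rule DERIV_isconst_end[OF assms(1)])
    show "continuous_on {0..z} h"
      using r(1) by (intro continuous_at_imp_continuous_on ballI DERIV_isCont[OF dh]) auto
  qed (use dh r(1) in auto)
  also have "h 0 = 1" by (simp add: h_def eval_fps_at_0 egf_coeff_0 del: fps_deriv_nth)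
  finally have D: "eval_fps (fps_deriv C_egf) z = exp (eval_fps planted_fps z)"
    by (simp add: h_def exp_minus field_simps)
  have nz: "ereal (norm z) < fps_conv_radius rooted_fps" "ereal (norm z) < fps_conv_radius bridged_fps"
      "ereal (norm z) < fps_conv_radius (fps_deriv C_egf)"
    using rad[OF r(1)] radD[OF r(1)] assms(1) by auto
  have nTP: "ereal (norm z) < fps_conv_radius (rooted_fps * bridged_fps)" "ereal (norm z) < fps_conv_radius (rooted_fps + bridged_fps)"
    by (rule less_le_trans[OF _ fps_conv_radius_mult] less_le_trans[OF _ fps_conv_radius_add],
        use nz(1,2) in simp)+
  have "eval_fps bridged_fps z = ?w z + ?w z * eval_fps bridged_fps z"
    by (subst bridged_fps_eq) (simp only: eval_fps_add[OF nz(1) nTP(1)] eval_fps_mult[OF nz(1,2)])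
  then have P: "eval_fps bridged_fps z = ?w z / (1 - ?w z)" using assms(3) by (simp add: field_simps)
  have "eval_fps planted_fps z = (?w z + eval_fps bridged_fps z) / 2"
    unfolding planted_fps_def using nTP(2) nz by (simp add: eval_fps_mult eval_fps_add)
  then have E: "eval_fps planted_fps z = block_exponent (?w z)" by (simp add: P block_exponent_def)
  have "?w z = z * eval_fps (fps_deriv C_egf) z"
    by (subst rooted_fps_eq) (use nz(3) in \<open>simp add: eval_fps_mult\<close>)
  then have "?w z * exp (- block_exponent (?w z)) =
      z * (exp (block_exponent (?w z)) * exp (- block_exponent (?w z)))"
    by (simp add: D E)
  then show "psi (?w z) = z" by (simp add: psi_def exp_minus_inverse)
qed

text \<open>The cubic is the numerator of \<open>t B''(t) - 1\<close> over
  \<open>2 (1 - t)^2\<close>. It is strictly increasing on the reals, so the description is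
  proper.\<close>

definition tau :: real where
  "tau = (THE z. z ^ 3 - 4 * z ^ 2 + 6 * z - 2 = 0)"

lemma cubic_strict_mono:
  fixes a b :: real
  assumes "a < b"
  shows "a ^ 3 - 4 * a ^ 2 + 6 * a - 2 < b ^ 3 - 4 * b ^ 2 + 6 * b - 2"
proof -
  \<comment> \<open>The divided difference \<open>a^2 + a b + b^2 - 4 a - 4 b + 6\<close>, written
    as a sum of squares plus a positive constant.\<close>
  have "(b ^ 3 - 4 * b ^ 2 + 6 * b - 2) - (a ^ 3 - 4 * a ^ 2 + 6 * a - 2) =
      (b - a) * ((a + b / 2 - 2) ^ 2 + 3 / 4 * (b - 4 / 3) ^ 2 + 2 / 3)"
    by (simp add: power2_eq_square power3_eq_cube algebra_simps)
  moreover have "0 < (b - a) * ((a + b / 2 - 2) ^ 2 + 3 / 4 * (b - 4 / 3) ^ 2 + 2 / 3)"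
    using assms by (intro mult_pos_pos add_nonneg_pos add_nonneg_nonneg) auto
  ultimately show ?thesis by linarith
qed

lemma cubic_less_iff:
  fixes a b :: real
  shows "a ^ 3 - 4 * a ^ 2 + 6 * a - 2 < b ^ 3 - 4 * b ^ 2 + 6 * b - 2 \<longleftrightarrow> a < b"
  using cubic_strict_mono[of a b] cubic_strict_mono[of b a] by (cases a b rule: linorder_cases) auto

lemma cubic_unique:
  fixes a b :: real
  assumes "a ^ 3 - 4 * a ^ 2 + 6 * a - 2 = 0" "b ^ 3 - 4 * b ^ 2 + 6 * b - 2 = 0"
  shows "a = b"
  using cubic_strict_mono[of a b] cubic_strict_mono[of b a] assms by linarith

text \<open>The enclosing decimals come from a sign change of the cubic; this precision serves the
  numerical bounds for \<open>kappa\<close> and \<open>sigma_sq\<close>.\<close>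

lemma tau_root: "tau ^ 3 - 4 * tau ^ 2 + 6 * tau - 2 = 0"
  and tau_bounds: "456310987 / 10 ^ 9 < tau" "tau < 456310988 / 10 ^ 9"
proof -
  let ?q = "\<lambda>z::real. z ^ 3 - 4 * z ^ 2 + 6 * z - 2"
  have "\<exists>x\<ge>456310987 / 10 ^ 9. x \<le> 456310988 / 10 ^ 9 \<and> ?q x = 0"
    by (rule IVT') (auto simp: power2_eq_square power3_eq_cube intro!: continuous_intros)
  then obtain x where x: "?q x = 0" by blast
  have "tau = x" unfolding tau_def by (rule the_equality) (use x cubic_unique in blast)+
  with x show root: "?q tau = 0" by simp
  have "?q (456310987 / 10 ^ 9) < 0" "0 < ?q (456310988 / 10 ^ 9)" by (simp_all add: power2_eq_square power3_eq_cube)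
  then have "?q (456310987 / 10 ^ 9) < ?q tau" "?q tau < ?q (456310988 / 10 ^ 9)"
    unfolding root by this+
  then show "456310987 / 10 ^ 9 < tau" "tau < 456310988 / 10 ^ 9"
    unfolding cubic_less_iff by this+
qed

lemma tau_iff: "z ^ 3 - 4 * z ^ 2 + 6 * z - 2 = (0::real) \<longleftrightarrow> z = tau"
  using tau_root cubic_unique by blast

lemma tau_01: "0 < tau" "tau < 1"
  using tau_bounds by auto

section \<open>The maximum of \<open>psi\<close>\<close>

lemma psi_deriv:
  assumes "t < 1"
  shows "(psi has_field_derivative exp (- block_exponent t) * (1 - t * ((1 + 1 / (1 - t) ^ 2) / 2))) (at t)"
proof -
  have "(block_exponent has_field_derivative (1 + 1 / (1 - t) ^ 2) / 2) (at t)"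
    unfolding block_exponent_def
    using assms by (auto intro!: derivative_eq_intros simp: field_simps power2_eq_square)
  then show ?thesis unfolding psi_def
    by - (rule derivative_eq_intros refl | assumption | simp add: algebra_simps)+
qed

lemma slope_eq_cubic:
  fixes t :: real
  assumes "t \<noteq> 1"
  shows "1 - t * ((1 + 1 / (1 - t) ^ 2) / 2) = - (t ^ 3 - 4 * t ^ 2 + 6 * t - 2) / (2 * (1 - t) ^ 2)"
proof -
  have "1 - t \<noteq> 0" using assms by simp
  then have "1 - t * ((1 + 1 / (1 - t) ^ 2) / 2) = (2 * (1 - t) ^ 2 - t * ((1 - t) ^ 2 + 1)) / (2 * (1 - t) ^ 2)"
    by (simp add: diff_divide_distrib add_divide_distrib distrib_left)
  also have "2 * (1 - t) ^ 2 - t * ((1 - t) ^ 2 + 1) = - (t ^ 3 - 4 * t ^ 2 + 6 * t - 2)"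
    by (simp add: power2_eq_square power3_eq_cube algebra_simps)
  finally show ?thesis .
qed

lemma psi_deriv_sign:
  assumes "t < 1"
  shows "0 < 1 - t * ((1 + 1 / (1 - t) ^ 2) / 2) \<longleftrightarrow> t < tau"
    "1 - t * ((1 + 1 / (1 - t) ^ 2) / 2) < 0 \<longleftrightarrow> tau < t"
    "1 - t * ((1 + 1 / (1 - t) ^ 2) / 2) = 0 \<longleftrightarrow> t = tau"
proof -
  have pos: "0 < 2 * (1 - t) ^ 2" using assms by simp
  note eq = slope_eq_cubic[of t]
  have "- (t ^ 3 - 4 * t ^ 2 + 6 * t - 2) > 0 \<longleftrightarrow> t < tau" "- (t ^ 3 - 4 * t ^ 2 + 6 * t - 2) < 0 \<longleftrightarrow> tau < t"
    using cubic_strict_mono[of t tau] cubic_strict_mono[of tau t] tau_root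
    by (cases "t = tau"; force)+
  then show "0 < 1 - t * ((1 + 1 / (1 - t) ^ 2) / 2) \<longleftrightarrow> t < tau"
    "1 - t * ((1 + 1 / (1 - t) ^ 2) / 2) < 0 \<longleftrightarrow> tau < t"
    using eq assms pos by (auto simp: zero_less_divide_iff divide_less_0_iff)
  then show "1 - t * ((1 + 1 / (1 - t) ^ 2) / 2) = 0 \<longleftrightarrow> t = tau"
    by (metis linorder_neqE_linordered_idom order_less_irrefl)
qed

lemma psi_strict_mono:
  assumes "a < b" "b \<le> tau"
  shows "psi a < psi b"
proof (rule DERIV_pos_imp_increasing_open[OF assms(1)])
  fix x assume x: "a < x" "x < b"
  then have "x < 1" "x < tau" using assms(2) tau_01 by auto
  then show "\<exists>y. (psi has_real_derivative y) (at x) \<and> 0 < y"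
    using psi_deriv[of x] psi_deriv_sign(1)[of x] by (blast intro: mult_pos_pos exp_gt_zero)
next
  show "continuous_on {a..b} psi"
    using assms(2) tau_01 by (intro continuous_at_imp_continuous_on ballI DERIV_isCont[OF psi_deriv]) auto
qed

lemma psi_le_tau:
  assumes "t < 1"
  shows "psi t \<le> psi tau"
proof (cases "t \<le> tau")
  case True
  then show ?thesis using psi_strict_mono[of t tau] by (cases "t = tau") auto
next
  case False
  show ?thesis
  proof (rule DERIV_nonpos_imp_nonincreasing[of tau t psi])
    fix x assume x: "tau \<le> x" "x \<le> t"
    then have "x < 1" using assms by simp
    moreover have "1 - x * ((1 + 1 / (1 - x) ^ 2) / 2) \<le> 0"
      using psi_deriv_sign[OF \<open>x < 1\<close>] x by (cases "x = tau") auto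
    ultimately show "\<exists>y. (psi has_real_derivative y) (at x) \<and> y \<le> 0"
      using psi_deriv[of x] by (blast intro: mult_nonneg_nonpos exp_ge_zero)
  qed (use False in simp)
qed

section \<open>The radius of convergence and the value of \<open>T\<close> there\<close>

lemma C_radius: "fps_conv_radius C_egf = ereal (psi tau)"
proof (rule antisym)
  show "ereal (psi tau) \<le> fps_conv_radius C_egf" using T_at_psi(3) tau_01 by simp
  show "fps_conv_radius C_egf \<le> ereal (psi tau)"
  proof (rule ccontr)
    assume "\<not> fps_conv_radius C_egf \<le> ereal (psi tau)"
    then have less: "ereal (psi tau) < fps_conv_radius C_egf" by simp
    have pos: "0 < psi tau" using tau_01 by (simp add: psi_def)
    have "isCont (eval_fps rooted_fps) (psi tau)"
      by (rule continuous_eval_fps) (use less T_radius pos in \<open>auto intro: less_le_trans\<close>)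
    then have "eval_fps rooted_fps \<midarrow>psi tau\<rightarrow> eval_fps rooted_fps (psi tau)" by (simp add: isCont_def)
    moreover have "eval_fps rooted_fps (psi tau) < 1" using T_at_psi(2)[of tau] tau_01 by simp
    ultimately have "eventually (\<lambda>x. eval_fps rooted_fps x < 1) (at (psi tau))" by (rule order_tendstoD)
    then obtain d where d: "d > 0" "\<And>x. x \<noteq> psi tau \<Longrightarrow> dist x (psi tau) < d \<Longrightarrow> eval_fps rooted_fps x < 1"
      by (auto simp: eventually_at)
    obtain s where s: "ereal (psi tau) < ereal s" "ereal s < fps_conv_radius C_egf"
      using ereal_dense2[OF less] by auto
    \<comment> \<open>A point beyond \<open>psi tau\<close> at which the series would still
      converge, with \<open>T\<close> still below 1 by continuity.\<close>
    define x where "x = min s (psi tau + d / 2)"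
    have x: "psi tau < x" "dist x (psi tau) < d" "x \<le> s"
      using d(1) s(1) by (auto simp: x_def dist_real_def min_def)
    have xR: "ereal x < fps_conv_radius C_egf" using x(3) s(2) by (metis ereal_less_eq(3) le_less_trans)
    have w: "eval_fps rooted_fps x < 1" using d(2)[of x] x by auto
    have "psi (eval_fps rooted_fps x) = x" by (rule psi_eval_T(2)[OF _ xR w]) (use x pos in simp)
    with psi_le_tau[OF w] x(1) show False by simp
  qed
qed

text \<open>The bound \<open>T (psi t) \<le> t\<close> places the value on the branch below
  \<open>tau\<close>, where \<open>psi\<close> is strictly increasing.\<close>

lemma eval_T_psi:
  assumes "0 < t" "t < tau"
  shows "eval_fps rooted_fps (psi t) = t"
proof -
  have t1: "t < 1" using assms tau_01 by simp
  have le: "eval_fps rooted_fps (psi t) \<le> t" using T_at_psi(2) assms t1 by simp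
  have "0 < psi t" using assms by (simp add: psi_def)
  moreover have "ereal (psi t) < fps_conv_radius C_egf"
    using psi_strict_mono[OF assms(2)] C_radius by simp
  ultimately have "psi (eval_fps rooted_fps (psi t)) = psi t" by (rule psi_eval_T) (use le t1 in simp)
  then show ?thesis using psi_strict_mono[of "eval_fps rooted_fps (psi t)" t] le assms
    by (cases "eval_fps rooted_fps (psi t) = t") auto
qed

lemma C_pointed_at_rho:
  "summable (\<lambda>n. fps_nth C_pointed n * rho ^ n)" "eval_fps C_pointed rho = tau"
proof -
  have rho: "rho = psi tau" by (simp add: rho_def C_radius)
  note T = T_at_psi[OF less_imp_le[OF tau_01(1)] tau_01(2)]
  show s: "summable (\<lambda>n. fps_nth C_pointed n * rho ^ n)" unfolding C_pointed_eq rho by (rule T(1))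
  \<comment> \<open>At the radius itself \<open>psi_eval_T\<close> does not apply. The lower bound
    comes from monotonicity: \<open>T (psi tau)\<close> dominates \<open>T (psi t) = t\<close> for
    every \<open>t < tau\<close>.\<close>
  have "tau \<le> eval_fps rooted_fps (psi tau)"
  proof (rule dense_le_bounded[OF tau_01(1)])
    fix t assume t: "0 < t" "t < tau"
    have "t = eval_fps rooted_fps (psi t)" by (rule eval_T_psi[OF t, symmetric])
    also have "\<dots> \<le> eval_fps rooted_fps (psi tau)"
      unfolding eval_fps_def
    proof (rule suminf_le)
      show "summable (\<lambda>n. fps_nth rooted_fps n * psi t ^ n)" using T_at_psi(1)[of t] t tau_01 by simp
      have "0 \<le> psi t" "psi t \<le> psi tau" using t psi_strict_mono[of t tau] by (auto simp: psi_def)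
      then show "fps_nth rooted_fps n * psi t ^ n \<le> fps_nth rooted_fps n * psi tau ^ n" for n
        by (intro mult_left_mono power_mono egf_coeff_nonneg)
    qed (rule T(1))
    finally show "t \<le> eval_fps rooted_fps (psi tau)" .
  qed
  with T(2) show "eval_fps C_pointed rho = tau" unfolding C_pointed_eq rho by (rule antisym)
qed

section \<open>Blocks of cacti\<close>

text \<open>No remaining edge meets \<open>v\<close>, so \<open>v\<close> is reached only from
  itself.\<close>

lemma linked_avoid:
  assumes "(w, v) \<in> linked {e \<in> E. v \<notin> e}"
  shows "w = v"
  using assms by (induction rule: linked_induct) auto

lemma cactus_singletonD: "cactus {a} E \<Longrightarrow> E = {}"
proof (rule ccontr)
  assume c: "cactus {a} E" and "E \<noteq> {}"
  then obtain e where "e \<in> E" by blast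
  then have "e \<subseteq> {a}" "card e = 2" using cactusD(3,4)[OF c] by auto
  then show False using card_mono[of "{a}" e] by auto
qed

text \<open>The last hypothesis says that nothing hangs off the path of bridges: deleting a vertex
  leaves every other one attached to an end. In the induction, the side cut off by the first bridge
  must be \<open>{a}\<close>, because its other vertices could not reach \<open>b\<close> once
  \<open>a\<close> is deleted.\<close>

lemma bridged_cactus_is_path:
  assumes "cactus S E" "a \<in> S" "b \<in> S" "(a, b) \<in> linked (bridge_edges E)"
    "\<And>v w. v \<in> S \<Longrightarrow> w \<in> S \<Longrightarrow> w \<noteq> v \<Longrightarrow>
      (w, a) \<in> linked {e \<in> E. v \<notin> e} \<or> (w, b) \<in> linked {e \<in> E. v \<notin> e}"
  shows "\<exists>xs. distinct xs \<and> xs \<noteq> [] \<and> set xs = S \<and> hd xs = a \<and> last xs = b \<and> E = path_edges xs"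
  using assms
proof (induction "card S" arbitrary: S E a rule: less_induct)
  case less
  show ?case
  proof (cases "a = b")
    case True
    have "w = a" if "w \<in> S" for w
      using less.prems(5)[OF less.prems(2) that] linked_avoid[of w a E] True by blast
    then have S: "S = {a}" using less.prems(2) by blast
    then have "E = {}" using less.prems(1) by (simp add: cactus_singletonD)
    then show ?thesis using S True by (intro exI[of _ "[a]"]) auto
  next
    case False
    from bridged_split[OF less.prems(1-3) this less.prems(4)] obtain A E1 a' E2 where
      A: "A \<subseteq> S" "cactus A E1" "a \<in> A" "cactus (S - A) E2" "a' \<in> S - A" "b \<in> S - A"
        "(a', b) \<in> linked (bridge_edges E2)" and E: "E = insert {a, a'} (E1 \<union> E2)" .
    have "w = a" if "w \<in> A" for w
    proof (rule ccontr)
      assume "w \<noteq> a"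
      have "(w, b) \<in> linked {e \<in> E. a \<notin> e}"
        using less.prems(5)[of a w] less.prems(2) linked_avoid[of w a E] that A(1) \<open>w \<noteq> a\<close> by blast
      then have "b \<in> A" using that
      proof (rule linked_closed)
        fix y z assume "{y, z} \<in> {e \<in> E. a \<notin> e}" "y \<in> A"
        then show "z \<in> A" using cactusD(3)[OF A(2), of "{y, z}"] cactusD(3)[OF A(4), of "{y, z}"] E by auto
      qed
      with A(6) show False by blast
    qed
    then have Aa: "A = {a}" using A(3) by blast
    then have "E1 = {}" using A(2) by (simp add: cactus_singletonD)
    with E have E: "E = insert {a, a'} E2" by simp
    note B = A(4-7)[unfolded Aa]
    have "\<exists>xs. distinct xs \<and> xs \<noteq> [] \<and> set xs = S - {a} \<and> hd xs = a' \<and> last xs = b \<and> E2 = path_edges xs"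
    proof (rule less.hyps[OF _ B])
      show "card (S - {a}) < card S"
        using cactusD(1)[OF less.prems(1)] less.prems(2) by (rule card_Diff1_less)
      fix v w assume v: "v \<in> S - {a}" and w: "w \<in> S - {a}" "w \<noteq> v"
      \<comment> \<open>Contracting \<open>a\<close> into \<open>a'\<close> carries the attachment
        hypothesis over to the rest of the path.\<close>
      let ?f = "\<lambda>w. if w = a then a' else w"
      have *: "(?f w, ?f c) \<in> linked {e \<in> E2. v \<notin> e}" if "(w, c) \<in> linked {e \<in> E. v \<notin> e}" for c
        using that
      proof (rule linked_map)
        fix y z assume yz: "{y, z} \<in> {e \<in> E. v \<notin> e}"
        show "(?f y, ?f z) \<in> linked {e \<in> E2. v \<notin> e}"
        proof (cases "{y, z} = {a, a'}")
          case True
          then have f: "?f y = a'" "?f z = a'" by (auto simp: doubleton_eq_iff)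
          show ?thesis unfolding f by (rule linked_refl)
        next
          case False
          then have yz2: "{y, z} \<in> {e \<in> E2. v \<notin> e}" using yz E by auto
          then have f: "?f y = y" "?f z = z" using cactusD(3)[OF B(1), of "{y, z}"] by auto
          show ?thesis unfolding f using yz2 by (rule linked_edge)
        qed
      qed
      have f: "?f w = w" "?f a = a'" "?f b = b" using w B by auto
      show "(w, a') \<in> linked {e \<in> E2. v \<notin> e} \<or> (w, b) \<in> linked {e \<in> E2. v \<notin> e}"
        using *[of a] *[of b] less.prems(5)[of v w] v w unfolding f by blast
    qed
    then obtain xs where xs: "distinct xs" "xs \<noteq> []" "set xs = S - {a}" "hd xs = a'" "last xs = b" "E2 = path_edges xs"
      by blast
    then show ?thesis using E less.prems(2) by (intro exI[of _ "a # xs"]) (auto simp: path_edges_Cons)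
  qed
qed

lemma cactus_path:
  assumes "distinct xs" "xs \<noteq> []"
  shows "cactus (set xs) (path_edges xs)" "(hd xs, last xs) \<in> linked (bridge_edges (path_edges xs))"
proof -
  have "cactus (set xs) (path_edges xs) \<and> (hd xs, last xs) \<in> linked (bridge_edges (path_edges xs))"
    using assms
  proof (induction xs rule: path_edges.induct)
    case (1 x y xs)
    then have IH: "cactus (set (y # xs)) (path_edges (y # xs))"
        "(y, last (y # xs)) \<in> linked (bridge_edges (path_edges (y # xs)))" by auto
    have "{x} \<inter> set (y # xs) = {}" "last (y # xs) \<in> set (y # xs)"
      using 1(2) last_in_set[of "y # xs"] by auto
    from join_bridged(1,2)[OF cactus_singleton IH(1) this(1) _ _ this(2) IH(2)]
    show ?case by (simp add: insert_commute)
  qed (auto simp: cactus_singleton)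
  then show "cactus (set xs) (path_edges xs)" "(hd xs, last xs) \<in> linked (bridge_edges (path_edges xs))"
    by auto
qed

definition cycle_through :: "'a \<Rightarrow> 'a list \<Rightarrow> 'a set set" where
  "cycle_through x xs = path_edges (x # xs @ [x])"

lemma cycle_through_rev: "cycle_through x (rev xs) = cycle_through x xs"
proof -
  have "x # rev xs @ [x] = rev (x # xs @ [x])" by simp
  then show ?thesis unfolding cycle_through_def by (metis path_edges_rev)
qed

lemma hd_neq_last: "distinct xs \<Longrightarrow> 2 \<le> length xs \<Longrightarrow> hd xs \<noteq> last xs"
  by (cases xs) (auto split: if_splits)

text \<open>All edges of a path are bridges, so closing it through \<open>x\<close> is an instance
  of \<open>cactus_close_bridged\<close>. For two-connectedness the cycle is rotated to start at the
  deleted vertex; what is left is a path.\<close>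

lemma cycle_through_block:
  assumes "distinct (x # xs)" "2 \<le> length xs"
  shows "cactus (insert x (set xs)) (cycle_through x xs)" "two_connected (insert x (set xs), cycle_through x xs)"
proof -
  have ne: "xs \<noteq> []" using assms by auto
  have eq: "cycle_through x xs = insert {x, hd xs} (insert {x, last xs} (path_edges xs))"
    unfolding cycle_through_def using closed_path_edges[OF ne] .
  show c: "cactus (insert x (set xs)) (cycle_through x xs)"
    unfolding eq using assms ne hd_neq_last[of xs] cactus_path[of xs]
    by (intro cactus_close_bridged) auto
  have cy: "is_cycle (cycle_through x xs)" unfolding is_cycle_def cycle_through_def using assms by blast
  have U: "\<Union>(cycle_through x xs) = insert x (set xs)"
    unfolding cycle_through_def using Union_path_edges[of "x # xs @ [x]"] by auto
  have no: "\<not> cutvertex (insert x (set xs), cycle_through x xs) v" for v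
  proof
    assume "cutvertex (insert x (set xs), cycle_through x xs) v"
    then obtain u w where uw: "v \<in> insert x (set xs)" "u \<in> insert x (set xs) - {v}" "w \<in> insert x (set xs) - {v}"
      "(u, w) \<notin> linked {e \<in> cycle_through x xs. v \<notin> e}"
      by (auto simp: cutvertex_def rtrancl_adj delete_vertex_def)
    from is_cycle_rotate[OF cy, of v] U uw(1) obtain ys where ys: "distinct (v # ys)" "2 \<le> length ys"
      "cycle_through x xs = path_edges (v # ys @ [v])" by auto
    have "insert v (set ys) = insert x (set xs)"
      using U ys(3) Union_path_edges[of "v # ys @ [v]"] by auto
    then have uy: "u \<in> set ys" "w \<in> set ys" using uw(2,3) by auto
    have "ys \<noteq> []" using ys by auto
    then have "path_edges ys \<subseteq> {e \<in> cycle_through x xs. v \<notin> e}"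
      unfolding ys(3) closed_path_edges[OF \<open>ys \<noteq> []\<close>] using ys(1) path_edges_subset_set[of _ ys] by auto
    from linked_path_mem(1)[OF uy(1) this] linked_path_mem(1)[OF uy(2) this]
    have "(u, w) \<in> linked {e \<in> cycle_through x xs. v \<notin> e}" using linked_sym linked_trans by fast
    with uw(4) show False ..
  qed
  have "card (insert x (set xs)) = Suc (length xs)" using assms(1) by (simp add: distinct_card)
  then show "two_connected (insert x (set xs), cycle_through x xs)"
    using no c assms(2) unfolding two_connected_def
    by (auto simp: connected_graph_def cactus_def rtrancl_adj)
qed

text \<open>As \<open>x\<close> is no cutvertex, the cactus is planted at \<open>x\<close>. A single
  neighbour of \<open>x\<close> would be a cutvertex; two neighbours are joined by a path of
  bridges, and a vertex hanging off it would again produce a cutvertex.\<close>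

lemma two_connected_cactus_is_cycle:
  assumes "cactus (insert x S) E" "two_connected (insert x S, E)" "x \<notin> S"
  obtains xs where "distinct xs" "set xs = S" "2 \<le> length xs" "E = cycle_through x xs"
proof -
  have fin: "finite S" using cactusD(1)[OF assms(1)] by simp
  have "card (insert x S) \<ge> 3" using assms(2) by (simp add: two_connected_def)
  then have card: "card S \<ge> 2" using fin assms(3) by simp
  then have ne: "S \<noteq> {}" by auto
  have nocut: "(u, w) \<in> linked {e \<in> E. v \<notin> e}"
    if "v \<in> insert x S" "u \<in> insert x S - {v}" "w \<in> insert x S - {v}" for u v w
  proof -
    have "(u, w) \<in> linked E" using cactusD(5)[OF assms(1)] that by blast
    moreover have "\<not> cutvertex (insert x S, E) v" using assms(2) by (simp add: two_connected_def)
    ultimately show ?thesis using that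
      by (auto simp: cutvertex_def rtrancl_adj delete_vertex_def)
  qed
  have pl: "planted x S E"
    unfolding planted_def using assms(1,3) nocut[of x] by auto
  let ?E = "{e \<in> E. x \<notin> e}"
  \<comment> \<open>A walk to \<open>x\<close> avoiding \<open>v\<close> enters \<open>x\<close>
    from a neighbour of \<open>x\<close>; stopping there avoids \<open>x\<close> as well.\<close>
  have reach: "\<exists>c\<in>neighbours x E. (w, c) \<in> linked {e \<in> ?E. v \<notin> e}"
    if "v \<in> S" "w \<in> S" "w \<noteq> v" for v w
  proof -
    have "(w, x) \<in> linked {e \<in> E. v \<notin> e}" using nocut[of v w x] that assms(3) by auto
    then have "w \<noteq> x \<longrightarrow> (\<exists>c\<in>neighbours x E. (w, c) \<in> linked {e \<in> ?E. v \<notin> e})"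
    proof (induction rule: linked_induct)
      case (step y z)
      show ?case
      proof (cases "z = x")
        case True
        then show ?thesis using step(1) by (auto simp: neighbours_def insert_commute)
      next
        case False
        with step obtain c where c: "c \<in> neighbours x E" "(z, c) \<in> linked {e \<in> ?E. v \<notin> e}" by blast
        show ?thesis
        proof
          assume "y \<noteq> x"
          then have "{y, z} \<in> {e \<in> ?E. v \<notin> e}" using step(1) False by auto
          from linked_step[OF this c(2)] c(1) show "\<exists>c\<in>neighbours x E. (y, c) \<in> linked {e \<in> ?E. v \<notin> e}" by blast
        qed
      qed
    qed simp
    then show ?thesis using that assms(3) by auto
  qed
  show thesis
  proof (rule planted_neighbours[OF pl assms(3) ne])
    fix a assume a: "a \<in> S" "neighbours x E = {a}"
    have "\<exists>s\<in>S. s \<noteq> a"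
    proof (rule ccontr)
      assume "\<not> ?thesis"
      then have "S \<subseteq> {a}" by blast
      then show False using card card_mono[of "{a}" S] by auto
    qed
    then obtain s where s: "s \<in> S" "s \<noteq> a" by blast
    have "(s, a) \<in> linked {e \<in> ?E. a \<notin> e}" using reach[OF a(1) s] a(2) by simp
    from linked_avoid[OF this] s(2) show thesis by simp
  next
    fix a b assume ab: "a \<in> S" "b \<in> S" "a \<noteq> b" "neighbours x E = {a, b}"
    have "{x, a} \<in> E" "{x, b} \<in> E" using ab(4) by (auto simp: neighbours_def)
    from planted_bridged[OF pl assms(3) this ab(3)]
    have "\<exists>xs. distinct xs \<and> xs \<noteq> [] \<and> set xs = S \<and> hd xs = a \<and> last xs = b \<and> ?E = path_edges xs"
      using reach unfolding ab(4)
      by (intro bridged_cactus_is_path planted_remove_root(1)[OF pl assms(3) ne] ab(1,2)) blast+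
    then obtain xs where xs: "distinct xs" "xs \<noteq> []" "set xs = S" "hd xs = a" "last xs = b" "?E = path_edges xs"
      by blast
    have "E = insert {x, a} (insert {x, b} (path_edges xs))"
      using planted_eq_neighbours[OF pl assms(3) ne] unfolding ab(4) xs(6) by auto
    then have "E = cycle_through x xs" unfolding cycle_through_def closed_path_edges[OF xs(2)] xs(4,5) .
    moreover have "2 \<le> length xs" using card xs(1,3) by (metis distinct_card)
    ultimately show thesis using that xs by blast
  qed
qed

section \<open>Enumeration of blocks by orderings of the non-root vertices\<close>

definition block_edges :: "'a set \<Rightarrow> 'a set set set" where
  "block_edges V = {E. (V, E) \<in> blocks_in cacti}"

lemma block_edges_cycles:
  assumes "finite S" "x \<notin> S" "2 \<le> card S"
  shows "block_edges (insert x S) = cycle_through x ` permutations_of_set S"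
proof (intro subset_antisym subsetI)
  fix E assume "E \<in> block_edges (insert x S)"
  then have E: "cactus (insert x S) E" "two_connected (insert x S, E) \<or> single_edge (insert x S, E)"
    by (auto simp: block_edges_def blocks_in_def cactus_iff)
  have "\<not> single_edge (insert x S, E)"
  proof
    assume "single_edge (insert x S, E)"
    then obtain u v where "insert x S = {u, v}" "u \<noteq> v" by (auto simp: single_edge_def)
    then have "card (insert x S) = 2" by (metis card_2_iff)
    then show False using assms by simp
  qed
  with E obtain xs where xs: "distinct xs" "set xs = S" "2 \<le> length xs" "E = cycle_through x xs"
    using two_connected_cactus_is_cycle[OF E(1) _ assms(2)] by blast
  then show "E \<in> cycle_through x ` permutations_of_set S" by (auto simp: permutations_of_set_def)
next
  fix E assume "E \<in> cycle_through x ` permutations_of_set S"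
  then obtain xs where xs: "set xs = S" "distinct xs" "E = cycle_through x xs" by (auto simp: permutations_of_set_def)
  then have "2 \<le> length xs" using assms(3) by (metis distinct_card)
  with cycle_through_block[of x xs] xs assms(2) show "E \<in> block_edges (insert x S)"
    by (auto simp: block_edges_def blocks_in_def cactus_iff)
qed

lemma block_edges_pair:
  assumes "a \<noteq> b"
  shows "block_edges {a, b} = {{{a, b}}}"
proof (intro subset_antisym subsetI)
  fix E assume "E \<in> block_edges {a, b}"
  then have "two_connected ({a, b}, E) \<or> single_edge ({a, b}, E)"
    by (auto simp: block_edges_def blocks_in_def)
  moreover have "\<not> two_connected ({a, b}, E)" using assms by (simp add: two_connected_def)
  ultimately show "E \<in> {{{a, b}}}" by (auto simp: single_edge_def)
next
  fix E assume "E \<in> {{{a, b}}}"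
  then show "E \<in> block_edges {a, b}"
    using cactus_edge[OF assms] assms by (auto simp: block_edges_def blocks_in_def cactus_iff single_edge_def)
qed

lemma block_edges_small:
  assumes "card V < 2"
  shows "block_edges V = {}"
  using assms by (fastforce simp: block_edges_def blocks_in_def two_connected_def single_edge_def)

text \<open>A vertex lies on exactly two edges of the cycle, so each entry is determined by the two
  before it. The induction therefore carries consecutive pairs, and equal heads start it.\<close>

lemma cycle_through_nth_determined:
  assumes "distinct (x # xs)" "distinct (x # ys)" "length xs = length ys" "2 \<le> length xs"
    "cycle_through x xs = cycle_through x ys" "hd xs = hd ys"
  shows "xs = ys"
proof -
  define zs ws where "zs = x # xs @ [x]" and "ws = x # ys @ [x]"
  have len: "length zs = length xs + 2" "length ws = length xs + 2" using assms(3) by (simp_all add: zs_def ws_def)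
  have F: "path_edges zs = path_edges ws" using assms(5) by (simp add: zs_def ws_def cycle_through_def)
  have cy: "is_cycle (path_edges zs)" "is_cycle (path_edges ws)"
    unfolding is_cycle_def zs_def ws_def
    using assms(1-4) by (metis)+
  have at: "{e \<in> path_edges us. us ! Suc i \<in> e} = {{us ! i, us ! Suc i}, {us ! Suc i, us ! Suc (Suc i)}}"
      "us ! i \<noteq> us ! Suc (Suc i)"
    if us: "us = x # vs @ [x]" "distinct (x # vs)" "2 \<le> length vs" and i: "i < length vs" for us vs i
  proof -
    have 1: "us ! Suc i = vs ! i" using us i by (simp add: nth_append)
    show neq: "us ! i \<noteq> us ! Suc (Suc i)"
    proof (cases i)
      case 0
      then show ?thesis using us i by (cases vs; cases "tl vs") auto
    next
      case (Suc k)
      then have k: "us ! i = vs ! k" using us i by (simp add: nth_append)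
      show ?thesis
      proof (cases "Suc i < length vs")
        case True
        then have "us ! Suc (Suc i) = vs ! Suc i" using us by (simp add: nth_append)
        then show ?thesis using k Suc True us(2) by (simp add: nth_eq_iff_index_eq)
      next
        case False
        then have "Suc i = length vs" using i by simp
        then have "us ! Suc (Suc i) = x" using us by (simp add: nth_append)
        then show ?thesis using k us(2) Suc i by (metis Suc_lessD distinct.simps(2) nth_mem)
      qed
    qed
    have c: "is_cycle (path_edges us)" unfolding is_cycle_def using us by blast
    have e: "{us ! i, us ! Suc i} \<in> path_edges us" "{us ! Suc i, us ! Suc (Suc i)} \<in> path_edges us"
      unfolding path_edges_nth using us(1) i
      by (intro CollectI exI[of _ i] exI[of _ "Suc i"] conjI refl; simp)+
    then have "us ! Suc i \<in> \<Union>(path_edges us)" by blast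
    then have card: "card {e \<in> path_edges us. us ! Suc i \<in> e} = 2" by (rule is_cycle_degree[OF c])
    have "{us ! i, us ! Suc i} \<noteq> {us ! Suc i, us ! Suc (Suc i)}"
      using neq by (auto simp: doubleton_eq_iff)
    then have "card {{us ! i, us ! Suc i}, {us ! Suc i, us ! Suc (Suc i)}} = 2" by simp
    then have "{{us ! i, us ! Suc i}, {us ! Suc i, us ! Suc (Suc i)}} = {e \<in> path_edges us. us ! Suc i \<in> e}"
      using e card by (intro card_subset_eq) auto
    then show "{e \<in> path_edges us. us ! Suc i \<in> e} = {{us ! i, us ! Suc i}, {us ! Suc i, us ! Suc (Suc i)}}"
      by (rule sym)
  qed
  have "zs ! i = ws ! i \<and> zs ! Suc i = ws ! Suc i" if "i \<le> length xs" for i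
    using that
  proof (induction i)
    case 0
    then show ?case using assms(3,4,6) by (cases xs; cases ys) (auto simp: zs_def ws_def)
  next
    case (Suc i)
    then have IH: "zs ! i = ws ! i" "zs ! Suc i = ws ! Suc i" and i: "i < length xs" by auto
    note Z = at[OF zs_def assms(1,4) i]
    note W = at[OF ws_def assms(2), of i] 
    have W: "{e \<in> path_edges zs. zs ! Suc i \<in> e} = {{zs ! i, zs ! Suc i}, {zs ! Suc i, ws ! Suc (Suc i)}}"
        "zs ! i \<noteq> ws ! Suc (Suc i)"
      using W assms(3,4) i unfolding F IH by auto
    have "{{zs ! i, zs ! Suc i}, {zs ! Suc i, zs ! Suc (Suc i)}} = {{zs ! i, zs ! Suc i}, {zs ! Suc i, ws ! Suc (Suc i)}}"
      using Z(1) W(1) by simp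
    then have "{zs ! Suc i, zs ! Suc (Suc i)} = {zs ! Suc i, ws ! Suc (Suc i)}"
      using Z(2) W(2) by (auto simp: doubleton_eq_iff)
    then show ?case using IH by (auto simp: doubleton_eq_iff)
  qed
  note agree = this
  have "zs ! i = ws ! i" if "i < length zs" for i
  proof (cases "i \<le> length xs")
    case False
    then have "i = Suc (length xs)" using that len by simp
    then show ?thesis using agree[of "length xs"] by simp
  qed (use agree in blast)
  then have "zs = ws" using len by (intro nth_equalityI) auto
  then show ?thesis by (simp add: zs_def ws_def)
qed

text \<open>The two edges at \<open>x\<close> leave two possibilities for the head; reversing
  \<open>xs\<close> reduces the second to the first.\<close>

lemma cycle_through_eq_iff:
  assumes "distinct (x # xs)" "distinct (x # ys)" "length xs = length ys" "2 \<le> length xs"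
  shows "cycle_through x xs = cycle_through x ys \<longleftrightarrow> ys = xs \<or> ys = rev xs"
proof
  assume eq: "cycle_through x xs = cycle_through x ys"
  have at: "{e \<in> cycle_through x xs. x \<in> e} = {{x, hd xs}, {x, last xs}}" "{e \<in> cycle_through x ys. x \<in> e} = {{x, hd ys}, {x, last ys}}"
    using is_cycle_edges_at(1)[OF assms(1,4) cycle_through_def]
      is_cycle_edges_at(1)[OF assms(2) _ cycle_through_def] assms(3,4) by auto
  have "{x, hd ys} \<in> {{x, hd xs}, {x, last xs}}" unfolding at(1)[symmetric] eq at(2) by simp
  then consider "hd ys = hd xs" | "hd ys = last xs" by (auto simp: doubleton_eq_iff)
  then show "ys = xs \<or> ys = rev xs"
  proof cases
    case 1
    then show ?thesis using cycle_through_nth_determined[OF assms eq] by simp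
  next
    case 2
    have "rev xs = ys"
      using cycle_through_nth_determined[of x "rev xs" ys] assms eq 2 by (simp add: cycle_through_rev hd_rev)
    then show ?thesis by simp
  qed
qed (auto simp: cycle_through_rev)

lemma sum_over_cycles:
  fixes f :: "'a set set \<Rightarrow> real"
  assumes "finite S" "x \<notin> S" "2 \<le> card S"
  shows "2 * (\<Sum>E\<in>block_edges (insert x S). f E) = (\<Sum>xs\<in>permutations_of_set S. f (cycle_through x xs))"
proof -
  let ?P = "permutations_of_set S"
  have "(\<Sum>xs\<in>?P. f (cycle_through x xs)) = (\<Sum>E\<in>cycle_through x ` ?P. \<Sum>xs\<in>{xs \<in> ?P. cycle_through x xs = E}. f (cycle_through x xs))"
    by (rule sum.image_gen) simp
  also have "\<dots> = (\<Sum>E\<in>cycle_through x ` ?P. 2 * f E)"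
  proof (rule sum.cong[OF refl])
    fix E assume "E \<in> cycle_through x ` ?P"
    then obtain xs where xs: "set xs = S" "distinct xs" and E: "E = cycle_through x xs" by (auto simp: permutations_of_set_def)
    have len: "length xs = card S" using xs by (metis distinct_card)
    have "{ys \<in> ?P. cycle_through x ys = E} = {xs, rev xs}"
    proof (intro subset_antisym subsetI)
      fix ys assume "ys \<in> {ys \<in> ?P. cycle_through x ys = E}"
      then have ys: "set ys = S" "distinct ys" "cycle_through x xs = cycle_through x ys" by (auto simp: permutations_of_set_def E)
      have "length ys = card S" using ys by (metis distinct_card)
      then show "ys \<in> {xs, rev xs}"
        using cycle_through_eq_iff[of x xs ys] xs ys assms(2,3) len by auto
    qed (use xs in \<open>auto simp: E cycle_through_rev permutations_of_set_def\<close>)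
    moreover have "xs \<noteq> rev xs"
      using hd_neq_last[of xs] xs len assms(3) by (metis hd_rev)
    ultimately show "(\<Sum>xs\<in>{xs \<in> ?P. cycle_through x xs = E}. f (cycle_through x xs)) = 2 * f E"
      by (simp add: E cycle_through_rev)
  qed
  finally show ?thesis using block_edges_cycles[OF assms] by (simp add: sum_distrib_left)
qed

lemma card_block_edges:
  assumes "finite V" "3 \<le> card V"
  shows "2 * real (card (block_edges V)) = fact (card V - 1)"
proof -
  obtain x where "x \<in> V" using assms by fastforce
  define S where "S = V - {x}"
  have V: "V = insert x S" "x \<notin> S" "finite S" "card S = card V - 1"
    using \<open>x \<in> V\<close> assms(1) by (auto simp: S_def)
  show ?thesis
    using sum_over_cycles[OF V(3,2), of "\<lambda>_. 1"] assms(2) V(4) V(3)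
    unfolding V(1)[symmetric] by simp
qed

text \<open>A potential argument: a walk of length \<open>j\<close> from \<open>u\<close> raises
  \<open>h\<close> by at most \<open>j\<close>, which bounds the distance from below.\<close>

lemma graph_dist_eqI:
  assumes "(u, v) \<in> adj G ^^ k" "\<And>y z. {y, z} \<in> edges G \<Longrightarrow> h z \<le> h y + (1::nat)" "h u = 0" "h v = k"
  shows "graph_dist G u v = k"
  unfolding graph_dist_def
proof (rule Least_equality)
  show "(u, v) \<in> adj G ^^ k" by (rule assms(1))
next
  fix j assume "(u, v) \<in> adj G ^^ j"
  then have "h v \<le> h u + j"
  proof (induction j arbitrary: v)
    case (Suc j)
    then obtain w where "(u, w) \<in> adj G ^^ j" "(w, v) \<in> adj G" by auto
    with Suc.IH[of w] assms(2)[of w v] show ?case by (simp add: adj_def)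
  qed simp
  with assms(3,4) show "k \<le> j" by simp
qed

lemma cycle_through_walk:
  assumes "i < length xs" "cycle_through x xs \<subseteq> edges G"
  shows "(x, xs ! i) \<in> adj G ^^ Suc i"
  using assms(1)
proof (induction i)
  case 0
  have "{x, xs ! 0} \<in> cycle_through x xs" using 0 by (cases xs) (auto simp: cycle_through_def)
  with assms(2) show ?case by (auto simp: adj_def)
next
  case (Suc i)
  have "{xs ! i, xs ! Suc i} \<in> cycle_through x xs"
    unfolding cycle_through_def path_edges_nth using Suc(2)
    by (intro CollectI exI[of _ "Suc i"]) (auto simp: nth_append)
  then have "(xs ! i, xs ! Suc i) \<in> adj G" using assms(2) by (auto simp: adj_def)
  with Suc show ?case by (metis Suc_lessD relpow_Suc_I)
qed

text \<open>The entry \<open>xs ! i\<close> has position \<open>Suc i\<close> among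
  \<open>Suc (length xs)\<close> vertices; the two numbers are the lengths of the two ways
  around.\<close>

lemma graph_dist_cycle:
  assumes "distinct (x # xs)" "i < length xs"
  shows "graph_dist (V, cycle_through x xs) x (xs ! i) = min (Suc i) (length xs - i)"
proof -
  let ?n = "length xs"
  let ?zs = "x # xs"
  define pos where "pos = inv_into {..?n} ((!) ?zs)"
  have inj: "inj_on ((!) ?zs) {..?n}"
    by (rule inj_on_nth[OF assms(1)]) auto
  have pos: "pos (?zs ! j) = j" if "j \<le> ?n" for j
    unfolding pos_def using inv_into_f_f[OF inj, of j] that by simp
  \<comment> \<open>The cyclic distance of the position of \<open>u\<close> from position 0 serves
    as the potential.\<close>
  define h where "h u = min (pos u) (Suc ?n - pos u)" for u
  have hz: "h (?zs ! j) = min j (Suc ?n - j)" if "j \<le> ?n" for j using pos[OF that] by (simp add: h_def)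
  have hx: "h x = 0" using hz[of 0] by simp
  have hi: "h (xs ! i) = min (Suc i) (length xs - i)" using hz[of "Suc i"] assms(2) by simp
  have walk: "(x, xs ! i) \<in> adj (V, cycle_through x xs) ^^ min (Suc i) (length xs - i)"
  proof (cases "Suc i \<le> length xs - i")
    case True
    then show ?thesis using cycle_through_walk[OF assms(2), of x "(V, cycle_through x xs)"] by (simp add: min_def)
  next
    case False
    \<comment> \<open>The other way around is the same walk along the reversed list.\<close>
    have "(x, rev xs ! (?n - Suc i)) \<in> adj (V, cycle_through x xs) ^^ Suc (?n - Suc i)"
      by (rule cycle_through_walk) (use assms(2) in \<open>auto simp: cycle_through_rev\<close>)
    moreover have "rev xs ! (?n - Suc i) = xs ! i" "Suc (?n - Suc i) = ?n - i"
      using assms(2) by (auto simp: rev_nth)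
    ultimately show ?thesis using False by (simp add: min_def)
  qed
  have lip: "h z \<le> h y + 1" if "{y, z} \<in> edges (V, cycle_through x xs)" for y z
  proof -
    from that obtain j where j: "Suc j < length (?zs @ [x])" "{y, z} = {(?zs @ [x]) ! j, (?zs @ [x]) ! Suc j}"
      unfolding snd_conv cycle_through_def path_edges_nth by auto
    \<comment> \<open>Index \<open>Suc ?n\<close> is the repeated \<open>x\<close>, where the
      formula gives 0 again; so the closing edge is covered too.\<close>
    have "h ((?zs @ [x]) ! k) = min k (Suc ?n - k)" if "k \<le> Suc ?n" for k
      using that hz[of k] hx nth_append[of ?zs "[x]" k] by (cases "k = Suc ?n") auto
    from this[of j] this[of "Suc j"] j(1)
    have "h ((?zs @ [x]) ! j) \<le> h ((?zs @ [x]) ! Suc j) + 1" "h ((?zs @ [x]) ! Suc j) \<le> h ((?zs @ [x]) ! j) + 1"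
      by auto
    with j(2) show ?thesis by (auto simp: doubleton_eq_iff simp del: append_Cons nth_Cons_Suc)
  qed
  show ?thesis by (rule graph_dist_eqI[where h = h, OF walk lip hx hi])
qed

definition dist_sum :: "nat \<Rightarrow> nat" where
  "dist_sum m = (\<Sum>i<m. min (Suc i) (m - i))"

lemma sum_graph_dist_cycle:
  assumes "distinct (x # xs)"
  shows "(\<Sum>r\<in>set xs. graph_dist (V, cycle_through x xs) x r) = dist_sum (length xs)"
proof -
  have "(\<Sum>r\<in>set xs. graph_dist (V, cycle_through x xs) x r) = (\<Sum>i<length xs. graph_dist (V, cycle_through x xs) x (xs ! i))"
    using assms by (intro sum.reindex_bij_betw[symmetric] bij_betw_nth) auto
  then show ?thesis using graph_dist_cycle[OF assms] by (simp add: dist_sum_def)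
qed

text \<open>The first and the last minimum equal 1, and the \<open>m\<close> between them exceed
  those for \<open>m\<close> by one each.\<close>

lemma dist_sum_rec: "dist_sum (Suc (Suc m)) = dist_sum m + m + 2"
proof -
  have "dist_sum (Suc (Suc m)) = Suc (\<Sum>i<Suc m. min (Suc (Suc i)) (Suc m - i))"
    unfolding dist_sum_def by (subst sum.lessThan_Suc_shift) simp
  also have "(\<Sum>i<Suc m. min (Suc (Suc i)) (Suc m - i)) = Suc (\<Sum>i<m. Suc (min (Suc i) (m - i)))"
    by (simp add: Suc_diff_le)
  finally show ?thesis by (simp only: sum_Suc dist_sum_def card_lessThan)
qed

section \<open>The Boltzmann distribution\<close>

lemma card_blocks_eq: "card {G \<in> blocks_in cacti. verts G = V} = card (block_edges V)"
proof -
  have "{G \<in> blocks_in cacti. verts G = V} = Pair V ` block_edges V"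
    by (auto simp: block_edges_def)
  then show ?thesis by (simp add: card_image inj_on_def)
qed

text \<open>The coefficients of \<open>B'\<close>: nothing for the root alone, one edge, and from
  then on half of the \<open>m!\<close> orderings.\<close>

definition block_coeff :: "nat \<Rightarrow> real" where
  "block_coeff m = (if m = 0 then 0 else if m = 1 then 1 else 1 / 2)"

lemma card_block_edges_coeff:
  assumes "finite V" "card V = Suc m"
  shows "real (card (block_edges V)) = fact m * block_coeff m"
proof -
  consider "m = 0" | "m = 1" | "2 \<le> m" by linarith
  then show ?thesis
  proof cases
    case 1
    then show ?thesis using assms block_edges_small[of V] by (simp add: block_coeff_def)
  next
    case 2
    then have "card V = 2" using assms by simp
    then obtain a b where "V = {a, b}" "a \<noteq> b" by (auto simp: card_2_iff)
    then show ?thesis using 2 block_edges_pair[of a b] by (simp add: block_coeff_def)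
  next
    case 3
    then show ?thesis using card_block_edges[OF assms(1)] assms(2) by (simp add: block_coeff_def)
  qed
qed

lemma deriv_B_egf_nth: "fps_nth (fps_deriv B_egf) n = block_coeff n"
proof -
  have "fps_nth B_egf (Suc n) = fact n * block_coeff n / fact (Suc n)"
    unfolding B_egf_def egf_def fps_nth_Abs_fps card_blocks_eq by (subst card_block_edges_coeff) auto
  then show ?thesis by (simp del: of_nat_Suc)
qed

lemma deriv_B_egf_sums:
  fixes z :: real
  assumes "\<bar>z\<bar> < 1"
  shows "(\<lambda>n. fps_nth (fps_deriv B_egf) n * z ^ n) sums B1 z"
proof -
  \<comment> \<open>Half the geometric series, corrected at the indices 0 and 1, where the
    coefficients are 0 and 1 instead of \<open>1 / 2\<close>.\<close>
  have "(\<lambda>n. z ^ n / 2 + (if n = 0 then - 1 / 2 else 0) + (if n = 1 then z / 2 else 0)) sums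
      (1 / (1 - z) / 2 + - 1 / 2 + z / 2)"
    using geometric_sums[of z] assms by (intro sums_add sums_divide sums_single) auto
  moreover have "1 / (1 - z) / 2 + - 1 / 2 + z / 2 = B1 z"
    using assms by (simp add: B1_def field_simps power2_eq_square)
  moreover have "z ^ n / 2 + (if n = 0 then - 1 / 2 else 0) + (if n = 1 then z / 2 else 0) =
      fps_nth (fps_deriv B_egf) n * z ^ n" for n
    unfolding deriv_B_egf_nth block_coeff_def by simp
  ultimately show ?thesis by simp
qed

text \<open>The coefficients of \<open>B\<close> are bounded by 1, while those of \<open>B'\<close>
  tend to \<open>1 / 2\<close>, so the series of \<open>B'\<close> cannot converge at 1.\<close>

lemma B_radius: "fps_conv_radius B_egf = 1"
proof (rule antisym)
  show "fps_conv_radius B_egf \<ge> 1"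
    unfolding fps_conv_radius_def
  proof (rule conv_radius_geI_ex')
    fix r :: real assume r: "0 < r" "ereal r < 1"
    have le: "norm (fps_nth B_egf n) \<le> 1" for n
    proof (cases n)
      case 0
      have "block_edges {1..0::nat} = {}" by (rule block_edges_small) simp
      then show ?thesis using 0 by (simp add: B_egf_def egf_def card_blocks_eq)
    next
      case (Suc m)
      have "real (Suc m) * fps_nth B_egf (Suc m) = block_coeff m" using deriv_B_egf_nth[of m] by simp
      then have "fps_nth B_egf (Suc m) = block_coeff m / real (Suc m)" by (simp add: field_simps)
      then show ?thesis using Suc by (simp add: block_coeff_def)
    qed
    show "summable (\<lambda>n. fps_nth B_egf n * of_real r ^ n)"
    proof (rule summable_comparison_test')
      show "summable (\<lambda>n. r ^ n)" using r by (intro summable_geometric) auto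
      show "norm (fps_nth B_egf n * of_real r ^ n) \<le> r ^ n" for n
        using mult_right_mono[OF le[of n], of "r ^ n"] r by (simp add: abs_mult power_abs)
    qed
  qed
  show "fps_conv_radius B_egf \<le> 1"
  proof (rule ccontr)
    assume "\<not> fps_conv_radius B_egf \<le> 1"
    then have "ereal (norm (1::real)) < fps_conv_radius (fps_deriv B_egf)"
      using fps_conv_radius_deriv[of B_egf] by (simp add: one_ereal_def not_le)
    then have "summable (\<lambda>n. fps_nth (fps_deriv B_egf) n * 1 ^ n)" by (rule summable_fps)
    then have "summable block_coeff" by (simp only: deriv_B_egf_nth power_one mult_1_right)
    then have "block_coeff \<longlonglongrightarrow> 0" by (rule summable_LIMSEQ_zero)
    moreover have "block_coeff \<longlonglongrightarrow> 1 / 2"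
      by (rule tendsto_eventually, rule eventually_sequentiallyI[of 2]) (simp add: block_coeff_def)
    ultimately show False using LIMSEQ_unique by fastforce
  qed
qed

section \<open>Closed forms for the derivatives of \<open>B\<close>\<close>

lemma radius_derivs:
  fixes z :: real
  assumes "\<bar>z\<bar> < 1"
  shows "ereal (norm z) < fps_conv_radius B_egf" "ereal (norm z) < fps_conv_radius (fps_deriv B_egf)"
    "ereal (norm z) < fps_conv_radius (fps_deriv (fps_deriv B_egf))"
    "ereal (norm z) < fps_conv_radius (fps_deriv (fps_deriv (fps_deriv B_egf)))"
proof -
  show 1: "ereal (norm z) < fps_conv_radius B_egf" using assms by (simp add: B_radius one_ereal_def)
  then show 2: "ereal (norm z) < fps_conv_radius (fps_deriv B_egf)"
    using fps_conv_radius_deriv by (rule less_le_trans)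
  then show 3: "ereal (norm z) < fps_conv_radius (fps_deriv (fps_deriv B_egf))"
    using fps_conv_radius_deriv by (rule less_le_trans)
  then show "ereal (norm z) < fps_conv_radius (fps_deriv (fps_deriv (fps_deriv B_egf)))"
    using fps_conv_radius_deriv by (rule less_le_trans)
qed

lemma B1_deriv:
  assumes "z \<noteq> 1"
  shows "(B1 has_field_derivative (1 + 1 / (1 - z) ^ 2) / 2) (at z)"
proof -
  have "(B1 has_field_derivative 1 + (2 * z * (2 * (1 - z)) + z ^ 2 * 2) / (2 * (1 - z)) ^ 2) (at z)"
    unfolding B1_def using assms
    by (auto intro!: derivative_eq_intros simp: power2_eq_square)
  also have "1 + (2 * z * (2 * (1 - z)) + z ^ 2 * 2) / (2 * (1 - z)) ^ 2 = (1 + 1 / (1 - z) ^ 2) / 2"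
    using assms by (simp add: divide_simps) (simp add: power2_eq_square algebra_simps)
  finally show ?thesis .
qed

text \<open>Transfers a closed form on the unit interval to the differentiated series, without
  another computation of coefficients.\<close>

lemma eval_deriv_unique:
  fixes z :: real
  assumes "\<bar>z\<bar> < 1" "ereal (norm z) < fps_conv_radius F"
    "\<And>x. \<bar>x\<bar> < 1 \<Longrightarrow> eval_fps F x = f x" "(f has_field_derivative D) (at z)"
  shows "eval_fps (fps_deriv F) z = D"
proof (rule DERIV_unique)
  have "(eval_fps F has_field_derivative eval_fps (fps_deriv F) z) (at z)"
    by (rule has_field_derivative_eval_fps[OF assms(2)])
  then show "(f has_field_derivative eval_fps (fps_deriv F) z) (at z)"
    by (rule has_field_derivative_transform_within_open[of _ _ _ "{-1<..<1}"]) (use assms in auto)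
qed (rule assms(4))

lemma eval_B2:
  fixes z :: real
  assumes "\<bar>z\<bar> < 1"
  shows "eval_fps (fps_deriv (fps_deriv B_egf)) z = (1 + 1 / (1 - z) ^ 2) / 2"
proof (rule eval_deriv_unique[OF assms radius_derivs(2)[OF assms]])
  show "eval_fps (fps_deriv B_egf) x = B1 x" if "\<bar>x\<bar> < 1" for x
    using sums_unique[OF deriv_B_egf_sums[OF that]] by (simp add: eval_fps_def)
qed (use B1_deriv assms in auto)

lemma eval_B3:
  fixes z :: real
  assumes "\<bar>z\<bar> < 1"
  shows "eval_fps (fps_deriv (fps_deriv (fps_deriv B_egf))) z = 1 / (1 - z) ^ 3"
proof (rule eval_deriv_unique[OF assms radius_derivs(3)[OF assms] eval_B2])
  show "((\<lambda>z. (1 + 1 / (1 - z) ^ 2) / 2) has_field_derivative 1 / (1 - z) ^ 3) (at z)"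
  proof -
    have cancel: "2 * u / (u ^ 2) ^ 2 / 2 = 1 / u ^ 3" if "u \<noteq> 0" for u :: real
      using that by (simp add: power2_eq_square power3_eq_cube)
    have n: "1 - z \<noteq> 0" using assms by simp
    have "((\<lambda>z. (1 + 1 / (1 - z) ^ 2) / 2) has_field_derivative (2 * (1 - z)) / ((1 - z) ^ 2) ^ 2 / 2) (at z)"
      using n by (auto intro!: derivative_eq_intros simp: power2_eq_square) (simp add: divide_simps algebra_simps)
    also have "(2 * (1 - z)) / ((1 - z) ^ 2) ^ 2 / 2 = 1 / (1 - z) ^ 3"
      using cancel[OF n] .
    finally show ?thesis .
  qed
qed

lemma slope_eq_1_iff:
  fixes z :: real
  assumes "z \<noteq> 1"
  shows "z * ((1 + 1 / (1 - z) ^ 2) / 2) = 1 \<longleftrightarrow> z = tau"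
proof -
  have "z * ((1 + 1 / (1 - z) ^ 2) / 2) = 1 \<longleftrightarrow> z ^ 3 - 4 * z ^ 2 + 6 * z - 2 = 0"
    using slope_eq_cubic[OF assms] assms by (auto simp: divide_eq_0_iff)
  then show ?thesis using tau_iff by simp
qed

text \<open>Two readings of the equation, by the series and by its closed form. The second also
  admits \<open>z > 1\<close>, where nothing is added because the cubic has a single real
  root.\<close>

lemma characteristic_solutions:
  "{z::real. 0 < z \<and> ereal z < fps_conv_radius B_egf \<and>
      z * eval_fps (fps_deriv (fps_deriv B_egf)) z = 1} = {tau}"
  "{z::real. 0 < z \<and> z \<noteq> 1 \<and> z * deriv B1 z = 1} = {tau}"
proof -
  have "0 < z \<and> ereal z < fps_conv_radius B_egf \<and>
      z * eval_fps (fps_deriv (fps_deriv B_egf)) z = 1 \<longleftrightarrow> z = tau" for z :: real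
  proof (cases "0 < z \<and> z < 1")
    case True
    then have "z * eval_fps (fps_deriv (fps_deriv B_egf)) z = 1 \<longleftrightarrow> z = tau"
      by (subst eval_B2) (auto intro!: slope_eq_1_iff simp del: times_divide_eq_right)
    then show ?thesis using True by (simp add: B_radius one_ereal_def)
  next
    case False
    then show ?thesis using tau_01 by (auto simp: B_radius one_ereal_def)
  qed
  then show "{z::real. 0 < z \<and> ereal z < fps_conv_radius B_egf \<and>
      z * eval_fps (fps_deriv (fps_deriv B_egf)) z = 1} = {tau}" by auto
  have "z * deriv B1 z = 1 \<longleftrightarrow> z = tau" if "z \<noteq> 1" for z :: real
    unfolding DERIV_imp_deriv[OF B1_deriv[OF that]] by (rule slope_eq_1_iff[OF that])
  then have "0 < z \<and> z \<noteq> 1 \<and> z * deriv B1 z = 1 \<longleftrightarrow> z = tau" for z :: real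
    using tau_01 by (cases "z = 1") auto
  then show "{z::real. 0 < z \<and> z \<noteq> 1 \<and> z * deriv B1 z = 1} = {tau}" by auto
qed

text \<open>At \<open>tau\<close> the characteristic equation says precisely that the normalising
  constant of the Boltzmann distribution is 1.\<close>

lemma eval_B_derived_pointed: "eval_fps B_derived_pointed tau = 1"
proof -
  have t: "\<bar>tau\<bar> < 1" using tau_01 by simp
  have "eval_fps B_derived_pointed tau = tau * eval_fps (fps_deriv (fps_deriv B_egf)) tau"
    unfolding B_derived_pointed_def using radius_derivs(3)[OF t] by (simp add: eval_fps_mult)
  also have "\<dots> = 1" unfolding eval_B2[OF t] using slope_eq_1_iff[of tau] tau_01 by simp
  finally show ?thesis .
qed

section \<open>Total mass and expectations as power series at \<open>tau\<close>\<close>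

definition objects :: "nat \<Rightarrow> pointed_graph set" where
  "objects m = derived_pointed (blocks_in cacti) {1..m}"

lemma objects_eq:
  "objects m = (\<lambda>(E, r). ((insert 0 {1..m}, E), r)) ` (block_edges (insert 0 {1..m}) \<times> {1..m})"
  by (force simp: objects_def derived_pointed_def block_edges_def)

lemma finite_block_edges [simp]: "finite V \<Longrightarrow> finite (block_edges V)"
proof (rule finite_subset)
  show "block_edges V \<subseteq> cactus_edges V"
    by (auto simp: block_edges_def blocks_in_def cactus_iff cactus_edges_def)
qed simp

lemma sum_objects:
  "sum g (objects m) = (\<Sum>E\<in>block_edges (insert 0 {1..m}). \<Sum>r\<in>{1..m}. g ((insert 0 {1..m}, E), r))"
proof -
  have "inj_on (\<lambda>(E, r). ((insert 0 {1..m}, E), r)) (block_edges (insert 0 {1..m}) \<times> {1..m})"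
    by (auto simp: inj_on_def)
  then have "sum g (objects m) = sum (g \<circ> (\<lambda>(E, r). ((insert 0 {1..m}, E), r))) (block_edges (insert 0 {1..m}) \<times> {1..m})"
    unfolding objects_eq by (rule sum.reindex)
  also have "\<dots> = (\<Sum>E\<in>block_edges (insert 0 {1..m}). \<Sum>r\<in>{1..m}. g ((insert 0 {1..m}, E), r))"
    unfolding sum.cartesian_product by (intro sum.cong) auto
  finally show ?thesis .
qed

lemma finite_objects: "finite (objects m)"
  unfolding objects_eq by (intro finite_imageI finite_cartesian_product finite_block_edges) auto

lemma obj_size_objects: "b \<in> objects m \<Longrightarrow> obj_size b = m"
  by (auto simp: objects_eq obj_size_def)

definition weight :: "pointed_graph \<Rightarrow> real" where
  "weight b = (if b \<in> (\<Union>m. objects m) then tau ^ obj_size b / fact (obj_size b) else 0)"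

lemma weight_nonneg: "0 \<le> weight b"
  using tau_01 by (simp add: weight_def)

lemma boltzmann_tau: "boltzmann tau = embed_pmf weight"
  unfolding boltzmann_def weight_def objects_def eval_B_derived_pointed mult_1_right by (rule refl)

text \<open>Grouping by size is free of convergence questions for nonnegative integrals. The case
  \<open>g = 1\<close> gives the total mass, other choices the expectations, whose finiteness comes
  from the sum \<open>L\<close>.\<close>

lemma nn_integral_weight:
  assumes "\<And>b. 0 \<le> g b" "(\<lambda>m. sum g (objects m) / fact m * tau ^ m) sums L"
  shows "(\<integral>\<^sup>+ b. ennreal (weight b * g b) \<partial>count_space UNIV) = ennreal L"
proof -
  let ?h = "\<lambda>b. ennreal (weight b * g b)"
  have nonneg: "0 \<le> sum g (objects m) / fact m * tau ^ m" for m
    using assms(1) tau_01 by (intro mult_nonneg_nonneg divide_nonneg_nonneg sum_nonneg) auto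
  have disj: "disjoint_family objects"
    unfolding disjoint_family_on_def using obj_size_objects by blast
  have "(\<integral>\<^sup>+ b. ?h b \<partial>count_space UNIV) =
      (\<integral>\<^sup>+ b. ?h b * indicator (\<Union>m. objects m) b \<partial>count_space UNIV)"
    by (intro nn_integral_cong) (auto simp: indicator_def weight_def)
  also have "\<dots> = (\<Sum>m. \<integral>\<^sup>+ b. ?h b * indicator (objects m) b \<partial>count_space UNIV)"
    by (rule nn_integral_disjoint_family) (use disj in auto)
  also have "(\<lambda>m. \<integral>\<^sup>+ b. ?h b * indicator (objects m) b \<partial>count_space UNIV) =
      (\<lambda>m. ennreal (sum g (objects m) / fact m * tau ^ m))"
  proof
    fix m
    have "(\<integral>\<^sup>+ b. ?h b * indicator (objects m) b \<partial>count_space UNIV) = (\<Sum>b\<in>objects m. ?h b * indicator (objects m) b)"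
      by (rule nn_integral_count_space') (use finite_objects in auto)
    also have "\<dots> = (\<Sum>b\<in>objects m. ennreal (tau ^ m / fact m * g b))"
    proof (rule sum.cong[OF refl])
      fix b assume b: "b \<in> objects m"
      then have "weight b = tau ^ m / fact m" using obj_size_objects[OF b] by (auto simp: weight_def)
      with b show "?h b * indicator (objects m) b = ennreal (tau ^ m / fact m * g b)" by simp
    qed
    also have "\<dots> = ennreal (\<Sum>b\<in>objects m. tau ^ m / fact m * g b)"
      using assms(1) tau_01 by (intro sum_ennreal) auto
    also have "(\<Sum>b\<in>objects m. tau ^ m / fact m * g b) = sum g (objects m) / fact m * tau ^ m"
      by (subst sum_distrib_left[symmetric]) simp
    finally show "(\<integral>\<^sup>+ b. ?h b * indicator (objects m) b \<partial>count_space UNIV) =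
        ennreal (sum g (objects m) / fact m * tau ^ m)" .
  qed
  also have "(\<Sum>m. ennreal (sum g (objects m) / fact m * tau ^ m)) = ennreal L"
    using suminf_ennreal_eq[OF nonneg assms(2)] by simp
  finally show ?thesis .
qed

lemma sum_const_objects: "(\<Sum>b\<in>objects m. c) / fact m = c * real m * block_coeff m" for c :: real
  unfolding sum_objects using card_block_edges_coeff[of "insert 0 {1..m}" m] by simp

lemma B_derived_pointed_nth: "fps_nth B_derived_pointed m = real m * block_coeff m"
  by (cases m) (simp_all add: B_derived_pointed_def deriv_B_egf_nth del: fps_deriv_nth
      add: fps_deriv_nth[of "fps_deriv B_egf"])

lemma B_derived_pointed_sums:
  "(\<lambda>m. real m * block_coeff m * tau ^ m) sums 1"
proof -
  have t: "\<bar>tau\<bar> < 1" using tau_01 by simp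
  have "ereal (norm tau) < min (fps_conv_radius fps_X) (fps_conv_radius (fps_deriv (fps_deriv B_egf)))"
    using radius_derivs(3)[OF t] by simp
  then have "ereal (norm tau) < fps_conv_radius B_derived_pointed"
    unfolding B_derived_pointed_def using fps_conv_radius_mult by (rule less_le_trans)
  from sums_eval_fps[OF this] show ?thesis by (simp add: B_derived_pointed_nth eval_B_derived_pointed)
qed

lemma pmf_boltzmann: "pmf (boltzmann tau) b = weight b"
  unfolding boltzmann_tau
proof (rule pmf_embed_pmf)
  have "(\<lambda>m. sum (\<lambda>_. 1) (objects m) / fact m * tau ^ m) sums 1"
    using B_derived_pointed_sums unfolding sum_const_objects by simp
  from nn_integral_weight[OF _ this]
  show "(\<integral>\<^sup>+ b. ennreal (weight b) \<partial>count_space UNIV) = 1" by simp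
qed (rule weight_nonneg)

lemma expectation_boltzmann:
  assumes "\<And>b. 0 \<le> g b" "(\<lambda>m. sum g (objects m) / fact m * tau ^ m) sums L"
  shows "measure_pmf.expectation (boltzmann tau) g = L"
proof -
  have "0 \<le> L"
    by (rule sums_le[OF _ sums_zero assms(2)])
      (intro mult_nonneg_nonneg divide_nonneg_nonneg sum_nonneg, use assms(1) tau_01 in auto)
  have "measure_pmf.expectation (boltzmann tau) g = enn2real (\<integral>\<^sup>+ b. ennreal (g b) \<partial>measure_pmf (boltzmann tau))"
    using assms(1) by (intro integral_eq_nn_integral) auto
  also have "(\<integral>\<^sup>+ b. ennreal (g b) \<partial>measure_pmf (boltzmann tau)) = (\<integral>\<^sup>+ b. ennreal (weight b * g b) \<partial>count_space UNIV)"
    unfolding nn_integral_measure_pmf pmf_boltzmann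
    using weight_nonneg assms(1) by (simp add: ennreal_mult)
  also have "\<dots> = ennreal L" by (rule nn_integral_weight[OF assms])
  finally show ?thesis using \<open>0 \<le> L\<close> by simp
qed

text \<open>Weighting by size is the operator \<open>z d/dz\<close>. It turns \<open>z B''\<close>
  into \<open>z B'' + z^2 B'''\<close>, and the first summand is 1 at \<open>tau\<close>.\<close>

lemma sigma_sq_eq:
  "sigma_sq tau = 1 + eval_fps (fps_deriv (fps_deriv (fps_deriv B_egf))) tau * tau\<^sup>2"
  unfolding sigma_sq_def
proof (rule expectation_boltzmann)
  have t: "\<bar>tau\<bar> < 1" using tau_01 by simp
  let ?F = "fps_X * fps_deriv B_derived_pointed"
  let ?B2 = "fps_deriv (fps_deriv B_egf)"
  note rad = radius_derivs(3,4)[OF t]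
  have F: "?F = fps_X * (?B2 + fps_X * fps_deriv ?B2)"
    unfolding B_derived_pointed_def by (simp add: algebra_simps)
  have r1: "ereal (norm tau) < fps_conv_radius (fps_X * fps_deriv ?B2)"
    by (rule less_le_trans[OF _ fps_conv_radius_mult]) (use rad in simp)
  have r2: "ereal (norm tau) < fps_conv_radius (?B2 + fps_X * fps_deriv ?B2)"
    by (rule less_le_trans[OF _ fps_conv_radius_add]) (use rad r1 in simp)
  have r3: "ereal (norm tau) < fps_conv_radius ?F"
    unfolding F by (rule less_le_trans[OF _ fps_conv_radius_mult]) (use r2 in simp)
  have "eval_fps ?F tau = tau * (eval_fps ?B2 tau + tau * eval_fps (fps_deriv ?B2) tau)"
    unfolding F using rad r1 r2 by (simp add: eval_fps_mult eval_fps_add)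
  also have "tau * eval_fps ?B2 tau = 1" unfolding eval_B2[OF t] using slope_eq_1_iff[of tau] tau_01 by simp
  then have "tau * (eval_fps ?B2 tau + tau * eval_fps (fps_deriv ?B2) tau) = 1 + eval_fps (fps_deriv ?B2) tau * tau\<^sup>2"
    by (simp add: distrib_left power2_eq_square)
  finally have "(\<lambda>m. fps_nth ?F m * tau ^ m) sums (1 + eval_fps (fps_deriv ?B2) tau * tau\<^sup>2)"
    using sums_eval_fps[OF r3] by simp
  moreover have "fps_nth ?F m * tau ^ m = (\<Sum>b\<in>objects m. real (obj_size b)) / fact m * tau ^ m" for m
  proof -
    have "fps_nth ?F m = real m * (real m * block_coeff m)"
      using B_derived_pointed_nth by (cases m) simp_all
    moreover have "(\<Sum>b\<in>objects m. real (obj_size b)) = (\<Sum>b\<in>objects m. real m)"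
      by (rule sum.cong) (use obj_size_objects in auto)
    ultimately show ?thesis using sum_const_objects[where c = "real m" and m = m] by simp
  qed
  ultimately show "(\<lambda>m. (\<Sum>b\<in>objects m. real (obj_size b)) / fact m * tau ^ m) sums
      (1 + eval_fps (fps_deriv ?B2) tau * tau\<^sup>2)" by simp
qed simp

section \<open>Distances from the root in blocks\<close>

lemma dist_sum_0 [simp]: "dist_sum 0 = 0" and dist_sum_1 [simp]: "dist_sum (Suc 0) = 1"
  by (simp_all add: dist_sum_def)

text \<open>The recurrence becomes a linear equation for the sum \<open>A\<close>. Convergence has
  to come first; it follows by comparison with \<open>B'''\<close>, whose coefficients grow
  quadratically as well.\<close>

lemma dist_sum_sums:
  fixes y :: real
  assumes "0 < y" "y < 1"
  shows "(\<lambda>m. real (dist_sum m) * y ^ m) sums (y / ((1 - y) ^ 3 * (1 + y)))"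
proof -
  let ?B3 = "fps_deriv (fps_deriv (fps_deriv B_egf))"
  have y: "\<bar>y\<bar> < 1" using assms by simp
  have coeff: "fps_nth ?B3 m = real (Suc m) * real (Suc (Suc m)) / 2" for m
    by (simp add: fps_deriv_nth[of "fps_deriv (fps_deriv B_egf)"] fps_deriv_nth[of "fps_deriv B_egf"]
        deriv_B_egf_nth block_coeff_def del: fps_deriv_nth of_nat_Suc)
  have sm: "summable (\<lambda>m. real (dist_sum m) * y ^ m)"
  proof (rule summable_comparison_test')
    show "summable (\<lambda>m. 2 * (fps_nth ?B3 m * y ^ m))"
      by (rule summable_mult[OF summable_fps]) (rule radius_derivs(4)[OF y])
    fix m
    have "dist_sum m \<le> (\<Sum>i<m. m)" unfolding dist_sum_def by (rule sum_mono) auto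
    then have "dist_sum m \<le> Suc m * Suc (Suc m)" by simp
    then have "real (dist_sum m) \<le> real (Suc m * Suc (Suc m))" by (rule of_nat_mono)
    also have "real (Suc m * Suc (Suc m)) = 2 * fps_nth ?B3 m"
      by (simp add: coeff del: of_nat_Suc mult_Suc mult_Suc_right fps_deriv_nth)
    finally have "real (dist_sum m) \<le> 2 * fps_nth ?B3 m" .
    from mult_right_mono[OF this, of "y ^ m"]
    show "norm (real (dist_sum m) * y ^ m) \<le> 2 * (fps_nth ?B3 m * y ^ m)"
      using assms by (simp del: fps_deriv_nth)
  qed
  define A where "A = (\<Sum>m. real (dist_sum m) * y ^ m)"
  have A: "(\<lambda>m. real (dist_sum m) * y ^ m) sums A" unfolding A_def using sm by (rule summable_sums)
  \<comment> \<open>The increment \<open>m + 2\<close> is split into \<open>Suc m\<close>, for the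
    differentiated geometric series, and 1.\<close>
  have "(\<lambda>m. real (dist_sum m) * y ^ m + real (Suc m) * y ^ m + y ^ m) sums (A + 1 / (1 - y) ^ 2 + 1 / (1 - y))"
    using geometric_deriv_sums[of y] geometric_sums[of y] y by (intro sums_add A) auto
  from sums_mult[OF this, of "y ^ 2"]
  have "(\<lambda>m. real (dist_sum (Suc (Suc m))) * y ^ Suc (Suc m)) sums (y ^ 2 * (A + 1 / (1 - y) ^ 2 + 1 / (1 - y)))"
    by (simp add: dist_sum_rec power2_eq_square algebra_simps)
  from sums_Suc[OF this]
  have "(\<lambda>m. real (dist_sum (Suc m)) * y ^ Suc m) sums (y ^ 2 * (A + 1 / (1 - y) ^ 2 + 1 / (1 - y)) + y)"
    by simp
  from sums_Suc[OF this]
  have "(\<lambda>m. real (dist_sum m) * y ^ m) sums (y ^ 2 * (A + 1 / (1 - y) ^ 2 + 1 / (1 - y)) + y)"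
    by simp
  with A have eq: "A = y ^ 2 * (A + 1 / (1 - y) ^ 2 + 1 / (1 - y)) + y" by (rule sums_unique2)
  have "A * ((1 - y) ^ 3 * (1 + y)) = y"
  proof -
    have cancel: "(a * (1 / u ^ 2 + 1 / u) + y) * u ^ 2 = a * (1 + u) + y * u ^ 2" if "u \<noteq> 0" for a u :: real
      using that by (simp add: field_simps power2_eq_square)
    have n: "1 - y \<noteq> 0" using assms by simp
    have "A * (1 - y ^ 2) = y ^ 2 * (1 / (1 - y) ^ 2 + 1 / (1 - y)) + y" using eq by (simp add: algebra_simps)
    then have "A * (1 - y ^ 2) * (1 - y) ^ 2 = (y ^ 2 * (1 / (1 - y) ^ 2 + 1 / (1 - y)) + y) * (1 - y) ^ 2" by simp
    also have "\<dots> = y ^ 2 * (1 + (1 - y)) + y * (1 - y) ^ 2"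
      using cancel[OF n] .
    also have "\<dots> = y" by (simp add: power2_eq_square algebra_simps)
    finally show ?thesis by (simp add: power2_eq_square power3_eq_cube algebra_simps)
  qed
  then have "A = y / ((1 - y) ^ 3 * (1 + y))" using assms by (simp add: eq_divide_eq)
  with A show ?thesis by simp
qed

text \<open>Each of the \<open>m! / 2\<close> cycles contributes \<open>dist_sum m\<close>. For
  \<open>m = 1\<close> there is one edge instead of half a cycle, hence the correction by
  \<open>1 / 2\<close>.\<close>

lemma sum_sp_objects:
  "(\<Sum>b\<in>objects m. real (sp b)) / fact m = real (dist_sum m) / 2 + (if m = 1 then 1 / 2 else 0)"
proof -
  consider "m = 0" | "m = 1" | "2 \<le> m" by linarith
  then show ?thesis
  proof cases
    case 1
    then show ?thesis by (simp add: sum_objects)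
  next
    case 2
    have "graph_dist ({0, Suc 0}, {{0, Suc 0}}) 0 (Suc 0) = Suc 0"
      by (rule graph_dist_eqI[where h = "\<lambda>x. x"]) (auto simp: adj_def doubleton_eq_iff)
    then show ?thesis using 2 block_edges_pair[of 0 "Suc 0"] by (simp add: sum_objects sp_def)
  next
    case 3
    have "2 * (\<Sum>b\<in>objects m. real (sp b)) =
        2 * (\<Sum>E\<in>block_edges (insert 0 {1..m}). \<Sum>r\<in>{1..m}. real (graph_dist (insert 0 {1..m}, E) 0 r))"
      by (simp add: sum_objects sp_def)
    also have "\<dots> = (\<Sum>xs\<in>permutations_of_set {1..m}. \<Sum>r\<in>{1..m}. real (graph_dist (insert 0 {1..m}, cycle_through 0 xs) 0 r))"
      by (rule sum_over_cycles) (use 3 in auto)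
    also have "\<dots> = (\<Sum>xs\<in>permutations_of_set {1..m}. real (dist_sum m))"
    proof (rule sum.cong[OF refl])
      fix xs assume "xs \<in> permutations_of_set {1..m}"
      then have xs: "set xs = {1..m}" "distinct xs" by (auto simp: permutations_of_set_def)
      then have "length xs = m" by (metis card_atLeastAtMost diff_Suc_1 distinct_card)
      then show "(\<Sum>r\<in>{1..m}. real (graph_dist (insert 0 {1..m}, cycle_through 0 xs) 0 r)) = real (dist_sum m)"
        using sum_graph_dist_cycle[of 0 xs "insert 0 {1..m}"] xs by (simp flip: of_nat_sum)
    qed
    also have "\<dots> = fact m * real (dist_sum m)" by simp
    finally show ?thesis using 3 by (simp add: field_simps)
  qed
qed

lemma kappa_eq: "kappa tau = tau / 2 * (1 + 1 / ((1 - tau) ^ 3 * (1 + tau)))"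
  unfolding kappa_def
proof (rule expectation_boltzmann)
  have "(\<lambda>m. real (dist_sum m) * tau ^ m / 2 + (if m = 1 then tau / 2 else 0)) sums
      (tau / ((1 - tau) ^ 3 * (1 + tau)) / 2 + tau / 2)"
    by (intro sums_add sums_divide dist_sum_sums tau_01 sums_single)
  also have "tau / ((1 - tau) ^ 3 * (1 + tau)) / 2 + tau / 2 = tau / 2 * (1 + 1 / ((1 - tau) ^ 3 * (1 + tau)))"
    by (simp add: distrib_left)
  also have "(\<lambda>m. real (dist_sum m) * tau ^ m / 2 + (if m = 1 then tau / 2 else 0)) =
      (\<lambda>m. (\<Sum>b\<in>objects m. real (sp b)) / fact m * tau ^ m)"
    unfolding sum_sp_objects by (auto simp: fun_eq_iff distrib_right)
  finally show "(\<lambda>m. (\<Sum>b\<in>objects m. real (sp b)) / fact m * tau ^ m) sums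
      (tau / 2 * (1 + 1 / ((1 - tau) ^ 3 * (1 + tau))))" .
qed simp

text \<open>The explicit value and the claimed fraction agree only by virtue of the cubic, used as
  \<open>tau * q = 2 * (1 - tau) ^ 2\<close> to trade one factor of the denominator for
  another.\<close>

lemma kappa_closed_form:
  "kappa tau = (tau ^ 4 - 2 * tau ^ 3 + 2 * tau - 2) / ((tau\<^sup>2 - 2 * tau + 2) * (1 + tau) * (tau - 1))"
proof -
  define q w where "q = tau\<^sup>2 - 2 * tau + 2" and "w = (1 - tau) ^ 3 * (1 + tau) + 1"
  have n: "1 - tau \<noteq> 0" "1 + tau \<noteq> 0" "tau \<noteq> 0" using tau_01 by auto
  have yq: "tau * q = 2 * (1 - tau) ^ 2"
    using tau_root by (simp add: q_def power2_eq_square power3_eq_cube algebra_simps)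
  then have q: "q \<noteq> 0" using n by auto
  have w: "tau ^ 4 - 2 * tau ^ 3 + 2 * tau - 2 = - w"
    by (simp add: w_def power2_eq_square power3_eq_cube power4_eq_xxxx algebra_simps)
  have "kappa tau = tau * w / (2 * (1 - tau) ^ 2 * ((1 - tau) * (1 + tau)))"
  proof -
    define X where "X = (1 - tau) ^ 3 * (1 + tau)"
    have "X \<noteq> 0" using n by (simp add: X_def)
    moreover have "2 * (1 - tau) ^ 2 * ((1 - tau) * (1 + tau)) = 2 * X"
      by (simp add: X_def power2_eq_square power3_eq_cube)
    ultimately show ?thesis unfolding kappa_eq w_def X_def[symmetric] by (simp add: field_simps)
  qed
  also have "\<dots> = w / (q * ((1 - tau) * (1 + tau)))"
    unfolding yq[symmetric] using n by simp
  also have "\<dots> = - w / (q * (1 + tau) * (tau - 1))"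
    using n q by (simp add: divide_simps) (simp add: algebra_simps)
  finally show ?thesis unfolding w q_def .
qed

lemma numeric_bounds:
  "\<bar>tau / 2 * (1 + 1 / ((1 - tau) ^ 3 * (1 + tau))) - 1.20297\<bar> < 1 / 10 ^ 5"
  "\<bar>1 + 1 / (1 - tau) ^ 3 * tau\<^sup>2 - 2.29559\<bar> < 1 / 10 ^ 5"
proof -
  define lo hi :: real where "lo = 456310987 / 10 ^ 9" and "hi = 456310988 / 10 ^ 9"
  have b: "lo \<le> tau" "tau \<le> hi" using tau_bounds by (auto simp: lo_def hi_def)
  have lh: "0 < lo" "hi < 1" by (simp_all add: lo_def hi_def)
  have c: "(1 - hi) ^ 3 \<le> (1 - tau) ^ 3" "(1 - tau) ^ 3 \<le> (1 - lo) ^ 3" "0 < (1 - hi) ^ 3" "0 < (1 - lo) ^ 3"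
    using b lh by (auto intro!: power_mono)
  \<comment> \<open>The factor \<open>1 - tau\<close> decreases in \<open>tau\<close> while
    \<open>1 + tau\<close> increases. Each is bounded separately, which explains the mixture of
    \<open>lo\<close> and \<open>hi\<close>.\<close>
  have d: "1 / ((1 - lo) ^ 3 * (1 + hi)) \<le> 1 / ((1 - tau) ^ 3 * (1 + tau))"
      "1 / ((1 - tau) ^ 3 * (1 + tau)) \<le> 1 / ((1 - hi) ^ 3 * (1 + lo))"
    using b lh c by (intro divide_left_mono mult_mono mult_pos_pos; simp)+
  have e: "1 / (1 - lo) ^ 3 \<le> 1 / (1 - tau) ^ 3" "1 / (1 - tau) ^ 3 \<le> 1 / (1 - hi) ^ 3"
    using b lh c by (intro divide_left_mono; simp)+
  have k: "lo / 2 * (1 + 1 / ((1 - lo) ^ 3 * (1 + hi))) \<le> tau / 2 * (1 + 1 / ((1 - tau) ^ 3 * (1 + tau)))"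
      "tau / 2 * (1 + 1 / ((1 - tau) ^ 3 * (1 + tau))) \<le> hi / 2 * (1 + 1 / ((1 - hi) ^ 3 * (1 + lo)))"
    using b lh c d by (intro mult_mono add_mono; simp)+
  have "1.20296 < lo / 2 * (1 + 1 / ((1 - lo) ^ 3 * (1 + hi)))"
      "hi / 2 * (1 + 1 / ((1 - hi) ^ 3 * (1 + lo))) < 1.20298"
    by (simp_all add: lo_def hi_def power3_eq_cube)
  note order.strict_trans2[OF this(1) k(1)] order.strict_trans1[OF k(2) this(2)]
  moreover have "\<bar>K - 1.20297\<bar> < 1 / 10 ^ 5" if "1.20296 < K" "K < 1.20298" for K :: real
    unfolding abs_less_iff using that by (intro conjI; simp)
  ultimately show "\<bar>tau / 2 * (1 + 1 / ((1 - tau) ^ 3 * (1 + tau))) - 1.20297\<bar> < 1 / 10 ^ 5" by blast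
  have k: "1 / (1 - lo) ^ 3 * lo\<^sup>2 \<le> 1 / (1 - tau) ^ 3 * tau\<^sup>2" "1 / (1 - tau) ^ 3 * tau\<^sup>2 \<le> 1 / (1 - hi) ^ 3 * hi\<^sup>2"
    using b lh c e by (intro mult_mono power_mono; simp)+
  have "1.29558 < 1 / (1 - lo) ^ 3 * lo\<^sup>2" "1 / (1 - hi) ^ 3 * hi\<^sup>2 < 1.2956"
    by (simp_all add: lo_def hi_def power3_eq_cube power2_eq_square)
  note order.strict_trans2[OF this(1) k(1)] order.strict_trans1[OF k(2) this(2)]
  moreover have "\<bar>1 + K - 2.29559\<bar> < 1 / 10 ^ 5" if "1.29558 < K" "K < 1.2956" for K :: real
    unfolding abs_less_iff using that by (intro conjI; simp)
  ultimately show "\<bar>1 + 1 / (1 - tau) ^ 3 * tau\<^sup>2 - 2.29559\<bar> < 1 / 10 ^ 5" by blast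
qed

text \<open>Since \<open>rho\<close> is the radius of convergence itself, summability at
  \<open>rho\<close> is claimed separately; it ensures that \<open>y\<close> is the value of a
  convergent series.\<close>

theorem proposition8p5:
  fixes y :: real
  assumes y_def: "y = eval_fps C_pointed rho"
  shows "(\<forall>z::real. \<bar>z\<bar> < 1 \<longrightarrow> (\<lambda>n. fps_nth (fps_deriv B_egf) n * z ^ n) sums B1 z) \<and>
    summable (\<lambda>n. fps_nth C_pointed n * rho ^ n) \<and>
    {z::real. 0 < z \<and> ereal z < fps_conv_radius B_egf \<and>
            z * eval_fps (fps_deriv (fps_deriv B_egf)) z = 1} = {y} \<and>
    {z::real. 0 < z \<and> z \<noteq> 1 \<and> z * deriv B1 z = 1} = {y} \<and>
    kappa y = (y ^ 4 - 2 * y ^ 3 + 2 * y - 2) / ((y\<^sup>2 - 2 * y + 2) * (1 + y) * (y - 1)) \<and>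
    \<bar>kappa y - 1.20297\<bar> < 1 / 10 ^ 5 \<and>
    sigma_sq y = 1 + eval_fps (fps_deriv (fps_deriv (fps_deriv B_egf))) y * y\<^sup>2 \<and>
    \<bar>sigma_sq y - 2.29559\<bar> < 1 / 10 ^ 5"
proof -
  have y: "y = tau" using y_def C_pointed_at_rho(2) by simp
  have "eval_fps (fps_deriv (fps_deriv (fps_deriv B_egf))) tau = 1 / (1 - tau) ^ 3"
    using tau_01 by (intro eval_B3) simp
  then have sigma: "\<bar>sigma_sq tau - 2.29559\<bar> < 1 / 10 ^ 5"
    unfolding sigma_sq_eq using numeric_bounds(2) by simp
  have kappa: "\<bar>kappa tau - 1.20297\<bar> < 1 / 10 ^ 5"
    unfolding kappa_eq by (rule numeric_bounds(1))
  show ?thesis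
    unfolding y
    by (intro conjI allI impI deriv_B_egf_sums C_pointed_at_rho(1) characteristic_solutions
        kappa_closed_form kappa sigma_sq_eq sigma)
qed

end
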